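(* (1) The data of a dg counital coassociative coalgebra $(C,\Delta,\epsilon,d_C)$ is equivalent to the data of a dg cooperad $(\mathcal{C},\Delta_{\mathcal{C}},\epsilon,d_{\mathcal{C}})$ whose underlying dg $\mathbb{S}$-module $\mathcal{C}$ is concentrated in arity one. (2) If $\mathcal{C}$ is the dg cooperad concentrated in arity one corresponding to $C$, then the definition of a dg $C$-contramodule is equivalent to the definition of a dg $\mathcal{C}$-algebra.
   Context: $\Bbbk$ is a field of characteristic $0$. A dg cooperad is a comonoid in dg $\mathbb{S}$-modules for the composition product $\circ$. For a dg $\mathbb{S}$-module $M$ put $\widehat{\mathscr{S}}^c(M)(V)=\prod_{n\ge0}\mathrm{Hom}_{\mathbb{S}_n}(M(n),V^{\otimes n})$ on dg modules; this is lax monoidal in $M$ via natural maps $\varphi_{M,N}:\widehat{\mathscr{S}}^c(M)\circ\widehat{\mathscr{S}}^c(N)\to\widehat{\mathscr{S}}^c(M\circ N)$, so for a dg cooperad $\mathcal{C}$ the endofunctor $\widehat{\mathscr{S}}^c(\mathcal{C})$ is a monad (with multiplication $\widehat{\mathscr{S}}^c(\Delta_{\mathcal{C}})\circ\varphi_{\mathcal{C},\mathcal{C}}$ and unit induced by the counit). A dg $\mathcal{C}$-algebra is an algebra over this monad. For a dg counital coassociative coalgebra $C$, a dg $C$-contramodule is a dg module $(M,d_M)$ with a morphism of dg modules $\gamma_M:\mathrm{Hom}(C,M)\to M$ such that (i) $\gamma_M\circ\Delta^*:\mathrm{Hom}(C\otimes C,M)\to M$ equals $\gamma_M\circ(\gamma_M)_*\circ\varsigma$,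 where $\varsigma:\mathrm{Hom}(C\otimes C,M)\cong\mathrm{Hom}(C,\mathrm{Hom}(C,M))$; and (ii) $\gamma_M\circ\epsilon^*:M\cong\mathrm{Hom}(\Bbbk,M)\to M$ is the identity. There are two choices of the isomorphism $\varsigma$ (depending on which tensor factor is used for the outer Hom), giving left and right contramodules; one of them is fixed, compatibly with the convention for $\varphi$. *)

theory Defs
  imports
    "HOL.Vector_Spaces"
    "HOL-Library.Function_Algebras"
    "HOL-Combinatorics.Permutations"
begin

section \<open>Vector spaces presented by generators and relations\<close>

text \<open>
  Tensor products and composition products are vector spaces presented by generators
  \<open>x :: 'x\<close> and linear relations. Over a field such a space embeds in the dual of the space \<open>F\<close> of
  those functions \<open>'x \<Rightarrow> 'k\<close> that kill all relations, and its image is the span of the evaluations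
  \<open>ev F x\<close>. This image is used as the model; its universal property is \<open>ev_universal\<close>.
  A linear map given on generators by \<open>h\<close> is \<open>T \<mapsto> bind T h\<close>.
\<close>

type_synonym ('x, 'k) formal = "('x \<Rightarrow> 'k) \<Rightarrow> 'k"

definition fscale :: "'k::field \<Rightarrow> ('x, 'k) formal \<Rightarrow> ('x, 'k) formal" where
  "fscale c T = (\<lambda>\<Phi>. c * T \<Phi>)"

definition ev :: "('x \<Rightarrow> 'k) set \<Rightarrow> 'x \<Rightarrow> ('x, 'k::field) formal" where
  "ev F x = (\<lambda>\<Phi>. if \<Phi> \<in> F then \<Phi> x else 0)"

definition bind :: "('x, 'k) formal \<Rightarrow> ('x \<Rightarrow> ('y, 'k) formal) \<Rightarrow> ('y, 'k) formal" where
  "bind T h = (\<lambda>\<Phi>. T (\<lambda>x. h x \<Phi>))"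

lemma vector_space_fscale: "vector_space (fscale :: 'k::field \<Rightarrow> ('x, 'k) formal \<Rightarrow> _)"
  by unfold_locales (auto simp: fscale_def fun_eq_iff algebra_simps)

lemma functional_separates:
  fixes sW :: "'k::field \<Rightarrow> 'w::ab_group_add \<Rightarrow> 'w"
  assumes "vector_space sW" and "\<And>l. Vector_Spaces.linear sW (*) l \<Longrightarrow> l w = 0"
  shows "w = 0"
proof (rule ccontr)
  assume w: "w \<noteq> 0"
  interpret W: vector_space sW by fact
  interpret k: vector_space "(*) :: 'k \<Rightarrow> 'k \<Rightarrow> 'k"
    by unfold_locales (auto simp: algebra_simps)
  interpret Wk: vector_space_pair sW "(*) :: 'k \<Rightarrow> 'k \<Rightarrow> 'k" ..
  have "W.independent {w}"
    using w by simp
  then obtain l where "Vector_Spaces.linear sW (*) l" "\<forall>x\<in>{w}. l x = (1::'k)"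
    using Wk.linear_independent_extend[of "{w}" "\<lambda>_. 1"] by blast
  then show False
    using assms(2)[of l] by auto
qed

lemma ev_universal:
  fixes sW :: "'k::field \<Rightarrow> 'w::ab_group_add \<Rightarrow> 'w" and h :: "'x \<Rightarrow> 'w" and F :: "('x \<Rightarrow> 'k) set"
  assumes W: "vector_space sW"
    and h: "\<And>l. Vector_Spaces.linear sW (*) l \<Longrightarrow> (\<lambda>x. l (h x)) \<in> F"
  shows "\<exists>g. Vector_Spaces.linear fscale sW g \<and> (\<forall>x. g (ev F x) = h x)"
proof -
  interpret W: vector_space sW by fact
  interpret T: vector_space "fscale :: 'k \<Rightarrow> ('x, 'k) formal \<Rightarrow> _"
    by (rule vector_space_fscale)
  interpret TW: vector_space_pair "fscale :: 'k \<Rightarrow> ('x, 'k) formal \<Rightarrow> _" sW ..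
  obtain B where B: "B \<subseteq> range (ev F)" "T.independent B" "range (ev F) \<subseteq> T.span B"
    using T.maximal_independent_subset by blast
  define r where "r b = (SOME x. ev F x = b)" for b
  have r: "ev F (r b) = b" if "b \<in> B" for b
    unfolding r_def by (rule someI_ex) (use that B in auto)
  obtain g where g: "Vector_Spaces.linear fscale sW g" "\<forall>b\<in>B. g b = h (r b)"
    using TW.linear_independent_extend[OF B(2), of "\<lambda>b. h (r b)"] by blast
  interpret g: Vector_Spaces.linear fscale sW g by (rule g)
  have "g (ev F x) - h x = 0" for x
  proof (rule functional_separates[OF W])
    fix l assume l: "Vector_Spaces.linear sW (*) l"
    interpret l: Vector_Spaces.linear sW "(*)" l by fact
    have "ev F x \<in> T.span B" using B by auto
    then obtain t c where t: "finite t" "t \<subseteq> B" "ev F x = (\<Sum>b\<in>t. fscale (c b) b)"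
      unfolding T.span_explicit by auto
    define \<Phi> where "\<Phi> = (\<lambda>x. l (h x))"
    have \<Phi>: "\<Phi> \<in> F" unfolding \<Phi>_def by (rule h[OF l])
    have app: "(\<Sum>b\<in>t. f b) \<Phi> = (\<Sum>b\<in>t. f b \<Phi>)" for f :: "('x, 'k) formal \<Rightarrow> ('x, 'k) formal"
      using t(1) by induction auto
    have b: "b \<Phi> = l (h (r b))" if "b \<in> t" for b
    proof -
      have "b \<Phi> = ev F (r b) \<Phi>" using r that t(2) by auto
      also have "\<dots> = l (h (r b))" using \<Phi> by (simp only: ev_def if_True \<Phi>_def)
      finally show ?thesis .
    qed
    have "l (h x) = ev F x \<Phi>" using \<Phi> by (simp add: ev_def \<Phi>_def)
    also have "\<dots> = (\<Sum>b\<in>t. c b * l (h (r b)))"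
      unfolding t(3) app by (intro sum.cong) (auto simp: fscale_def b)
    also have "\<dots> = l (g (ev F x))"
      unfolding t(3) g.sum l.sum g.scale l.scale
      using g(2) t(2) by (intro sum.cong) auto
    finally show "l (g (ev F x) - h x) = 0" by (simp add: l.diff)
  qed
  then show ?thesis using g(1) by auto
qed


section \<open>Dg modules\<close>

text \<open>
  A dg module is a family of subspaces of an ambient vector space \<open>'a\<close>, indexed by the degree;
  the components of different degrees need not be disjoint or independent in \<open>'a\<close>, and therefore
  graded maps take the degree of their argument as an argument. Differentials have degree \<open>-1\<close>.
  Maps that are data of a structure or elements of a Hom module are \<open>0\<close> outside of their domain, so
  that they are equal iff they agree on the domain.
\<close>

record ('k, 'a) dgmod =
  scl :: "'k \<Rightarrow> 'a \<Rightarrow> 'a"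
  grd :: "int \<Rightarrow> 'a set"
  dif :: "int \<Rightarrow> 'a \<Rightarrow> 'a"

definition linear_between ::
  "('k \<Rightarrow> 'a \<Rightarrow> 'a) \<Rightarrow> ('k \<Rightarrow> 'b \<Rightarrow> 'b) \<Rightarrow> 'a set \<Rightarrow> 'b set \<Rightarrow> ('a::plus \<Rightarrow> 'b::plus) \<Rightarrow> bool" where
  "linear_between s t A B f \<longleftrightarrow> f ` A \<subseteq> B \<and> (\<forall>x\<in>A. \<forall>y\<in>A. f (x + y) = f x + f y)
     \<and> (\<forall>c. \<forall>x\<in>A. f (s c x) = t c (f x))"

definition dg_module :: "('k::field_char_0, 'a::ab_group_add) dgmod \<Rightarrow> bool" where
  "dg_module V \<longleftrightarrow> vector_space (scl V)
     \<and> (\<forall>i. module.subspace (scl V) (grd V i))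
     \<and> (\<forall>i. linear_between (scl V) (scl V) (grd V i) (grd V (i - 1)) (dif V i))
     \<and> (\<forall>i. \<forall>x\<in>grd V i. dif V (i - 1) (dif V i x) = 0)"

definition hom_deg ::
  "('k, 'a::ab_group_add) dgmod \<Rightarrow> ('k, 'b::ab_group_add) dgmod \<Rightarrow> int \<Rightarrow> (int \<Rightarrow> 'a \<Rightarrow> 'b) set" where
  "hom_deg V W p = {f. \<forall>i. linear_between (scl V) (scl W) (grd V i) (grd W (i + p)) (f i)
     \<and> (\<forall>x. x \<notin> grd V i \<longrightarrow> f i x = 0)}"

definition hom_dif ::
  "('k::field, 'a) dgmod \<Rightarrow> ('k, 'b) dgmod \<Rightarrow> int \<Rightarrow> (int \<Rightarrow> 'a \<Rightarrow> 'b::ab_group_add) \<Rightarrow> int \<Rightarrow> 'a \<Rightarrow> 'b"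
  where
  "hom_dif V W p f = (\<lambda>i x. if x \<in> grd V i
     then dif W (i + p) (f i x) - scl W ((-1) powi p) (f (i - 1) (dif V i x)) else 0)"

definition hom_mod :: "('k::field, 'a::ab_group_add) dgmod \<Rightarrow> ('k, 'b::ab_group_add) dgmod
    \<Rightarrow> ('k, int \<Rightarrow> 'a \<Rightarrow> 'b) dgmod" where
  "hom_mod V W = \<lparr>scl = (\<lambda>c f i x. scl W c (f i x)), grd = hom_deg V W, dif = hom_dif V W\<rparr>"

definition dg_mor :: "('k, 'a::ab_group_add) dgmod \<Rightarrow> ('k, 'b::ab_group_add) dgmod
    \<Rightarrow> (int \<Rightarrow> 'a \<Rightarrow> 'b) set" where
  "dg_mor V W = {f \<in> hom_deg V W 0.
     \<forall>i. \<forall>x\<in>grd V i. f (i - 1) (dif V i x) = dif W i (f i x)}"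

definition unit_mod :: "('k::field, 'k) dgmod" where
  "unit_mod = \<lparr>scl = (*), grd = (\<lambda>i. if i = 0 then UNIV else {0}), dif = (\<lambda>_ _. 0)\<rparr>"


section \<open>Tensor powers\<close>

text \<open>A generator of the tensor power is a list of elements labelled with their degrees.\<close>

type_synonym ('a, 'k) tensor = "((int \<times> 'a) list, 'k) formal"

definition multilinear_forms ::
  "('k::field, 'a::ab_group_add) dgmod \<Rightarrow> nat \<Rightarrow> ((int \<times> 'a) list \<Rightarrow> 'k) set" where
  "multilinear_forms V n = {\<Phi>. \<forall>l r i. Suc (length l + length r) = n \<longrightarrow>
     (\<forall>(j, v)\<in>set (l @ r). v \<in> grd V j) \<longrightarrow>
     linear_between (scl V) (*) (grd V i) UNIV (\<lambda>x. \<Phi> (l @ (i, x) # r))}"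

definition pure_tensor ::
  "('k::field, 'a::ab_group_add) dgmod \<Rightarrow> (int \<times> 'a) list \<Rightarrow> ('a, 'k) tensor" where
  "pure_tensor V vs = ev (multilinear_forms V (length vs)) vs"

definition tensor_power ::
  "('k::field, 'a::ab_group_add) dgmod \<Rightarrow> nat \<Rightarrow> ('k, ('a, 'k) tensor) dgmod" where
  "tensor_power V n = \<lparr>scl = fscale,
     grd = (\<lambda>d. module.span fscale {pure_tensor V vs | vs. length vs = n
              \<and> (\<forall>(j, v)\<in>set vs. v \<in> grd V j) \<and> sum_list (map fst vs) = d}),
     dif = (\<lambda>_ T. bind T (\<lambda>vs. \<Sum>j<length vs. case vs ! j of (i, v) \<Rightarrow>
              fscale ((-1) powi sum_list (take j (map fst vs)))
                (pure_tensor V (vs[j := (i - 1, dif V i v)]))))\<rparr>"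

text \<open>The sign in \<open>(v\<^sub>0 \<otimes> \<dots> \<otimes> v\<^sub>n\<^sub>-\<^sub>1) \<cdot> \<sigma> = \<plusminus> v\<^bsub>\<sigma> 0\<^esub> \<otimes> \<dots> \<otimes> v\<^bsub>\<sigma> (n - 1)\<^esub>\<close>, where \<open>v\<^sub>i\<close> has degree \<open>ds ! i\<close>.\<close>

definition koszul_sign :: "(nat \<Rightarrow> nat) \<Rightarrow> int list \<Rightarrow> 'k::field" where
  "koszul_sign \<sigma> ds = (\<Prod>(i, j)\<in>{(i, j). i < j \<and> j < length ds \<and> \<sigma> j < \<sigma> i}.
     (-1) powi (ds ! \<sigma> i * ds ! \<sigma> j))"

text \<open>The sign of \<open>x\<^sub>1 \<otimes> \<dots> \<otimes> x\<^sub>k \<otimes> y\<^sub>1 \<otimes> \<dots> \<otimes> y\<^sub>k \<mapsto> x\<^sub>1 \<otimes> y\<^sub>1 \<otimes> \<dots> \<otimes> x\<^sub>k \<otimes> y\<^sub>k\<close>.\<close>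

definition shuffle_sign :: "int list \<Rightarrow> int list \<Rightarrow> 'k::field" where
  "shuffle_sign xs ys = (\<Prod>(i, j)\<in>{(i, j). i < j \<and> j < length xs}. (-1) powi (ys ! i * xs ! j))"

definition tensor_perm :: "('k::field, 'a::ab_group_add) dgmod \<Rightarrow> (nat \<Rightarrow> nat) \<Rightarrow>
    ('a, 'k) tensor \<Rightarrow> ('a, 'k) tensor" where
  "tensor_perm V \<sigma> T = bind T (\<lambda>vs.
     fscale (koszul_sign \<sigma> (map fst vs)) (pure_tensor V (permute_list \<sigma> vs)))"

definition tensor_map :: "('k::field, 'b::ab_group_add) dgmod \<Rightarrow> (int \<Rightarrow> 'a \<Rightarrow> 'b) \<Rightarrow>
    ('a, 'k) tensor \<Rightarrow> ('b, 'k) tensor" where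
  "tensor_map W f T = bind T (\<lambda>vs. pure_tensor W (map (\<lambda>(i, v). (i, f i v)) vs))"

definition tensor_append :: "('k::field, 'a::ab_group_add) dgmod \<Rightarrow>
    ('a, 'k) tensor \<Rightarrow> ('a, 'k) tensor \<Rightarrow> ('a, 'k) tensor" where
  "tensor_append V S T = bind S (\<lambda>xs. bind T (\<lambda>ys. pure_tensor V (xs @ ys)))"

definition tensor_concat :: "('k::field, 'a::ab_group_add) dgmod \<Rightarrow>
    ('a, 'k) tensor list \<Rightarrow> ('a, 'k) tensor" where
  "tensor_concat V Ts = foldr (tensor_append V) Ts (pure_tensor V [])"


section \<open>Dg S-modules and the composition product\<close>

text \<open>
  The symmetric group on \<open>{..<n}\<close> acts on \<open>M(n)\<close> from the right. In the notation of operations,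
  input \<open>i\<close> of \<open>\<mu> \<cdot> \<sigma>\<close> is input \<open>\<sigma> i\<close> of \<open>\<mu>\<close>, in accordance with \<open>tensor_perm\<close>.
\<close>

record ('k, 'a) smod =
  arity :: "nat \<Rightarrow> ('k, 'a) dgmod"
  act :: "nat \<Rightarrow> (nat \<Rightarrow> nat) \<Rightarrow> int \<Rightarrow> 'a \<Rightarrow> 'a"

definition dg_smodule :: "('k::field_char_0, 'a::ab_group_add) smod \<Rightarrow> bool" where
  "dg_smodule M \<longleftrightarrow> (\<forall>n. dg_module (arity M n) \<and>
     (\<forall>\<sigma> i. \<sigma> permutes {..<n} \<longrightarrow>
        linear_between (scl (arity M n)) (scl (arity M n)) (grd (arity M n) i) (grd (arity M n) i)
          (act M n \<sigma> i)) \<and>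
     (\<forall>i. \<forall>x\<in>grd (arity M n) i. act M n id i x = x \<and>
        (\<forall>\<sigma>. \<sigma> permutes {..<n} \<longrightarrow>
           dif (arity M n) i (act M n \<sigma> i x) = act M n \<sigma> (i - 1) (dif (arity M n) i x) \<and>
           (\<forall>\<tau>. \<tau> permutes {..<n} \<longrightarrow> act M n (\<sigma> \<circ> \<tau>) i x = act M n \<tau> i (act M n \<sigma> i x)))))"

definition smod_mor :: "('k, 'a::ab_group_add) smod \<Rightarrow> ('k, 'b::ab_group_add) smod
    \<Rightarrow> (nat \<Rightarrow> int \<Rightarrow> 'a \<Rightarrow> 'b) set" where
  "smod_mor M N = {f. \<forall>n. f n \<in> dg_mor (arity M n) (arity N n) \<and>
     (\<forall>\<sigma> i. \<forall>x\<in>grd (arity M n) i. \<sigma> permutes {..<n} \<longrightarrow>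
        f n i (act M n \<sigma> i x) = act N n \<sigma> i (f n i x))}"

definition in_arity_one :: "('k, 'a::zero) dgmod \<Rightarrow> ('k, 'a) smod" where
  "in_arity_one V = \<lparr>arity = (\<lambda>n. if n = 1 then V else V\<lparr>grd := \<lambda>_. {0}, dif := \<lambda>_ _. 0\<rparr>),
     act = (\<lambda>_ _ _ x. x)\<rparr>"

definition concentrated_in_arity_one :: "('k::field_char_0, 'a::ab_group_add) smod \<Rightarrow> bool" where
  "concentrated_in_arity_one M \<longleftrightarrow>
     dg_smodule M \<and> (\<forall>n i. n \<noteq> 1 \<longrightarrow> grd (arity M n) i = {0})"

definition unit_smod :: "('k::field, 'k) smod" where
  "unit_smod = in_arity_one unit_mod"

text \<open>
  The composition product is
  \<open>(M \<circ> N)(n) = \<Oplus>\<^sub>k M(k) \<otimes>\<^bsub>S\<^sub>k\<^esub> (\<Oplus> Ind (N(a\<^sub>1) \<otimes> \<dots> \<otimes> N(a\<^sub>k)))\<close>, with the inner sum over \<open>a\<^sub>1 + \<dots> + a\<^sub>k = n\<close> and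
  \<open>Ind\<close> the induction from \<open>S\<^bsub>a\<^sub>1\<^esub> \<times> \<dots> \<times> S\<^bsub>a\<^sub>k\<^esub>\<close> to \<open>S\<^sub>n\<close>. A generator \<open>(\<mu>; \<nu>\<^sub>1, \<dots>, \<nu>\<^sub>k; \<sigma>)\<close> stands for
  \<open>(\<mu> \<otimes> \<nu>\<^sub>1 \<otimes> \<dots> \<otimes> \<nu>\<^sub>k) \<cdot> \<sigma>\<close>. It is labelled with the degrees of \<open>\<mu>\<close> and the \<open>\<nu>\<^sub>j\<close> and the arity of each
  \<open>\<nu>\<^sub>j\<close>.
\<close>

type_synonym ('a, 'b) cgen = "(int \<times> 'a) \<times> (nat \<times> int \<times> 'b) list \<times> (nat \<Rightarrow> nat)"

abbreviation arities_of :: "(nat \<times> int \<times> 'b) list \<Rightarrow> nat list" where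
  "arities_of \<nu>s \<equiv> map fst \<nu>s"

abbreviation degrees_of :: "(nat \<times> int \<times> 'b) list \<Rightarrow> int list" where
  "degrees_of \<nu>s \<equiv> map (\<lambda>\<nu>. fst (snd \<nu>)) \<nu>s"

definition is_cgen :: "('k, 'a) smod \<Rightarrow> ('k, 'b) smod \<Rightarrow> nat \<Rightarrow> int \<Rightarrow> ('a, 'b) cgen \<Rightarrow> bool" where
  "is_cgen M N n d = (\<lambda>((p, \<mu>), \<nu>s, \<sigma>).
     \<mu> \<in> grd (arity M (length \<nu>s)) p \<and> (\<forall>(a, q, \<nu>)\<in>set \<nu>s. \<nu> \<in> grd (arity N a) q)
     \<and> \<sigma> permutes {..<n} \<and> sum_list (arities_of \<nu>s) = n \<and> p + sum_list (degrees_of \<nu>s) = d)"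

definition chunks :: "nat list \<Rightarrow> 'x list \<Rightarrow> 'x list list" where
  "chunks ns xs = map (\<lambda>j. take (ns ! j) (drop (sum_list (take j ns)) xs)) [0..<length ns]"

definition list_perm :: "nat list \<Rightarrow> nat \<Rightarrow> nat" where
  "list_perm is = (\<lambda>i. if i < length is then is ! i else i)"

text \<open>The permutation of blocks of lengths \<open>ns\<close> induced by \<open>\<tau>\<close>, and the block sum of permutations.\<close>

definition block_perm :: "(nat \<Rightarrow> nat) \<Rightarrow> nat list \<Rightarrow> nat \<Rightarrow> nat" where
  "block_perm \<tau> ns = list_perm (concat (permute_list \<tau> (chunks ns [0..<sum_list ns])))"

definition perm_sum :: "(nat \<Rightarrow> nat) list \<Rightarrow> nat list \<Rightarrow> nat \<Rightarrow> nat" where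
  "perm_sum \<tau>s ns = list_perm (concat (map2 permute_list \<tau>s (chunks ns [0..<sum_list ns])))"

text \<open>
  The relations are multilinearity, \<open>(\<mu>; \<nu>\<^sub>1 \<cdot> \<tau>\<^sub>1, \<dots>, \<nu>\<^sub>k \<cdot> \<tau>\<^sub>k; \<sigma>) = (\<mu>; \<nu>\<^sub>1, \<dots>, \<nu>\<^sub>k; (\<tau>\<^sub>1 \<oplus> \<dots> \<oplus> \<tau>\<^sub>k) \<circ> \<sigma>)\<close>, and
  \<open>(\<mu> \<cdot> \<tau>; (\<nu>\<^sub>1, \<dots>, \<nu>\<^sub>k) \<cdot> \<tau>; \<sigma>) = (\<mu>; \<nu>\<^sub>1, \<dots>, \<nu>\<^sub>k; \<tau>' \<circ> \<sigma>)\<close>, with \<open>\<tau>'\<close> the permutation of blocks.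
\<close>

definition cforms :: "('k::field, 'a::ab_group_add) smod \<Rightarrow> ('k, 'b::ab_group_add) smod \<Rightarrow> nat
    \<Rightarrow> (('a, 'b) cgen \<Rightarrow> 'k) set" where
  "cforms M N n = {\<Phi>.
     (\<forall>p \<nu>s \<sigma>. (\<exists>d. is_cgen M N n d ((p, 0), \<nu>s, \<sigma>)) \<longrightarrow>
        linear_between (scl (arity M (length \<nu>s))) (*) (grd (arity M (length \<nu>s)) p) UNIV
          (\<lambda>x. \<Phi> ((p, x), \<nu>s, \<sigma>))) \<and>
     (\<forall>p \<mu> l a q r \<sigma>. (\<exists>d. is_cgen M N n d ((p, \<mu>), l @ (a, q, 0) # r, \<sigma>)) \<longrightarrow>
        linear_between (scl (arity N a)) (*) (grd (arity N a) q) UNIV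
          (\<lambda>x. \<Phi> ((p, \<mu>), l @ (a, q, x) # r, \<sigma>))) \<and>
     (\<forall>p \<mu> \<nu>s \<sigma>. (\<exists>d. is_cgen M N n d ((p, \<mu>), \<nu>s, \<sigma>)) \<longrightarrow>
        (\<forall>\<tau>s. list_all2 (\<lambda>\<tau> a. \<tau> permutes {..<a}) \<tau>s (arities_of \<nu>s) \<longrightarrow>
           \<Phi> ((p, \<mu>), map2 (\<lambda>\<tau> (a, q, \<nu>). (a, q, act N a \<tau> q \<nu>)) \<tau>s \<nu>s, \<sigma>)
             = \<Phi> ((p, \<mu>), \<nu>s, perm_sum \<tau>s (arities_of \<nu>s) \<circ> \<sigma>)) \<and>
        (\<forall>\<tau>. \<tau> permutes {..<length \<nu>s} \<longrightarrow>
           koszul_sign \<tau> (degrees_of \<nu>s) *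
             \<Phi> ((p, act M (length \<nu>s) \<tau> p \<mu>), permute_list \<tau> \<nu>s, \<sigma>)
             = \<Phi> ((p, \<mu>), \<nu>s, block_perm \<tau> (arities_of \<nu>s) \<circ> \<sigma>)))}"

definition comp_prod :: "('k::field, 'a::ab_group_add) smod \<Rightarrow> ('k, 'b::ab_group_add) smod
    \<Rightarrow> ('k, (('a, 'b) cgen, 'k) formal) smod" where
  "comp_prod M N = \<lparr>
     arity = (\<lambda>n. \<lparr>scl = fscale,
       grd = (\<lambda>d. module.span fscale {ev (cforms M N n) g | g. is_cgen M N n d g}),
       dif = (\<lambda>_ T. bind T (\<lambda>((p, \<mu>), \<nu>s, \<sigma>).
         ev (cforms M N n) ((p - 1, dif (arity M (length \<nu>s)) p \<mu>), \<nu>s, \<sigma>) +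
         (\<Sum>j<length \<nu>s. case \<nu>s ! j of (a, q, \<nu>) \<Rightarrow>
            fscale ((-1) powi (p + sum_list (take j (degrees_of \<nu>s))))
              (ev (cforms M N n) ((p, \<mu>), \<nu>s[j := (a, q - 1, dif (arity N a) q \<nu>)], \<sigma>)))))\<rparr>),
     act = (\<lambda>n \<tau> _ T. bind T (\<lambda>(\<mu>, \<nu>s, \<sigma>). ev (cforms M N n) (\<mu>, \<nu>s, \<sigma> \<circ> \<tau>)))\<rparr>"

text \<open>In the following three definitions \<open>n\<close> is the arity of the argument.\<close>

definition comp_map :: "('k::field, 'c::ab_group_add) smod \<Rightarrow> ('k, 'd::ab_group_add) smod
    \<Rightarrow> (nat \<Rightarrow> int \<Rightarrow> 'a \<Rightarrow> 'c) \<Rightarrow> (nat \<Rightarrow> int \<Rightarrow> 'b \<Rightarrow> 'd) \<Rightarrow> nat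
    \<Rightarrow> (('a, 'b) cgen, 'k) formal \<Rightarrow> (('c, 'd) cgen, 'k) formal" where
  "comp_map M' N' f g n T = bind T (\<lambda>((p, \<mu>), \<nu>s, \<sigma>).
     ev (cforms M' N' n) ((p, f (length \<nu>s) p \<mu>), map (\<lambda>(a, q, \<nu>). (a, q, g a q \<nu>)) \<nu>s, \<sigma>))"

text \<open>
  The associator \<open>(M \<circ> N) \<circ> P \<rightarrow> M \<circ> (N \<circ> P)\<close>. For \<open>S = (\<mu>; \<nu>\<^sub>1, \<dots>, \<nu>\<^sub>k; \<sigma>)\<close> the generator \<open>(S; \<rho>s; \<tau>)\<close>
  is first rewritten as \<open>((\<mu>; \<nu>\<^sub>1, \<dots>, \<nu>\<^sub>k; id); ys; \<sigma>' \<circ> \<tau>)\<close> with \<open>\<rho>s = ys \<cdot> \<sigma>\<close> and \<open>\<sigma>'\<close> the permutation of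
  blocks, and then the \<open>ys\<close> are distributed over the \<open>\<nu>\<^sub>j\<close>.
\<close>

definition comp_assoc :: "('k::field, 'a::ab_group_add) smod \<Rightarrow> ('k, 'b::ab_group_add) smod
    \<Rightarrow> ('k, 'c::ab_group_add) smod \<Rightarrow> nat
    \<Rightarrow> (((('a, 'b) cgen, 'k) formal, 'c) cgen, 'k) formal
    \<Rightarrow> (('a, (('b, 'c) cgen, 'k) formal) cgen, 'k) formal" where
  "comp_assoc M N P n T = bind T (\<lambda>((_, S), \<rho>s, \<tau>). bind S (\<lambda>((p, \<mu>), \<nu>s, \<sigma>).
     let ys = permute_list (inv \<sigma>) \<rho>s; yss = chunks (arities_of \<nu>s) ys
     in fscale (koszul_sign \<sigma> (degrees_of ys)
          * shuffle_sign (degrees_of \<nu>s) (map (\<lambda>zs. sum_list (degrees_of zs)) yss))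
        (ev (cforms M (comp_prod N P) n)
          ((p, \<mu>),
           map2 (\<lambda>(a, q, \<nu>) zs. (sum_list (arities_of zs), q + sum_list (degrees_of zs),
               ev (cforms N P (sum_list (arities_of zs))) ((q, \<nu>), zs, id))) \<nu>s yss,
           block_perm \<sigma> (arities_of ys) \<circ> \<tau>))))"


section \<open>Dg coalgebras and dg cooperads\<close>

text \<open>
  \<open>C\<close>, \<open>\<Bbbk>\<close> and the tensor products of copies of \<open>C\<close> are regarded as tensor powers of \<open>C\<close>;
  \<open>tensor2_map C f g\<close> is \<open>f \<otimes> g\<close> on \<open>C \<otimes> C\<close> for \<open>f\<close> and \<open>g\<close> of degree \<open>0\<close> with values in tensor powers.
\<close>

definition tensor2_map :: "('k::field, 'a::ab_group_add) dgmod \<Rightarrow> (int \<Rightarrow> 'a \<Rightarrow> ('a, 'k) tensor)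
    \<Rightarrow> (int \<Rightarrow> 'a \<Rightarrow> ('a, 'k) tensor) \<Rightarrow> ('a, 'k) tensor \<Rightarrow> ('a, 'k) tensor" where
  "tensor2_map C f g T = bind T (\<lambda>xs.
     tensor_append C (f (fst (xs ! 0)) (snd (xs ! 0))) (g (fst (xs ! 1)) (snd (xs ! 1))))"

definition tensor1 :: "('k::field, 'a::ab_group_add) dgmod \<Rightarrow> int \<Rightarrow> 'a \<Rightarrow> ('a, 'k) tensor" where
  "tensor1 C i x = pure_tensor C [(i, x)]"

definition tensor0 :: "('k::field, 'a::ab_group_add) dgmod \<Rightarrow> 'k \<Rightarrow> ('a, 'k) tensor" where
  "tensor0 C c = fscale c (pure_tensor C [])"

definition dg_coalgebra :: "('k::field_char_0, 'a::ab_group_add) dgmod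
    \<Rightarrow> (int \<Rightarrow> 'a \<Rightarrow> ('a, 'k) tensor) \<Rightarrow> (int \<Rightarrow> 'a \<Rightarrow> 'k) \<Rightarrow> bool" where
  "dg_coalgebra C \<Delta> \<epsilon> \<longleftrightarrow> dg_module C \<and> \<Delta> \<in> dg_mor C (tensor_power C 2) \<and> \<epsilon> \<in> dg_mor C unit_mod \<and>
     (\<forall>i. \<forall>x\<in>grd C i.
        tensor2_map C \<Delta> (tensor1 C) (\<Delta> i x) = tensor2_map C (tensor1 C) \<Delta> (\<Delta> i x) \<and>
        tensor2_map C (\<lambda>i x. tensor0 C (\<epsilon> i x)) (tensor1 C) (\<Delta> i x) = tensor1 C i x \<and>
        tensor2_map C (tensor1 C) (\<lambda>i x. tensor0 C (\<epsilon> i x)) (\<Delta> i x) = tensor1 C i x)"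

definition coalgebra_mor where
  "coalgebra_mor C \<Delta> \<epsilon> D \<Delta>' \<epsilon>' = {f \<in> dg_mor C D. \<forall>i. \<forall>x\<in>grd C i.
     tensor_map D f (\<Delta> i x) = \<Delta>' i (f i x) \<and> \<epsilon>' i (f i x) = \<epsilon> i x}"

definition dg_cooperad :: "('k::field_char_0, 'a::ab_group_add) smod
    \<Rightarrow> (nat \<Rightarrow> int \<Rightarrow> 'a \<Rightarrow> (('a, 'a) cgen, 'k) formal) \<Rightarrow> (nat \<Rightarrow> int \<Rightarrow> 'a \<Rightarrow> 'k) \<Rightarrow> bool" where
  "dg_cooperad P \<Delta> \<epsilon> \<longleftrightarrow>
     dg_smodule P \<and> \<Delta> \<in> smod_mor P (comp_prod P P) \<and> \<epsilon> \<in> smod_mor P unit_smod \<and>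
     (\<forall>n i. \<forall>x\<in>grd (arity P n) i.
        comp_assoc P P P n (comp_map (comp_prod P P) P \<Delta> (\<lambda>_ _ y. y) n (\<Delta> n i x))
          = comp_map P (comp_prod P P) (\<lambda>_ _ y. y) \<Delta> n (\<Delta> n i x) \<and>
        comp_map unit_smod P \<epsilon> (\<lambda>_ _ y. y) n (\<Delta> n i x)
          = ev (cforms unit_smod P n) ((0, 1), [(n, i, x)], id) \<and>
        comp_map P unit_smod (\<lambda>_ _ y. y) \<epsilon> n (\<Delta> n i x)
          = ev (cforms P unit_smod n) ((i, x), replicate n (1, 0, 1), id))"

definition cooperad_mor where
  "cooperad_mor P \<Delta> \<epsilon> Q \<Delta>' \<epsilon>' = {f \<in> smod_mor P Q. \<forall>n i. \<forall>x\<in>grd (arity P n) i.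
     comp_map Q Q f f n (\<Delta> n i x) = \<Delta>' n i (f n i x) \<and> \<epsilon>' n i (f n i x) = \<epsilon> n i x}"

text \<open>
  For \<open>P\<close> concentrated in arity one, \<open>comp_one\<close> is the isomorphism \<open>P(1) \<otimes> P(1) \<cong> (P \<circ> P)(1)\<close>, and the
  two maps after it transport comultiplications and counits from \<open>P(1)\<close> to \<open>P\<close>.
\<close>

definition comp_one :: "('k::field, 'a::ab_group_add) smod
    \<Rightarrow> ('a, 'k) tensor \<Rightarrow> (('a, 'a) cgen, 'k) formal" where
  "comp_one P T = bind T (\<lambda>xs. ev (cforms P P 1) (xs ! 0, [(1, xs ! 1)], id))"

definition cooperad_comult :: "('k::field, 'a::ab_group_add) smod
    \<Rightarrow> (int \<Rightarrow> 'a \<Rightarrow> ('a, 'k) tensor) \<Rightarrow> nat \<Rightarrow> int \<Rightarrow> 'a \<Rightarrow> (('a, 'a) cgen, 'k) formal" where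
  "cooperad_comult P \<Delta> = (\<lambda>n i x. if n = 1 then comp_one P (\<Delta> i x) else 0)"

definition cooperad_counit :: "(int \<Rightarrow> 'a \<Rightarrow> 'k::zero) \<Rightarrow> nat \<Rightarrow> int \<Rightarrow> 'a \<Rightarrow> 'k" where
  "cooperad_counit \<epsilon> = (\<lambda>n i x. if n = 1 then \<epsilon> i x else 0)"


section \<open>Contramodules\<close>

text \<open>
  The isomorphism \<open>Hom(C \<otimes> C, M) \<cong> Hom(C, Hom(C, M))\<close> uses the first tensor factor for the outer Hom,
  as does \<open>dual_schur_lax\<close> below.
\<close>

definition hom_curry :: "('k::field, 'c::ab_group_add) dgmod \<Rightarrow> (int \<Rightarrow> ('c, 'k) tensor \<Rightarrow> 'm::zero)
    \<Rightarrow> int \<Rightarrow> 'c \<Rightarrow> int \<Rightarrow> 'c \<Rightarrow> 'm" where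
  "hom_curry C g = (\<lambda>i x j y. if x \<in> grd C i \<and> y \<in> grd C j
     then g (i + j) (pure_tensor C [(i, x), (j, y)]) else 0)"

definition dg_contramodule :: "('k::field_char_0, 'c::ab_group_add) dgmod
    \<Rightarrow> (int \<Rightarrow> 'c \<Rightarrow> ('c, 'k) tensor) \<Rightarrow> (int \<Rightarrow> 'c \<Rightarrow> 'k) \<Rightarrow> ('k, 'm::ab_group_add) dgmod
    \<Rightarrow> (int \<Rightarrow> (int \<Rightarrow> 'c \<Rightarrow> 'm) \<Rightarrow> 'm) \<Rightarrow> bool" where
  "dg_contramodule C \<Delta> \<epsilon> M \<gamma> \<longleftrightarrow> dg_module M \<and> \<gamma> \<in> dg_mor (hom_mod C M) M \<and>
     (\<forall>p. \<forall>g\<in>hom_deg (tensor_power C 2) M p.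
        \<gamma> p (\<lambda>i x. g i (\<Delta> i x)) = \<gamma> p (\<lambda>i x. \<gamma> (i + p) (hom_curry C g i x))) \<and>
     (\<forall>p. \<forall>v\<in>grd M p. \<gamma> p (\<lambda>i x. if i = 0 then scl M (\<epsilon> i x) v else 0) = v)"

definition contramodule_mor where
  "contramodule_mor C M \<gamma> N \<delta> = {f \<in> dg_mor M N. \<forall>p. \<forall>h\<in>hom_deg C M p.
     f p (\<gamma> p h) = \<delta> p (\<lambda>i x. f (i + p) (h i x))}"


section \<open>The dual Schur functor and algebras over a cooperad\<close>

definition dual_schur :: "('k::field, 'a::ab_group_add) smod \<Rightarrow> ('k, 'v::ab_group_add) dgmod
    \<Rightarrow> ('k, nat \<Rightarrow> int \<Rightarrow> 'a \<Rightarrow> ('v, 'k) tensor) dgmod" where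
  "dual_schur M V = \<lparr>
     scl = (\<lambda>c f n i x. fscale c (f n i x)),
     grd = (\<lambda>p. {f. \<forall>n. f n \<in> hom_deg (arity M n) (tensor_power V n) p \<and>
       (\<forall>\<sigma> i. \<forall>x\<in>grd (arity M n) i. \<sigma> permutes {..<n} \<longrightarrow>
          f n i (act M n \<sigma> i x) = tensor_perm V \<sigma> (f n i x))}),
     dif = (\<lambda>p f n. hom_dif (arity M n) (tensor_power V n) p (f n))\<rparr>"

definition dual_schur_map :: "('k::field, 'w::ab_group_add) dgmod \<Rightarrow> (int \<Rightarrow> 'v \<Rightarrow> 'w)
    \<Rightarrow> (nat \<Rightarrow> int \<Rightarrow> 'a \<Rightarrow> ('v, 'k) tensor) \<Rightarrow> nat \<Rightarrow> int \<Rightarrow> 'a \<Rightarrow> ('w, 'k) tensor" where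
  "dual_schur_map W g f = (\<lambda>n i x. tensor_map W g (f n i x))"

definition dual_schur_comap :: "(nat \<Rightarrow> int \<Rightarrow> 'a \<Rightarrow> 'b)
    \<Rightarrow> (nat \<Rightarrow> int \<Rightarrow> 'b \<Rightarrow> ('v, 'k) tensor) \<Rightarrow> nat \<Rightarrow> int \<Rightarrow> 'a \<Rightarrow> ('v, 'k) tensor" where
  "dual_schur_comap g f = (\<lambda>n i x. f n i (g n i x))"

text \<open>
  The lax structure map \<open>\<phi>\<^bsub>M,N\<^esub>\<close> sends \<open>f\<close> to
  \<open>(\<mu>; \<nu>\<^sub>1, \<dots>, \<nu>\<^sub>k; \<sigma>) \<mapsto> \<Sum> \<plusminus> (g\<^sub>1 \<nu>\<^sub>1 \<otimes> \<dots> \<otimes> g\<^sub>k \<nu>\<^sub>k) \<cdot> \<sigma>\<close>, where \<open>f \<mu> = \<Sum> g\<^sub>1 \<otimes> \<dots> \<otimes> g\<^sub>k\<close>.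
\<close>

definition dual_schur_lax :: "('k::field, 'a::ab_group_add) smod \<Rightarrow> ('k, 'b::ab_group_add) smod
    \<Rightarrow> ('k, 'v::ab_group_add) dgmod
    \<Rightarrow> (nat \<Rightarrow> int \<Rightarrow> 'a \<Rightarrow> (nat \<Rightarrow> int \<Rightarrow> 'b \<Rightarrow> ('v, 'k) tensor, 'k) tensor)
    \<Rightarrow> nat \<Rightarrow> int \<Rightarrow> (('a, 'b) cgen, 'k) formal \<Rightarrow> ('v, 'k) tensor" where
  "dual_schur_lax M N V f = (\<lambda>n i T. if T \<in> grd (arity (comp_prod M N) n) i
     then bind T (\<lambda>((p, \<mu>), \<nu>s, \<sigma>). bind (f (length \<nu>s) p \<mu>) (\<lambda>gs.
       fscale (shuffle_sign (map fst gs) (degrees_of \<nu>s))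
         (tensor_perm V \<sigma> (tensor_concat V (map2 (\<lambda>(_, g) (a, q, \<nu>). g a q \<nu>) gs \<nu>s)))))
     else 0)"

definition dual_schur_unit_iso ::
  "('k::field, 'v::ab_group_add) dgmod \<Rightarrow> int \<Rightarrow> 'v \<Rightarrow> nat \<Rightarrow> int \<Rightarrow> 'k \<Rightarrow> ('v, 'k) tensor" where
  "dual_schur_unit_iso V p v = (\<lambda>n i c. if n = 1 \<and> i = 0 then tensor1 V p (scl V c v) else 0)"

definition monad_mult where
  "monad_mult P \<Delta> V f = dual_schur_comap \<Delta> (dual_schur_lax P P V f)"

definition monad_unit where
  "monad_unit \<epsilon> V p v = dual_schur_comap \<epsilon> (dual_schur_unit_iso V p v)"

definition dg_algebra :: "('k::field_char_0, 'a::ab_group_add) smod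
    \<Rightarrow> (nat \<Rightarrow> int \<Rightarrow> 'a \<Rightarrow> (('a, 'a) cgen, 'k) formal) \<Rightarrow> (nat \<Rightarrow> int \<Rightarrow> 'a \<Rightarrow> 'k)
    \<Rightarrow> ('k, 'm::ab_group_add) dgmod
    \<Rightarrow> (int \<Rightarrow> (nat \<Rightarrow> int \<Rightarrow> 'a \<Rightarrow> ('m, 'k) tensor) \<Rightarrow> 'm) \<Rightarrow> bool" where
  "dg_algebra P \<Delta> \<epsilon> M \<gamma> \<longleftrightarrow> dg_module M \<and> \<gamma> \<in> dg_mor (dual_schur P M) M \<and>
     (\<forall>p. \<forall>f\<in>grd (dual_schur P (dual_schur P M)) p.
        \<gamma> p (monad_mult P \<Delta> M f) = \<gamma> p (dual_schur_map M \<gamma> f)) \<and>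
     (\<forall>p. \<forall>v\<in>grd M p. \<gamma> p (monad_unit \<epsilon> M p v) = v)"

definition algebra_mor where
  "algebra_mor P M \<gamma> N \<delta> = {f \<in> dg_mor M N. \<forall>p. \<forall>h\<in>grd (dual_schur P M) p.
     f p (\<gamma> p h) = \<delta> p (dual_schur_map N f h)}"

text \<open>
  For \<open>P\<close> concentrated in arity one, \<open>dual_schur_one\<close> is the isomorphism from \<open>Hom(P(1), M)\<close> to the
  value of the dual Schur functor of \<open>P\<close> at \<open>M\<close>.
\<close>

definition dual_schur_one :: "('k::field, 'm::ab_group_add) dgmod \<Rightarrow> int \<Rightarrow> (int \<Rightarrow> 'c \<Rightarrow> 'm)
    \<Rightarrow> nat \<Rightarrow> int \<Rightarrow> 'c \<Rightarrow> ('m, 'k) tensor" where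
  "dual_schur_one M p h = (\<lambda>n i x. if n = 1 then tensor1 M (i + p) (h i x) else 0)"

definition contramodule_action :: "('k::field, 'c::ab_group_add) smod
    \<Rightarrow> ('k, 'm::ab_group_add) dgmod \<Rightarrow> (int \<Rightarrow> (nat \<Rightarrow> int \<Rightarrow> 'c \<Rightarrow> ('m, 'k) tensor) \<Rightarrow> 'm)
    \<Rightarrow> int \<Rightarrow> (int \<Rightarrow> 'c \<Rightarrow> 'm) \<Rightarrow> 'm" where
  "contramodule_action P M \<gamma> = (\<lambda>p h. if h \<in> hom_deg (arity P 1) M p
     then \<gamma> p (dual_schur_one M p h) else 0)"

end

theory Submission
  imports Defs
begin

text \<open>
  If \<open>P\<close> and \<open>Q\<close> vanish outside of arity one, then all generators of \<open>(P \<circ> Q)(n)\<close> vanish except for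
  \<open>(\<mu>; \<nu>; id)\<close> with \<open>\<mu> \<in> P(1)\<close> and \<open>\<nu> \<in> Q(1)\<close>, and so \<open>(P \<circ> Q)(1) \<cong> P(1) \<otimes> Q(1)\<close>. This isomorphism turns
  the axioms of a cooperad into those of a coalgebra. Likewise the dual Schur functor of \<open>P\<close> at \<open>V\<close> is
  \<open>Hom(P(1), V)\<close>; applied twice it is \<open>Hom(P(1), Hom(P(1), M)) \<cong> Hom(P(1) \<otimes> P(1), M)\<close>, on which the monad
  multiplication becomes precomposition with the comultiplication.
\<close>


section \<open>Formal linear combinations modulo relations\<close>

text \<open>The difficulty lies less in the isomorphisms than in well-definedness. Every map out of
  a tensor power or a composition product has the form \<open>bind T h\<close>. This is linear in
  \<open>T\<close> for any \<open>h\<close>, but its value at a generator \<open>x\<close> is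
  \<open>h x\<close> only if \<open>h\<close> respects all relations. So each map is checked against
  the relations before any identity can be verified on generators. For composition products in total
  arity one this check shrinks to linearity in the two slots and vanishing on generators with
  \<open>k \<noteq> 1\<close> inputs. Such generators do occur, for instance with
  \<open>k = 2\<close> and inner arities 1 and 0; they evaluate to zero because they contain a zero
  entry. All permutations, Koszul signs and shuffle signs that are left are trivial, and the one
  surviving sign, in the Leibniz rule, is the same for tensors and for composites. Since
  \<open>bind\<close> only takes values in spaces of formal combinations, it cannot produce a map
  from \<open>P(1) \<otimes> P(1)\<close> to an arbitrary module \<open>M\<close>; there the
  universal property \<open>ev_universal\<close> is used.\<close>

interpretation formal: vector_space "fscale :: 'k::field \<Rightarrow> ('x, 'k) formal \<Rightarrow> _"
  by (rule vector_space_fscale)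

lemma bind_add [simp]: "bind (S + T) h = bind S h + bind T h"
  by (simp add: bind_def fun_eq_iff)

lemma bind_fscale [simp]: "bind (fscale c T) h = fscale c (bind T h)"
  by (simp add: bind_def fscale_def fun_eq_iff)

lemma bind_0 [simp]: "bind 0 h = 0"
  by (simp add: bind_def fun_eq_iff)

lemma fscale_apply: "fscale c T \<Phi> = c * T \<Phi>"
  by (simp add: fscale_def)

abbreviation linear_on ::
  "('k \<Rightarrow> 'a \<Rightarrow> 'a) \<Rightarrow> ('k \<Rightarrow> 'b \<Rightarrow> 'b) \<Rightarrow> 'a set \<Rightarrow> ('a::plus \<Rightarrow> 'b::plus) \<Rightarrow> bool" where
  "linear_on s t A \<equiv> linear_between s t A UNIV"

lemma linear_betweenI:
  assumes "\<And>x. x \<in> A \<Longrightarrow> f x \<in> B"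
    and "\<And>x y. x \<in> A \<Longrightarrow> y \<in> A \<Longrightarrow> f (x + y) = f x + f y"
    and "\<And>c x. x \<in> A \<Longrightarrow> f (s c x) = t c (f x)"
  shows "linear_between s t A B f"
  using assms by (auto simp: linear_between_def)

lemma linear_between_mem: "linear_between s t A B f \<Longrightarrow> x \<in> A \<Longrightarrow> f x \<in> B"
  and linear_between_add: "linear_between s t A B f \<Longrightarrow> x \<in> A \<Longrightarrow> y \<in> A \<Longrightarrow> f (x + y) = f x + f y"
  and linear_between_scale: "linear_between s t A B f \<Longrightarrow> x \<in> A \<Longrightarrow> f (s c x) = t c (f x)"
  by (auto simp: linear_between_def)

lemma linear_between_zero:
  fixes f :: "'a::ab_group_add \<Rightarrow> 'b::ab_group_add"
  assumes "linear_between s t A B f" "0 \<in> A"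
  shows "f 0 = 0"
  using linear_between_add[OF assms(1), of 0 0] assms(2) by simp

text \<open>The laws for \<open>g\<close> at \<open>x + y\<close> and \<open>s c x\<close> are read
  off from those for \<open>f\<close>, and the two maps are compared only on \<open>A\<close>; hence
  the closure conditions on \<open>A\<close>.\<close>

lemma linear_between_cong:
  assumes "linear_between s t A B f" "\<And>x. x \<in> A \<Longrightarrow> f x = g x"
    and "\<And>x y. x \<in> A \<Longrightarrow> y \<in> A \<Longrightarrow> x + y \<in> A" "\<And>c x. x \<in> A \<Longrightarrow> s c x \<in> A"
  shows "linear_between s t A B g"
  using assms unfolding linear_between_def by (simp add: image_subset_iff)

lemma linear_between_subspace_cong:
  assumes "linear_between s t A B f" "vector_space s" "module.subspace s A"
    "\<And>x. x \<in> A \<Longrightarrow> f x = g x"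
  shows "linear_between s t A B g"
proof -
  interpret vector_space s by fact
  show ?thesis
    by (rule linear_between_cong[OF assms(1,4)])
       (use assms(3) in \<open>auto intro: subspace_add subspace_scale\<close>)
qed

lemma linear_between_comp:
  "linear_between s t A B f \<Longrightarrow> linear_between t u B D g \<Longrightarrow> linear_between s u A D (\<lambda>x. g (f x))"
  unfolding linear_between_def by (auto simp: image_subset_iff)

lemma linear_on_weaken: "linear_between s t A B f \<Longrightarrow> linear_on s t A f"
  unfolding linear_between_def by auto

lemma linear_between_codomain:
  "linear_on s t A f \<Longrightarrow> (\<And>x. x \<in> A \<Longrightarrow> f x \<in> B) \<Longrightarrow> linear_between s t A B f"
  unfolding linear_between_def by auto

lemma linear_between_id: "linear_between s s A A (\<lambda>x. x)"
  unfolding linear_between_def by auto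

lemma linear_on_fscale: "linear_on s fscale A f \<Longrightarrow> linear_on s fscale A (\<lambda>x. fscale c (f x))"
  unfolding linear_between_def by (auto simp: formal.scale_right_distrib mult.commute)

lemma linear_on_plus:
  "linear_on s fscale A f \<Longrightarrow> linear_on s fscale A g \<Longrightarrow> linear_on s fscale A (\<lambda>x. f x + g x)"
  unfolding linear_between_def by (auto simp: formal.scale_right_distrib)

lemma linear_on_formal_iff:
  "linear_on s fscale A f \<longleftrightarrow> (\<forall>\<Phi>. linear_on s (*) A (\<lambda>x. f x \<Phi>))"
  unfolding linear_between_def by (auto simp: fun_eq_iff fscale_apply)

section \<open>Linear maps on the span of a set of generators\<close>

text \<open>Membership in the span is carried along in the induction, so the steps may use maps that
  are linear only on the span.\<close>

lemma formal_span_induct [consumes 1, case_names base zero add scale]: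
  assumes "T \<in> formal.span X" "\<And>x. x \<in> X \<Longrightarrow> Q x" "Q 0"
    and "\<And>S T. S \<in> formal.span X \<Longrightarrow> T \<in> formal.span X \<Longrightarrow> Q S \<Longrightarrow> Q T \<Longrightarrow> Q (S + T)"
    and "\<And>c T. T \<in> formal.span X \<Longrightarrow> Q T \<Longrightarrow> Q (fscale c T)"
  shows "Q T"
proof -
  have "T \<in> formal.span X \<and> Q T"
    using assms(1)
    by (rule formal.span_induct)
       (auto simp: formal.subspace_def assms formal.span_base formal.span_zero
          intro: formal.span_add formal.span_scale)
  then show ?thesis by simp
qed

lemma linear_between_span:
  fixes t :: "'k::field \<Rightarrow> 'b::ab_group_add \<Rightarrow> 'b"
  assumes f: "linear_on fscale t (formal.span X) f" and "\<And>x. x \<in> X \<Longrightarrow> f x \<in> B"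
    and "vector_space t" "module.subspace t B"
  shows "linear_between fscale t (formal.span X) B f"
proof -
  interpret t: vector_space t by fact
  have "f T \<in> B" if "T \<in> formal.span X" for T
    using that
  proof (induction rule: formal_span_induct)
    case zero
    show "f 0 \<in> B"
      using linear_between_zero[OF f formal.span_zero] assms(4) by (simp add: t.subspace_0)
  next
    case (add S T)
    then show "f (S + T) \<in> B"
      using linear_between_add[OF f] assms(4) by (simp add: t.subspace_add)
  next
    case (scale c T)
    then show "f (fscale c T) \<in> B"
      using linear_between_scale[OF f] assms(4) by (simp add: t.subspace_scale)
  qed (use assms in auto)
  then show ?thesis using f unfolding linear_between_def by auto
qed

lemma linear_on_span_eq:
  fixes f :: "('x, 'k::field) formal \<Rightarrow> 'b::ab_group_add"
  assumes f: "linear_between fscale t (formal.span X) B f"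
    and g: "linear_between fscale t (formal.span X) D g"
    and "\<And>x. x \<in> X \<Longrightarrow> f x = g x" "T \<in> formal.span X"
  shows "f T = g T"
  using assms(4)
proof (induction rule: formal_span_induct)
  case zero
  show "f 0 = g 0"
    using linear_between_zero[OF f formal.span_zero] linear_between_zero[OF g formal.span_zero]
    by simp
next
  case (add S T)
  then show "f (S + T) = g (S + T)" using linear_between_add[OF f] linear_between_add[OF g] by simp
next
  case (scale c T)
  then show "f (fscale c T) = g (fscale c T)" using linear_between_scale[OF f] linear_between_scale[OF g] by simp
qed (use assms in auto)

lemma linear_bind: "linear_on fscale fscale A (\<lambda>T. bind T h)"
  by (rule linear_betweenI) auto

text \<open>A map on generators extends to a linear map iff all its coordinates kill the relations.\<close>

definition admissible :: "('x \<Rightarrow> 'k) set \<Rightarrow> ('x \<Rightarrow> ('y, 'k::field) formal) \<Rightarrow> bool" where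
  "admissible F h \<longleftrightarrow> (\<forall>\<Phi>. (\<lambda>x. h x \<Phi>) \<in> F)"

text \<open>At \<open>\<Phi>\<close> the left-hand side evaluates the form
  \<open>\<lambda>x. h x \<Phi>\<close> at the generator. If that form violated a relation,
  \<open>ev\<close> would return its default 0 instead.\<close>

lemma bind_ev: "admissible F h \<Longrightarrow> bind (ev F x) h = h x"
  by (auto simp: admissible_def bind_def ev_def fun_eq_iff)

definition form_space :: "('x \<Rightarrow> 'k::field) set \<Rightarrow> bool" where
  "form_space F \<longleftrightarrow> (\<lambda>_. 0) \<in> F \<and> (\<forall>\<phi>\<in>F. \<forall>\<psi>\<in>F. (\<lambda>x. \<phi> x + \<psi> x) \<in> F)
     \<and> (\<forall>c. \<forall>\<phi>\<in>F. (\<lambda>x. c * \<phi> x) \<in> F)"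

lemma admissible_add:
  "form_space F \<Longrightarrow> admissible F h \<Longrightarrow> admissible F h' \<Longrightarrow> admissible F (\<lambda>x. h x + h' x)"
  unfolding admissible_def form_space_def by auto

lemma admissible_fscale:
  "form_space F \<Longrightarrow> admissible F h \<Longrightarrow> admissible F (\<lambda>x. fscale c (h x))"
  unfolding admissible_def form_space_def by (auto simp: fscale_apply)

text \<open>An arbitrary functional \<open>T\<close> need not be additive in the form that it
  receives. For \<open>T\<close> in the span of the evaluations both sides are linear in
  \<open>T\<close> and agree on generators, as \<open>F\<close> is closed under sums.\<close>

lemma bind_add_right:
  assumes "form_space F" "T \<in> formal.span (ev F ` G)" "admissible F h" "admissible F h'"
  shows "bind T (\<lambda>x. h x + h' x) = bind T h + bind T h'"
  by (rule linear_on_span_eq[OF linear_bind linear_on_plus[OF linear_bind linear_bind] _ assms(2)])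
     (auto simp: bind_ev assms admissible_add)

lemma bind_fscale_right:
  assumes "form_space F" "T \<in> formal.span (ev F ` G)" "admissible F h"
  shows "bind T (\<lambda>x. fscale c (h x)) = fscale c (bind T h)"
  by (rule linear_on_span_eq[OF linear_bind linear_on_fscale[OF linear_bind] _ assms(2)])
     (auto simp: bind_ev assms admissible_fscale)


section \<open>Tensor powers\<close>

text \<open>The part of \<open>dg_module\<close> that does not mention differentials. Tensor powers,
  composition products and dual Schur functors can be used as graded objects without verifying that
  their differentials square to zero.\<close>

definition graded :: "('k::field, 'a::ab_group_add) dgmod \<Rightarrow> bool" where
  "graded V \<longleftrightarrow> vector_space (scl V) \<and> (\<forall>i. module.subspace (scl V) (grd V i))"

lemma graded_0: "graded V \<Longrightarrow> 0 \<in> grd V i"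
  and graded_add: "graded V \<Longrightarrow> x \<in> grd V i \<Longrightarrow> y \<in> grd V i \<Longrightarrow> x + y \<in> grd V i"
  and graded_scale: "graded V \<Longrightarrow> x \<in> grd V i \<Longrightarrow> scl V c x \<in> grd V i"
  unfolding graded_def
  by (auto simp: vector_space_def module.subspace_def module_def)

lemma graded_linear_cong:
  assumes "linear_between (scl V) t (grd V i) B f" "graded V" "\<And>x. x \<in> grd V i \<Longrightarrow> f x = g x"
  shows "linear_between (scl V) t (grd V i) B g"
  using linear_between_subspace_cong[OF assms(1) _ _ assms(3)] assms(2)
  by (simp add: graded_def)

lemma dg_module_graded: "dg_module V \<Longrightarrow> graded V"
  and dg_module_dif:
    "dg_module V \<Longrightarrow> linear_between (scl V) (scl V) (grd V i) (grd V (i - 1)) (dif V i)"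
  by (auto simp: graded_def dg_module_def)

definition homogeneous :: "('k, 'a) dgmod \<Rightarrow> (int \<times> 'a) list \<Rightarrow> bool" where
  "homogeneous V vs \<longleftrightarrow> (\<forall>(j, v)\<in>set vs. v \<in> grd V j)"

lemma homogeneous_simps [simp]:
  "homogeneous V []" "homogeneous V ((j, v) # vs) \<longleftrightarrow> v \<in> grd V j \<and> homogeneous V vs"
  "homogeneous V (us @ vs) \<longleftrightarrow> homogeneous V us \<and> homogeneous V vs"
  by (auto simp: homogeneous_def)

lemma multilinear_forms_iff:
  "\<Phi> \<in> multilinear_forms V n \<longleftrightarrow> (\<forall>l i r. Suc (length l + length r) = n \<longrightarrow> homogeneous V (l @ r) \<longrightarrow>
     linear_on (scl V) (*) (grd V i) (\<lambda>x. \<Phi> (l @ (i, x) # r)))"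
  unfolding multilinear_forms_def homogeneous_def by blast

lemma linear_on_form_add:
  fixes f g :: "'a::plus \<Rightarrow> 'k::field"
  shows "linear_on s (*) A f \<Longrightarrow> linear_on s (*) A g \<Longrightarrow> linear_on s (*) A (\<lambda>x. f x + g x)"
  unfolding linear_between_def by (auto simp: algebra_simps)

lemma linear_on_form_scale:
  fixes f :: "'a::plus \<Rightarrow> 'k::field"
  shows "linear_on s (*) A f \<Longrightarrow> linear_on s (*) A (\<lambda>x. c * f x)"
  unfolding linear_between_def by (auto simp: algebra_simps)

lemma linear_on_form_0: "linear_on s (*) A (\<lambda>x. 0 :: 'k::field)"
  unfolding linear_between_def by auto

lemma form_space_multilinear: "form_space (multilinear_forms V n)"
  unfolding form_space_def
proof (intro conjI ballI allI)
  show "(\<lambda>_. 0) \<in> multilinear_forms V n"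
    unfolding multilinear_forms_iff by (simp add: linear_on_form_0)
next
  fix \<phi> \<psi> assume "\<phi> \<in> multilinear_forms V n" "\<psi> \<in> multilinear_forms V n"
  then show "(\<lambda>x. \<phi> x + \<psi> x) \<in> multilinear_forms V n"
    unfolding multilinear_forms_iff by (simp add: linear_on_form_add)
next
  fix c \<phi> assume "\<phi> \<in> multilinear_forms V n"
  then show "(\<lambda>x. c * \<phi> x) \<in> multilinear_forms V n"
    unfolding multilinear_forms_iff by (simp add: linear_on_form_scale)
qed

section \<open>Maps out of tensor powers\<close>

lemma admissible_multilinearI:
  assumes "\<And>l i r. Suc (length l + length r) = n \<Longrightarrow> homogeneous V l \<Longrightarrow> homogeneous V r \<Longrightarrow>
     linear_on (scl V) fscale (grd V i) (\<lambda>x. h (l @ (i, x) # r))"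
  shows "admissible (multilinear_forms V n) h"
  using assms unfolding admissible_def multilinear_forms_iff linear_on_formal_iff by auto

lemma linear_pure_tensor:
  assumes "homogeneous V l" "homogeneous V r"
  shows "linear_on (scl V) fscale (grd V i) (\<lambda>x. pure_tensor V (l @ (i, x) # r))"
  unfolding linear_on_formal_iff
proof
  fix \<Phi>
  show "linear_on (scl V) (*) (grd V i) (\<lambda>x. pure_tensor V (l @ (i, x) # r) \<Phi>)"
  proof (cases "\<Phi> \<in> multilinear_forms V (Suc (length l + length r))")
    case True
    then show ?thesis
      using assms by (simp add: pure_tensor_def ev_def) (simp add: multilinear_forms_iff)
  next
    case False
    then show ?thesis
      by (simp add: pure_tensor_def ev_def linear_between_def)
  qed
qed

lemma bind_pure_tensor:
  "admissible (multilinear_forms V (length vs)) h \<Longrightarrow> bind (pure_tensor V vs) h = h vs"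
  unfolding pure_tensor_def by (rule bind_ev)

lemma admissible_pure_tensor: "admissible (multilinear_forms V n) (pure_tensor V)"
  by (rule admissible_multilinearI) (rule linear_pure_tensor)

lemma linear_on_pure_tensor_1: "linear_on (scl V) fscale (grd V i) (\<lambda>x. pure_tensor V [(i, x)])"
  using linear_pure_tensor[of V "[]" "[]"] by simp

lemma linear_on_pure_tensor_2:
  "y \<in> grd V j \<Longrightarrow> linear_on (scl V) fscale (grd V i) (\<lambda>x. pure_tensor V [(i, x), (j, y)])"
  "x \<in> grd V i \<Longrightarrow> linear_on (scl V) fscale (grd V j) (\<lambda>y. pure_tensor V [(i, x), (j, y)])"
  using linear_pure_tensor[of V "[]" "[(j, y)]"] linear_pure_tensor[of V "[(i, x)]" "[]"] by auto

lemma admissible_multilinear_1: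
  assumes "\<And>i. linear_on (scl V) fscale (grd V i) (\<lambda>x. h [(i, x)])"
  shows "admissible (multilinear_forms V (Suc 0)) h"
  by (rule admissible_multilinearI) (use assms in auto)

lemma admissible_multilinear_2:
  assumes "\<And>i j y. y \<in> grd V j \<Longrightarrow> linear_on (scl V) fscale (grd V i) (\<lambda>x. h [(i, x), (j, y)])"
    and "\<And>i j x. x \<in> grd V i \<Longrightarrow> linear_on (scl V) fscale (grd V j) (\<lambda>y. h [(i, x), (j, y)])"
  shows "admissible (multilinear_forms V (Suc (Suc 0))) h"
proof (rule admissible_multilinearI)
  fix l r :: "(int \<times> 'a) list" and i
  assume "Suc (length l + length r) = Suc (Suc 0)" "homogeneous V l" "homogeneous V r"
  then show "linear_on (scl V) fscale (grd V i) (\<lambda>x. h (l @ (i, x) # r))"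
    by (cases l; cases r) (use assms in auto)
qed

lemma admissible_multilinear_3:
  assumes "\<And>i j k y z. y \<in> grd V j \<Longrightarrow> z \<in> grd V k \<Longrightarrow>
      linear_on (scl V) fscale (grd V i) (\<lambda>x. h [(i, x), (j, y), (k, z)])"
    and "\<And>i j k x z. x \<in> grd V i \<Longrightarrow> z \<in> grd V k \<Longrightarrow>
      linear_on (scl V) fscale (grd V j) (\<lambda>y. h [(i, x), (j, y), (k, z)])"
    and "\<And>i j k x y. x \<in> grd V i \<Longrightarrow> y \<in> grd V j \<Longrightarrow>
      linear_on (scl V) fscale (grd V k) (\<lambda>z. h [(i, x), (j, y), (k, z)])"
  shows "admissible (multilinear_forms V (Suc (Suc (Suc 0)))) h"
proof (rule admissible_multilinearI)
  fix l r :: "(int \<times> 'a) list" and i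
  assume *: "Suc (length l + length r) = Suc (Suc (Suc 0))" "homogeneous V l" "homogeneous V r"
  show "linear_on (scl V) fscale (grd V i) (\<lambda>x. h (l @ (i, x) # r))"
  proof (cases l)
    case Nil
    with * obtain a b where "r = [a, b]" by (auto simp: length_Suc_conv)
    with Nil * show ?thesis by (cases a; cases b) (simp add: assms(1))
  next
    case l: (Cons a l')
    show ?thesis
    proof (cases l')
      case Nil
      with l * obtain b where "r = [b]" by (auto simp: length_Suc_conv)
      with l Nil * show ?thesis by (cases a; cases b) (simp add: assms(2))
    next
      case (Cons b l'')
      with l * have "l'' = []" "r = []" by auto
      with l Cons * show ?thesis by (cases a; cases b) (simp add: assms(3))
    qed
  qed
qed

definition tensor_gens :: "('k, 'a) dgmod \<Rightarrow> nat \<Rightarrow> int \<Rightarrow> (int \<times> 'a) list set" where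
  "tensor_gens V n d = {vs. length vs = n \<and> homogeneous V vs \<and> sum_list (map fst vs) = d}"

lemma tensor_power_simps [simp]:
  "scl (tensor_power V n) = fscale"
  "grd (tensor_power V n) d = formal.span (ev (multilinear_forms V n) ` tensor_gens V n d)"
  unfolding tensor_power_def tensor_gens_def homogeneous_def pure_tensor_def
  by (auto intro!: arg_cong[where f = formal.span] simp: image_def)

lemma graded_tensor_power: "graded (tensor_power V n)"
  by (simp add: graded_def formal.subspace_span vector_space_fscale)

lemma pure_tensor_mem:
  "length vs = n \<Longrightarrow> homogeneous V vs \<Longrightarrow> sum_list (map fst vs) = d \<Longrightarrow>
     pure_tensor V vs \<in> grd (tensor_power V n) d"
  by (auto simp: pure_tensor_def tensor_gens_def intro: formal.span_base)

text \<open>The main device for equations between maps out of tensor powers: both sides are linear,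
  so homogeneous pure tensors decide. The separate codomains \<open>B\<close> and \<open>D\<close>
  let linearity facts of different origin be combined.\<close>

lemma tensor_power_linear_eq:
  fixes t :: "'k::field \<Rightarrow> 'b::ab_group_add \<Rightarrow> 'b"
  assumes "linear_between fscale t (grd (tensor_power V n) d) B f"
    "linear_between fscale t (grd (tensor_power V n) d) D g"
    and "\<And>vs. length vs = n \<Longrightarrow> homogeneous V vs \<Longrightarrow> sum_list (map fst vs) = d \<Longrightarrow>
      f (pure_tensor V vs) = g (pure_tensor V vs)"
    and "T \<in> grd (tensor_power V n) d"
  shows "f T = g T"
  by (rule linear_on_span_eq[OF assms(1,2)[simplified] _ assms(4)[simplified]])
     (use assms(3) in \<open>auto simp: tensor_gens_def pure_tensor_def\<close>)

lemma tensor_power_linear_between: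
  fixes t :: "'k::field \<Rightarrow> 'b::ab_group_add \<Rightarrow> 'b"
  assumes "linear_on fscale t (grd (tensor_power V n) d) f"
    and "\<And>vs. length vs = n \<Longrightarrow> homogeneous V vs \<Longrightarrow> sum_list (map fst vs) = d \<Longrightarrow>
      f (pure_tensor V vs) \<in> B"
    and "vector_space t" "module.subspace t B"
  shows "linear_between fscale t (grd (tensor_power V n) d) B f"
  unfolding tensor_power_simps
  by (rule linear_between_span[OF assms(1)[simplified] _ assms(3,4)])
     (use assms(2) in \<open>auto simp: tensor_gens_def pure_tensor_def\<close>)

lemma length_2_gens:
  assumes "length vs = 2" "homogeneous V vs" "sum_list (map fst vs) = d"
  obtains i x j y where "vs = [(i, x), (j, y)]" "x \<in> grd V i" "y \<in> grd V j" "i + j = d"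
  using assms by (auto simp: numeral_2_eq_2 length_Suc_conv)

lemma length_1_gens:
  assumes "length vs = Suc 0" "homogeneous V vs" "sum_list (map fst vs) = d"
  obtains x where "vs = [(d, x)]" "x \<in> grd V d"
  using assms by (auto simp: length_Suc_conv)

section \<open>Concatenation of tensors\<close>

lemma tensor_append_admissible_right:
  "homogeneous V xs \<Longrightarrow> admissible (multilinear_forms V n) (\<lambda>ys. pure_tensor V (xs @ ys))"
  by (rule admissible_multilinearI)
     (use linear_pure_tensor[of V "xs @ l" r for l r] in simp)

text \<open>The varying entry \<open>x\<close> occurs inside the function given to
  \<open>bind T\<close>, where linearity is not automatic. For pure \<open>T\<close> it is
  multilinearity of pure tensors, and both sides are linear in \<open>T\<close>.\<close>

lemma tensor_append_admissible_left:
  assumes V: "graded V" and T: "T \<in> grd (tensor_power V n) e"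
  shows "admissible (multilinear_forms V m) (\<lambda>xs. bind T (\<lambda>ys. pure_tensor V (xs @ ys)))"
proof (rule admissible_multilinearI)
  fix l r i
  assume lr: "homogeneous V l" "homogeneous V r"
  have adm: "admissible (multilinear_forms V k) (\<lambda>ys. pure_tensor V (l @ (i, x) # r @ ys))"
    if "x \<in> grd V i" for x k
    using tensor_append_admissible_right[of V "l @ (i, x) # r"] that lr by simp
  show "linear_on (scl V) fscale (grd V i) (\<lambda>x. bind T (\<lambda>ys. pure_tensor V ((l @ (i, x) # r) @ ys)))"
  proof (rule linear_betweenI)
    fix x y assume xy: "x \<in> grd V i" "y \<in> grd V i"
    have "bind T (\<lambda>ys. pure_tensor V (l @ (i, x + y) # r @ ys)) =
        bind T (\<lambda>ys. pure_tensor V (l @ (i, x) # r @ ys)) + bind T (\<lambda>ys. pure_tensor V (l @ (i, y) # r @ ys))"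
      by (rule tensor_power_linear_eq[OF linear_bind linear_on_plus[OF linear_bind linear_bind] _ T])
         (use lr xy in \<open>simp add: bind_pure_tensor adm graded_add[OF V]
            linear_between_add[OF linear_pure_tensor] fun_eq_iff\<close>)
    then show "bind T (\<lambda>ys. pure_tensor V ((l @ (i, x + y) # r) @ ys)) =
        bind T (\<lambda>ys. pure_tensor V ((l @ (i, x) # r) @ ys))
        + bind T (\<lambda>ys. pure_tensor V ((l @ (i, y) # r) @ ys))" by simp
  next
    fix c x assume x: "x \<in> grd V i"
    have "bind T (\<lambda>ys. pure_tensor V (l @ (i, scl V c x) # r @ ys)) =
        fscale c (bind T (\<lambda>ys. pure_tensor V (l @ (i, x) # r @ ys)))"
      by (rule tensor_power_linear_eq[OF linear_bind linear_on_fscale[OF linear_bind] _ T])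
         (use lr x in \<open>simp add: bind_pure_tensor adm graded_scale[OF V]
            linear_between_scale[OF linear_pure_tensor]\<close>)
    then show "bind T (\<lambda>ys. pure_tensor V ((l @ (i, scl V c x) # r) @ ys)) =
        fscale c (bind T (\<lambda>ys. pure_tensor V ((l @ (i, x) # r) @ ys)))" by simp
  qed auto
qed

lemma tensor_append_pure:
  assumes "graded V" "homogeneous V xs" "homogeneous V ys"
  shows "tensor_append V (pure_tensor V xs) (pure_tensor V ys) = pure_tensor V (xs @ ys)"
  unfolding tensor_append_def
  by (simp add: bind_pure_tensor tensor_append_admissible_left[OF assms(1) pure_tensor_mem[OF refl assms(3) refl]]
      tensor_append_admissible_right assms(2))

lemma linear_tensor_append_left: "linear_on fscale fscale A (\<lambda>S. tensor_append V S T)"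
  unfolding tensor_append_def by (rule linear_bind)

text \<open>Concatenation is \<open>bind\<close> over the left factor, so linearity on the right
  depends on \<open>S\<close> being a combination of pure tensors.\<close>

lemma linear_tensor_append_right:
  assumes V: "graded V" and S: "S \<in> grd (tensor_power V m) d"
  shows "linear_on fscale fscale (grd (tensor_power V n) e) (tensor_append V S)"
proof (rule linear_betweenI)
  note adm = tensor_append_admissible_left[OF V]
  note S = S[simplified]
  fix T T' assume "T \<in> grd (tensor_power V n) e" "T' \<in> grd (tensor_power V n) e"
  then show "tensor_append V S (T + T') = tensor_append V S T + tensor_append V S T'"
    unfolding tensor_append_def bind_add
    by (intro bind_add_right[OF form_space_multilinear S] adm)
next
  note adm = tensor_append_admissible_left[OF V]
  note S = S[simplified]
  fix c T assume "T \<in> grd (tensor_power V n) e"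
  then show "tensor_append V S (fscale c T) = fscale c (tensor_append V S T)"
    unfolding tensor_append_def bind_fscale
    by (intro bind_fscale_right[OF form_space_multilinear S] adm)
qed auto

lemma subspace_tensor_power: "formal.subspace (grd (tensor_power V n) d)"
  by (simp add: formal.subspace_span)

lemma tensor_append_mem:
  assumes V: "graded V" and S: "S \<in> grd (tensor_power V m) d" and T: "T \<in> grd (tensor_power V n) e"
  shows "tensor_append V S T \<in> grd (tensor_power V (m + n)) (d + e)"
proof -
  have *: "tensor_append V (pure_tensor V xs) T \<in> grd (tensor_power V (m + n)) (d + e)"
    if xs: "length xs = m" "homogeneous V xs" "sum_list (map fst xs) = d" for xs
    by (rule linear_between_mem[OF tensor_power_linear_between
          [OF linear_tensor_append_right[OF V pure_tensor_mem[OF xs]] _ vector_space_fscale subspace_tensor_power] T])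
       (use xs in \<open>auto simp: tensor_append_pure V simp del: tensor_power_simps intro!: pure_tensor_mem\<close>)
  show ?thesis
    by (rule linear_between_mem[OF tensor_power_linear_between
          [OF linear_tensor_append_left _ vector_space_fscale subspace_tensor_power] S])
       (rule *)
qed

lemma linear_tensor_append_map:
  assumes V: "graded V"
    and f: "linear_between s fscale A (grd (tensor_power V m) d) f"
    and S: "S \<in> grd (tensor_power V n) e"
  shows "linear_on s fscale A (\<lambda>x. tensor_append V (f x) S)"
    and "linear_on s fscale A (\<lambda>x. tensor_append V S (f x))"
  by (rule linear_between_comp[OF f linear_tensor_append_left],
      rule linear_between_comp[OF f linear_tensor_append_right[OF V S]])

text \<open>Admissibility is bilinearity of concatenation combined with linearity of
  \<open>f\<close> and \<open>g\<close>. Their values must be genuine tensors, because concatenation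
  is linear on the right only for those.\<close>

lemma tensor2_map_pure:
  assumes V: "graded V"
    and f: "\<And>i. linear_between (scl V) fscale (grd V i) (grd (tensor_power V m) i) (f i)"
    and g: "\<And>i. linear_between (scl V) fscale (grd V i) (grd (tensor_power V n) i) (g i)"
  shows "tensor2_map V f g (pure_tensor V [(i, x), (j, y)]) = tensor_append V (f i x) (g j y)"
proof -
  have "admissible (multilinear_forms V (Suc (Suc 0)))
      (\<lambda>xs. tensor_append V (f (fst (xs ! 0)) (snd (xs ! 0))) (g (fst (xs ! 1)) (snd (xs ! 1))))"
  proof (rule admissible_multilinear_2)
    fix i j y assume y: "y \<in> grd V j"
    show "linear_on (scl V) fscale (grd V i)
       (\<lambda>x. tensor_append V (f (fst ([(i, x), (j, y)] ! 0)) (snd ([(i, x), (j, y)] ! 0)))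
          (g (fst ([(i, x), (j, y)] ! 1)) (snd ([(i, x), (j, y)] ! 1))))"
      using linear_tensor_append_map(1)[OF V f linear_between_mem[OF g y]] by simp
  next
    fix i j x assume x: "x \<in> grd V i"
    show "linear_on (scl V) fscale (grd V j)
       (\<lambda>y. tensor_append V (f (fst ([(i, x), (j, y)] ! 0)) (snd ([(i, x), (j, y)] ! 0)))
          (g (fst ([(i, x), (j, y)] ! 1)) (snd ([(i, x), (j, y)] ! 1))))"
      using linear_tensor_append_map(2)[OF V g linear_between_mem[OF f x]] by simp
  qed
  then show ?thesis
    unfolding tensor2_map_def by (subst bind_pure_tensor) simp_all
qed

lemma linear_tensor2_map: "linear_on fscale fscale A (tensor2_map V f g)"
  unfolding tensor2_map_def by (rule linear_bind)

lemma tensor2_map_mem: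
  assumes V: "graded V"
    and f: "\<And>i. linear_between (scl V) fscale (grd V i) (grd (tensor_power V m) i) (f i)"
    and g: "\<And>i. linear_between (scl V) fscale (grd V i) (grd (tensor_power V n) i) (g i)"
    and T: "T \<in> grd (tensor_power V 2) d"
  shows "tensor2_map V f g T \<in> grd (tensor_power V (m + n)) d"
proof (rule linear_between_mem[OF tensor_power_linear_between
        [OF linear_tensor2_map _ vector_space_fscale subspace_tensor_power] T])
  fix vs assume "length vs = 2" "homogeneous V vs" "sum_list (map fst vs) = d"
  then obtain i x j y where "vs = [(i, x), (j, y)]" "x \<in> grd V i" "y \<in> grd V j" "i + j = d"
    by (rule length_2_gens)
  then show "tensor2_map V f g (pure_tensor V vs) \<in> grd (tensor_power V (m + n)) d"
    using tensor_append_mem[OF V linear_between_mem[OF f] linear_between_mem[OF g]]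
    by (simp only: tensor2_map_pure[OF V f g]) blast
qed

section \<open>Tensor powers with exponents one and zero\<close>

lemma linear_tensor1:
  "linear_between (scl V) fscale (grd V i) (grd (tensor_power V (Suc 0)) i) (tensor1 V i)"
proof -
  have "linear_on (scl V) fscale (grd V i) (tensor1 V i)"
    unfolding tensor1_def by (rule linear_on_pure_tensor_1)
  moreover have "tensor1 V i x \<in> grd (tensor_power V (Suc 0)) i" if "x \<in> grd V i" for x
    unfolding tensor1_def by (rule pure_tensor_mem) (use that in auto)
  ultimately show ?thesis unfolding linear_between_def by blast
qed

lemma tensor1_0: "graded V \<Longrightarrow> tensor1 V i 0 = 0"
  using linear_between_zero[OF linear_tensor1] graded_0 by blast

text \<open>The image of the linear map \<open>tensor1\<close> is already a subspace, and it
  contains every generator since the degree of a one-element list is its only label.\<close>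

lemma tensor_power_1_grd:
  assumes V: "graded V"
  shows "grd (tensor_power V (Suc 0)) i = tensor1 V i ` grd V i"
proof
  have "linear_between fscale fscale (grd (tensor_power V (Suc 0)) i) (tensor1 V i ` grd V i) (\<lambda>T. T)"
  proof (rule tensor_power_linear_between)
    show "linear_on fscale fscale (grd (tensor_power V (Suc 0)) i) (\<lambda>T. T)"
      by (auto simp: linear_between_def)
    show "formal.subspace (tensor1 V i ` grd V i)"
      unfolding formal.subspace_def
    proof (intro conjI ballI allI)
      show "0 \<in> tensor1 V i ` grd V i"
        using tensor1_0[OF V, of i] graded_0[OF V] by (metis image_eqI)
    next
      fix S T assume "S \<in> tensor1 V i ` grd V i" "T \<in> tensor1 V i ` grd V i"
      then show "S + T \<in> tensor1 V i ` grd V i"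
        using linear_between_add[OF linear_tensor1[of V i]] graded_add[OF V] by (auto simp: image_iff) metis
    next
      fix c T assume "T \<in> tensor1 V i ` grd V i"
      then show "fscale c T \<in> tensor1 V i ` grd V i"
        using linear_between_scale[OF linear_tensor1[of V i]] graded_scale[OF V] by (auto simp: image_iff) metis
    qed
  next
    fix vs assume "length vs = Suc 0" "homogeneous V vs" "sum_list (map fst vs) = i"
    then obtain x where "vs = [(i, x)]" "x \<in> grd V i"
      by (rule length_1_gens)
    then show "pure_tensor V vs \<in> tensor1 V i ` grd V i"
      by (auto simp: tensor1_def)
  qed (rule vector_space_fscale)
  then show "grd (tensor_power V (Suc 0)) i \<subseteq> tensor1 V i ` grd V i"
    unfolding linear_between_def by auto
next
  show "tensor1 V i ` grd V i \<subseteq> grd (tensor_power V (Suc 0)) i"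
    using linear_tensor1[of V i] unfolding linear_between_def by blast
qed

text \<open>A linear functional on the ambient space, applied to the entry of a one-element list, is
  a multilinear form. Functionals separate points, so the passage to formal combinations loses
  nothing.\<close>

lemma tensor1_inj:
  fixes V :: "('k::field, 'a::ab_group_add) dgmod"
  assumes V: "graded V"
  shows "inj_on (tensor1 V i) (grd V i)"
proof (rule inj_onI)
  fix x y assume xy: "x \<in> grd V i" "y \<in> grd V i" and eq: "tensor1 V i x = tensor1 V i y"
  have "x - y = 0"
  proof (rule functional_separates)
    show "vector_space (scl V)" using V by (simp add: graded_def)
    fix l :: "'a \<Rightarrow> 'k" assume "Vector_Spaces.linear (scl V) (*) l"
    then interpret l: Vector_Spaces.linear "scl V" "(*)" l .
    define \<Phi> where "\<Phi> vs = l (snd (hd vs))" for vs :: "(int \<times> 'a) list"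
    have "\<Phi> \<in> multilinear_forms V 1"
      by (auto simp: multilinear_forms_iff \<Phi>_def l.add l.scale intro!: linear_betweenI)
    then have "tensor1 V i z \<Phi> = l z" for z
      by (simp add: tensor1_def pure_tensor_def ev_def \<Phi>_def)
    then show "l (x - y) = 0"
      using eq by (metis l.diff right_minus_eq)
  qed
  then show "x = y" by simp
qed

text \<open>The tensors \<open>tensor0 V c\<close> all sit in degree 0. The value lies in degree
  \<open>i\<close> nevertheless, because a degree-preserving \<open>\<epsilon>\<close> is zero in
  every degree \<open>i \<noteq> 0\<close>.\<close>

lemma linear_tensor0:
  assumes "\<And>i. linear_between (scl V) (*) (grd V i) (if i = 0 then UNIV else {0}) (\<epsilon> i)"
  shows "linear_between (scl V) fscale (grd V i) (grd (tensor_power V 0) i) (\<lambda>x. tensor0 V (\<epsilon> i x))"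
proof (rule linear_betweenI)
  fix x assume "x \<in> grd V i"
  then have "\<epsilon> i x \<in> (if i = 0 then UNIV else {0})"
    by (rule linear_between_mem[OF assms])
  moreover have "tensor0 V c \<in> grd (tensor_power V 0) 0" for c
    using pure_tensor_mem[of "[]" 0 V 0] unfolding tensor0_def
    by (simp add: formal.span_scale)
  ultimately show "tensor0 V (\<epsilon> i x) \<in> grd (tensor_power V 0) i"
    by (cases "i = 0") (simp_all add: tensor0_def formal.span_zero del: tensor_power_simps(2), simp add: formal.span_zero)
qed (auto simp: tensor0_def linear_between_add[OF assms] linear_between_scale[OF assms] formal.scale_left_distrib)

lemma tensor0_append:
  assumes "graded V" "homogeneous V ys"
  shows "tensor_append V (tensor0 V c) (pure_tensor V ys) = fscale c (pure_tensor V ys)"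
    and "tensor_append V (pure_tensor V ys) (tensor0 V c) = fscale c (pure_tensor V ys)"
proof -
  show "tensor_append V (tensor0 V c) (pure_tensor V ys) = fscale c (pure_tensor V ys)"
    using tensor_append_pure[OF assms(1) _ assms(2), of "[]"]
    by (simp add: tensor0_def tensor_append_def)
  have "pure_tensor V [] \<in> grd (tensor_power V 0) 0"
    by (rule pure_tensor_mem) simp_all
  then show "tensor_append V (pure_tensor V ys) (tensor0 V c) = fscale c (pure_tensor V ys)"
    unfolding tensor0_def
    using linear_between_scale[OF linear_tensor_append_right[OF assms(1) pure_tensor_mem[OF refl assms(2) refl]]]
      tensor_append_pure[OF assms, of "[]"] by simp
qed

section \<open>Differentials, functoriality and trivial permutations of tensors\<close>

lemma tensor_dif_1:
  assumes V: "dg_module V"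
  shows "dif (tensor_power V n) d (tensor1 V i x) = tensor1 V (i - 1) (dif V i x)"
  unfolding tensor_power_def dgmod.simps tensor1_def
  by (subst bind_pure_tensor)
     (auto intro!: admissible_multilinear_1 linear_between_comp[OF dg_module_dif[OF V] linear_on_pure_tensor_1])

text \<open>The sign of a summand is given by the total degree of the entries to its left: 0 for the
  first entry and \<open>i\<close> for the second.\<close>

lemma tensor_dif_2:
  assumes V: "dg_module V" "x \<in> grd V i" "y \<in> grd V j"
  shows "dif (tensor_power V n) d (pure_tensor V [(i, x), (j, y)]) =
    pure_tensor V [(i - 1, dif V i x), (j, y)] + fscale ((-1) powi i) (pure_tensor V [(i, x), (j - 1, dif V j y)])"
  unfolding tensor_power_def dgmod.simps
  by (subst bind_pure_tensor)
     (auto intro!: admissible_multilinear_2 linear_on_plus linear_on_fscale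
       linear_on_pure_tensor_2 linear_between_comp[OF dg_module_dif[OF V(1)] linear_on_pure_tensor_2(1)]
       linear_between_comp[OF dg_module_dif[OF V(1)] linear_on_pure_tensor_2(2)]
       linear_between_mem[OF dg_module_dif[OF V(1)]])

lemma linear_tensor_dif: "linear_on fscale fscale A (dif (tensor_power V n) d)"
  unfolding tensor_power_def dgmod.simps by (rule linear_bind)

lemma tensor_map_pure:
  assumes f: "\<And>i. linear_between (scl V) (scl W) (grd V i) (grd W i) (f i)"
  shows "tensor_map W f (pure_tensor V vs) = pure_tensor W (map (\<lambda>(i, v). (i, f i v)) vs)"
proof -
  have map: "homogeneous W (map (\<lambda>(i, v). (i, f i v)) vs)" if "homogeneous V vs" for vs
    using that linear_between_mem[OF f] by (fastforce simp: homogeneous_def)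
  show ?thesis
    unfolding tensor_map_def
    by (rule bind_pure_tensor, rule admissible_multilinearI)
       (auto intro!: linear_between_comp[OF f linear_pure_tensor] map)
qed

lemma linear_tensor_map: "linear_on fscale fscale A (tensor_map W f)"
  unfolding tensor_map_def by (rule linear_bind)

lemma koszul_sign_id [simp]: "koszul_sign id ds = 1"
  unfolding koszul_sign_def by (rule prod.neutral) auto

lemma tensor_perm_id:
  assumes "T \<in> grd (tensor_power V n) d"
  shows "tensor_perm V id T = T"
  unfolding tensor_perm_def
  by (rule tensor_power_linear_eq[OF linear_bind linear_between_id _ assms])
     (simp add: bind_pure_tensor admissible_pure_tensor)

lemma tensor_concat_single:
  assumes "graded V" "T \<in> grd (tensor_power V n) d"
  shows "tensor_concat V [T] = T"
  unfolding tensor_concat_def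
  by (simp, rule tensor_power_linear_eq[OF linear_tensor_append_left linear_between_id _ assms(2)])
     (simp add: tensor_append_pure assms(1))


section \<open>Composition products in arity one\<close>

lemma chunks_Nil [simp]: "chunks [] xs = []"
  by (simp add: chunks_def)

lemma chunks_Cons [simp]: "chunks (n # ns) xs = take n xs # chunks ns (drop n xs)"
proof -
  have "[0..<length (n # ns)] = 0 # map Suc [0..<length ns]"
    by (simp add: upt_conv_Cons map_Suc_upt del: upt_Suc)
  then show ?thesis by (simp add: chunks_def add.commute)
qed

lemma length_chunks [simp]: "length (chunks ns xs) = length ns"
  by (simp add: chunks_def)

lemma concat_chunks: "sum_list ns = length xs \<Longrightarrow> concat (chunks ns xs) = xs"
  by (induction ns arbitrary: xs) auto

lemma map_length_chunks: "sum_list ns = length xs \<Longrightarrow> map length (chunks ns xs) = ns"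
  by (induction ns arbitrary: xs) auto

text \<open>Block permutations and block sums are defined by their lists of values. The multiset of
  values is easy to follow through cutting, rearranging and concatenating, and it determines
  bijectivity.\<close>

lemma list_perm_permutes:
  assumes "mset ks = mset [0..<n]"
  shows "list_perm ks permutes {..<n}"
proof (rule bij_imp_permutes)
  have ks: "distinct ks" "set ks = {..<n}" "length ks = n"
    using mset_eq_imp_distinct_iff[OF assms] mset_eq_setD[OF assms] mset_eq_length[OF assms]
    by (simp_all add: atLeast0LessThan)
  have "bij_betw ((!) ks) {..<n} {..<n}"
    using ks by (intro bij_betw_nth) auto
  then show "bij_betw (list_perm ks) {..<n} {..<n}"
    by (rule bij_betw_cong[THEN iffD1, rotated]) (use ks in \<open>auto simp: list_perm_def\<close>)
  show "list_perm ks x = x" if "x \<notin> {..<n}" for x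
    using that ks by (auto simp: list_perm_def)
qed

lemma mset_concat_cong: "mset (map mset xss) = mset (map mset yss) \<Longrightarrow> mset (concat xss) = mset (concat yss)"
  by (metis mset_concat sum_mset_sum_list)

lemma block_perm_permutes:
  assumes "\<tau> permutes {..<length ns}"
  shows "block_perm \<tau> ns permutes {..<sum_list ns}"
  unfolding block_perm_def
proof (rule list_perm_permutes)
  have "mset (concat (permute_list \<tau> (chunks ns [0..<sum_list ns]))) = mset (concat (chunks ns [0..<sum_list ns]))"
    by (rule mset_concat_cong) (simp add: assms)
  then show "mset (concat (permute_list \<tau> (chunks ns [0..<sum_list ns]))) = mset [0..<sum_list ns]"
    by (simp add: concat_chunks)
qed

lemma perm_sum_permutes:
  assumes "list_all2 (\<lambda>\<tau> a. \<tau> permutes {..<a}) \<tau>s ns"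
  shows "perm_sum \<tau>s ns permutes {..<sum_list ns}"
  unfolding perm_sum_def
proof (rule list_perm_permutes)
  have "map mset (map2 permute_list \<tau>s xss) = map mset xss"
    if "map length xss = ns" for xss :: "nat list list"
    using assms unfolding that[symmetric] list_all2_map2
    by (induction rule: list_all2_induct) auto
  from this[of "chunks ns [0..<sum_list ns]"]
  have "mset (concat (map2 permute_list \<tau>s (chunks ns [0..<sum_list ns]))) = mset (concat (chunks ns [0..<sum_list ns]))"
    by (intro mset_concat_cong) (simp add: map_length_chunks)
  then show "mset (concat (map2 permute_list \<tau>s (chunks ns [0..<sum_list ns]))) = mset [0..<sum_list ns]"
    by (simp add: concat_chunks)
qed

lemma permutes_1 [simp]: "\<sigma> permutes {..<Suc 0} \<longleftrightarrow> \<sigma> = id"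
  by (simp add: lessThan_Suc)

lemma block_perm_1: "block_perm id [Suc 0] = id"
  by (auto simp: block_perm_def list_perm_def fun_eq_iff)

text \<open>Unlike \<open>concentrated_in_arity_one\<close>, this involves no differentials, so that it passes to
  composition products without further work.\<close>

definition arity_one :: "('k::field, 'a::ab_group_add) smod \<Rightarrow> bool" where
  "arity_one M \<longleftrightarrow> (\<forall>n. graded (arity M n)) \<and> (\<forall>n i. n \<noteq> 1 \<longrightarrow> grd (arity M n) i = {0})
     \<and> (\<forall>n \<tau> i. \<tau> permutes {..<n} \<longrightarrow> (\<forall>x\<in>grd (arity M n) i. act M n \<tau> i x \<in> grd (arity M n) i))
     \<and> (\<forall>i. \<forall>x\<in>grd (arity M 1) i. act M 1 id i x = x)"

lemma arity_one_graded: "arity_one M \<Longrightarrow> graded (arity M n)"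
  and arity_one_grd: "arity_one M \<Longrightarrow> n \<noteq> Suc 0 \<Longrightarrow> grd (arity M n) i = {0}"
  and arity_one_act: "arity_one M \<Longrightarrow> \<tau> permutes {..<n} \<Longrightarrow> x \<in> grd (arity M n) i \<Longrightarrow>
    act M n \<tau> i x \<in> grd (arity M n) i"
  and arity_one_act_id: "arity_one M \<Longrightarrow> x \<in> grd (arity M (Suc 0)) i \<Longrightarrow> act M (Suc 0) id i x = x"
  by (auto simp: arity_one_def)

section \<open>Generators and forms of a composition product\<close>

lemma is_cgen_iff:
  "is_cgen M N n d ((p, \<mu>), \<nu>s, \<sigma>) \<longleftrightarrow>
     \<mu> \<in> grd (arity M (length \<nu>s)) p \<and> (\<forall>(a, q, \<nu>)\<in>set \<nu>s. \<nu> \<in> grd (arity N a) q)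
     \<and> \<sigma> permutes {..<n} \<and> sum_list (arities_of \<nu>s) = n \<and> p + sum_list (degrees_of \<nu>s) = d"
  by (simp add: is_cgen_def)

lemma is_cgen_1:
  "is_cgen M N (Suc 0) d ((p, x), [(a, q, y)], \<sigma>) \<longleftrightarrow>
     a = Suc 0 \<and> x \<in> grd (arity M (Suc 0)) p \<and> y \<in> grd (arity N (Suc 0)) q \<and> \<sigma> = id \<and> p + q = d"
  by (auto simp: is_cgen_iff)

text \<open>The action on the entries changes neither arities nor degrees. This and the next closure
  property show that both sides of an equivariance relation are evaluated at generators, so that a
  vanishing hypothesis about generators applies to them.\<close>

lemma is_cgen_act:
  assumes g: "is_cgen M N n d ((p, \<mu>), \<nu>s, \<sigma>)" and N: "arity_one N"
    and \<tau>s: "list_all2 (\<lambda>\<tau> a. \<tau> permutes {..<a}) \<tau>s (arities_of \<nu>s)"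
  shows "is_cgen M N n d ((p, \<mu>), map2 (\<lambda>\<tau> (a, q, \<nu>). (a, q, act N a \<tau> q \<nu>)) \<tau>s \<nu>s, \<sigma>)"
proof -
  have "list_all2 (\<lambda>\<tau> v. \<tau> permutes {..<fst v}) \<tau>s \<nu>s"
    using \<tau>s by (simp add: list_all2_map2)
  then have "arities_of (map2 (\<lambda>\<tau> (a, q, \<nu>). (a, q, act N a \<tau> q \<nu>)) \<tau>s \<nu>s) = arities_of \<nu>s
      \<and> degrees_of (map2 (\<lambda>\<tau> (a, q, \<nu>). (a, q, act N a \<tau> q \<nu>)) \<tau>s \<nu>s) = degrees_of \<nu>s
      \<and> ((\<forall>(a, q, \<nu>)\<in>set \<nu>s. \<nu> \<in> grd (arity N a) q) \<longrightarrow>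
        (\<forall>(a, q, \<nu>)\<in>set (map2 (\<lambda>\<tau> (a, q, \<nu>). (a, q, act N a \<tau> q \<nu>)) \<tau>s \<nu>s). \<nu> \<in> grd (arity N a) q))"
    by (induction rule: list_all2_induct) (auto intro: arity_one_act[OF N])
  moreover have "length \<tau>s = length \<nu>s" using list_all2_lengthD[OF \<tau>s] by simp
  ultimately show ?thesis using g unfolding is_cgen_iff by simp
qed

lemma sum_list_permute_list:
  fixes f :: "'b \<Rightarrow> 'c::comm_monoid_add"
  assumes "\<tau> permutes {..<length xs}"
  shows "sum_list (map f (permute_list \<tau> xs)) = sum_list (map f xs)"
  using mset_permute_list[OF assms] by (metis mset_map sum_mset_sum_list)

lemma is_cgen_permute:
  assumes g: "is_cgen M N n d ((p, \<mu>), \<nu>s, \<sigma>)" and M: "arity_one M"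
    and \<tau>: "\<tau> permutes {..<length \<nu>s}"
  shows "is_cgen M N n d ((p, act M (length \<nu>s) \<tau> p \<mu>), permute_list \<tau> \<nu>s, \<sigma>)"
proof -
  show ?thesis
    using g arity_one_act[OF M \<tau>] \<tau> unfolding is_cgen_iff by (simp add: sum_list_permute_list)
qed

text \<open>With \<open>k \<noteq> 1\<close> inputs the outer entry lies in \<open>M(k) = 0\<close>.
  With one input of arity \<open>n \<noteq> 1\<close> the inner entry lies in
  \<open>N(n) = 0\<close>. A form is linear in the slot concerned, hence zero there.\<close>

lemma cforms_vanish:
  assumes M: "arity_one M" and N: "arity_one N" and \<Phi>: "\<Phi> \<in> cforms M N n"
    and g: "is_cgen M N n d ((p, \<mu>), \<nu>s, \<sigma>)" and nontrivial: "length \<nu>s \<noteq> Suc 0 \<or> n \<noteq> Suc 0"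
  shows "\<Phi> ((p, \<mu>), \<nu>s, \<sigma>) = 0"
proof (cases "length \<nu>s = Suc 0")
  case False
  then have \<mu>: "\<mu> = 0" using g arity_one_grd[OF M False] by (auto simp: is_cgen_iff)
  have "linear_on (scl (arity M (length \<nu>s))) (*) (grd (arity M (length \<nu>s)) p) (\<lambda>x. \<Phi> ((p, x), \<nu>s, \<sigma>))"
    using \<Phi> g \<mu> unfolding cforms_def by blast
  from linear_between_zero[OF this graded_0[OF arity_one_graded[OF M]]] \<mu> show ?thesis by simp
next
  case True
  then obtain a q \<nu> where \<nu>s: "\<nu>s = [(a, q, \<nu>)]" by (auto simp: length_Suc_conv)
  with True g nontrivial have a: "a \<noteq> Suc 0" by (auto simp: is_cgen_iff)
  then have \<nu>: "\<nu> = 0" using g arity_one_grd[OF N a] by (auto simp: is_cgen_iff \<nu>s)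
  have "is_cgen M N n d ((p, \<mu>), [] @ (a, q, 0) # [], \<sigma>)" using g \<nu>s \<nu> by simp
  then have "linear_on (scl (arity N a)) (*) (grd (arity N a) q) (\<lambda>x. \<Phi> ((p, \<mu>), [] @ (a, q, x) # [], \<sigma>))"
    using \<Phi> unfolding cforms_def by blast
  from linear_between_zero[OF this graded_0[OF arity_one_graded[OF N]]] \<nu> \<nu>s show ?thesis by simp
qed

lemma ev_cforms_vanish:
  assumes "arity_one M" "arity_one N" "is_cgen M N n d ((p, \<mu>), \<nu>s, \<sigma>)" "length \<nu>s \<noteq> Suc 0 \<or> n \<noteq> Suc 0"
  shows "ev (cforms M N n) ((p, \<mu>), \<nu>s, \<sigma>) = 0"
  using cforms_vanish[OF assms(1,2) _ assms(3,4)] by (auto simp: ev_def fun_eq_iff)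

lemma linear_on_form_singleton:
  fixes V :: "('k::field, 'a::ab_group_add) dgmod"
  assumes "graded V" "f 0 = 0"
  shows "linear_on (scl V) (*) {0} f"
proof -
  interpret vector_space "scl V" using assms by (simp add: graded_def)
  show ?thesis using assms by (intro linear_betweenI) auto
qed

text \<open>For a single input all permutations are identities, so both equivariance relations are
  tautologies. For any other number of inputs both sides of each relation vanish by the last
  hypothesis.\<close>

lemma cforms_1I:
  assumes M: "arity_one M" and N: "arity_one N"
    and 1: "\<And>p q y. y \<in> grd (arity N (Suc 0)) q \<Longrightarrow>
      linear_on (scl (arity M (Suc 0))) (*) (grd (arity M (Suc 0)) p) (\<lambda>x. \<Phi> ((p, x), [(Suc 0, q, y)], id))"
    and 2: "\<And>p q x. x \<in> grd (arity M (Suc 0)) p \<Longrightarrow>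
      linear_on (scl (arity N (Suc 0))) (*) (grd (arity N (Suc 0)) q) (\<lambda>y. \<Phi> ((p, x), [(Suc 0, q, y)], id))"
    and 0: "\<And>d p x \<nu>s \<sigma>. is_cgen M N (Suc 0) d ((p, x), \<nu>s, \<sigma>) \<Longrightarrow> length \<nu>s \<noteq> Suc 0 \<Longrightarrow>
      \<Phi> ((p, x), \<nu>s, \<sigma>) = 0"
  shows "\<Phi> \<in> cforms M N (Suc 0)"
  unfolding cforms_def mem_Collect_eq
proof (intro conjI allI impI; elim exE)
  fix p \<nu>s \<sigma> d assume g: "is_cgen M N (Suc 0) d ((p, 0), \<nu>s, \<sigma>)"
  show "linear_on (scl (arity M (length \<nu>s))) (*) (grd (arity M (length \<nu>s)) p) (\<lambda>x. \<Phi> ((p, x), \<nu>s, \<sigma>))"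
  proof (cases "length \<nu>s = Suc 0")
    case True
    then show ?thesis using g 1 by (auto simp: length_Suc_conv is_cgen_1)
  next
    case False
    then show ?thesis
      using 0[OF g] by (simp add: arity_one_grd[OF M False] linear_on_form_singleton[OF arity_one_graded[OF M]])
  qed
next
  fix p \<mu> l a q r \<sigma> d assume g: "is_cgen M N (Suc 0) d ((p, \<mu>), l @ (a, q, 0) # r, \<sigma>)"
  show "linear_on (scl (arity N a)) (*) (grd (arity N a) q) (\<lambda>x. \<Phi> ((p, \<mu>), l @ (a, q, x) # r, \<sigma>))"
  proof (cases "l = [] \<and> r = []")
    case True
    then show ?thesis using g 2 by (auto simp: is_cgen_1)
  next
    case False
    \<comment> \<open>There is a further input besides the varying one, so the form is identically
      zero in this slot.\<close>
    have "\<Phi> ((p, \<mu>), l @ (a, q, x) # r, \<sigma>) = 0" if "x \<in> grd (arity N a) q" for x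
      by (rule 0[of d]) (use g that False in \<open>auto simp: is_cgen_iff\<close>)
    then show ?thesis
      by (intro graded_linear_cong[OF linear_on_form_0 arity_one_graded[OF N]]) simp
  qed
next
  fix p \<mu> \<nu>s \<sigma> \<tau>s d assume g: "is_cgen M N (Suc 0) d ((p, \<mu>), \<nu>s, \<sigma>)"
    and \<tau>s: "list_all2 (\<lambda>\<tau> a. \<tau> permutes {..<a}) \<tau>s (arities_of \<nu>s)"
  note len = list_all2_lengthD[OF \<tau>s]
  show "\<Phi> ((p, \<mu>), map2 (\<lambda>\<tau> (a, q, \<nu>). (a, q, act N a \<tau> q \<nu>)) \<tau>s \<nu>s, \<sigma>)
     = \<Phi> ((p, \<mu>), \<nu>s, perm_sum \<tau>s (arities_of \<nu>s) \<circ> \<sigma>)"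
  proof (cases "length \<nu>s = Suc 0")
    case True
    then obtain q \<nu> where *: "\<nu>s = [(Suc 0, q, \<nu>)]" "\<nu> \<in> grd (arity N (Suc 0)) q" "\<tau>s = [id]"
      using g \<tau>s by (auto simp: length_Suc_conv is_cgen_1 list_all2_Cons2)
    have "perm_sum [id] [Suc 0] = id"
      by (auto simp: perm_sum_def list_perm_def fun_eq_iff)
    then show ?thesis using * by (simp add: arity_one_act_id[OF N])
  next
    case False
    \<comment> \<open>The right-hand side of the relation is again taken at a generator, since a
      block sum of permutations permutes the inputs.\<close>
    have "is_cgen M N (Suc 0) d ((p, \<mu>), \<nu>s, perm_sum \<tau>s (arities_of \<nu>s) \<circ> \<sigma>)"
      using g perm_sum_permutes[OF \<tau>s] permutes_compose unfolding is_cgen_iff by metis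
    from 0[OF this False] 0[OF is_cgen_act[OF g N \<tau>s]] False len show ?thesis by simp
  qed
next
  fix p \<mu> \<nu>s \<sigma> \<tau> d assume g: "is_cgen M N (Suc 0) d ((p, \<mu>), \<nu>s, \<sigma>)"
    and \<tau>: "\<tau> permutes {..<length \<nu>s}"
  show "koszul_sign \<tau> (degrees_of \<nu>s) * \<Phi> ((p, act M (length \<nu>s) \<tau> p \<mu>), permute_list \<tau> \<nu>s, \<sigma>)
     = \<Phi> ((p, \<mu>), \<nu>s, block_perm \<tau> (arities_of \<nu>s) \<circ> \<sigma>)"
  proof (cases "length \<nu>s = Suc 0")
    case True
    then obtain q \<nu> where *: "\<nu>s = [(Suc 0, q, \<nu>)]" "\<mu> \<in> grd (arity M (Suc 0)) p" "\<tau> = id"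
      using g \<tau> by (auto simp: length_Suc_conv is_cgen_1)
    then show ?thesis by (simp add: arity_one_act_id[OF M] block_perm_1)
  next
    case False
    have "is_cgen M N (Suc 0) d ((p, \<mu>), \<nu>s, block_perm \<tau> (arities_of \<nu>s) \<circ> \<sigma>)"
      using g block_perm_permutes[of \<tau> "arities_of \<nu>s"] \<tau> permutes_compose
      unfolding is_cgen_iff by (metis length_map)
    from 0[OF this False] 0[OF is_cgen_permute[OF g M \<tau>]] False show ?thesis by simp
  qed
qed

text \<open>The well-definedness test for all maps out of a composition product in arity one: the
  associator, the differential, the unit isomorphisms and the lax structure map all pass through
  it.\<close>

lemma admissible_cformsI:
  assumes M: "arity_one M" and N: "arity_one N"
    and 1: "\<And>p q y. y \<in> grd (arity N (Suc 0)) q \<Longrightarrow>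
      linear_on (scl (arity M (Suc 0))) fscale (grd (arity M (Suc 0)) p) (\<lambda>x. h ((p, x), [(Suc 0, q, y)], id))"
    and 2: "\<And>p q x. x \<in> grd (arity M (Suc 0)) p \<Longrightarrow>
      linear_on (scl (arity N (Suc 0))) fscale (grd (arity N (Suc 0)) q) (\<lambda>y. h ((p, x), [(Suc 0, q, y)], id))"
    and 0: "\<And>d p x \<nu>s \<sigma>. is_cgen M N (Suc 0) d ((p, x), \<nu>s, \<sigma>) \<Longrightarrow> length \<nu>s \<noteq> Suc 0 \<Longrightarrow>
      h ((p, x), \<nu>s, \<sigma>) = 0"
  shows "admissible (cforms M N (Suc 0)) h"
  unfolding admissible_def
  by (intro allI cforms_1I[OF M N])
     (use 0 1[unfolded linear_on_formal_iff] 2[unfolded linear_on_formal_iff] in auto)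

section \<open>Composites of two operations of arity one\<close>

definition comp_pure :: "('k::field, 'a::ab_group_add) smod \<Rightarrow> ('k, 'b::ab_group_add) smod
    \<Rightarrow> int \<times> 'a \<Rightarrow> int \<times> 'b \<Rightarrow> (('a, 'b) cgen, 'k) formal" where
  "comp_pure M N x y = ev (cforms M N (Suc 0)) (x, [(Suc 0, y)], id)"

lemma linear_comp_pure_left:
  assumes "y \<in> grd (arity N (Suc 0)) q" "arity_one M"
  shows "linear_on (scl (arity M (Suc 0))) fscale (grd (arity M (Suc 0)) p) (\<lambda>x. comp_pure M N (p, x) (q, y))"
  unfolding linear_on_formal_iff
proof
  fix \<Phi>
  \<comment> \<open>\<open>cforms\<close> requires linearity only at slots of generators, which it
    recognizes by putting 0 into the slot; this is the required witness.\<close>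
  have g: "is_cgen M N (Suc 0) (p + q) ((p, 0), [(Suc 0, q, y)], id)"
    using assms by (simp add: is_cgen_1 graded_0 arity_one_graded)
  show "linear_on (scl (arity M (Suc 0))) (*) (grd (arity M (Suc 0)) p) (\<lambda>x. comp_pure M N (p, x) (q, y) \<Phi>)"
  proof (cases "\<Phi> \<in> cforms M N (Suc 0)")
    case True
    then have "linear_on (scl (arity M (length [(Suc 0, q, y)]))) (*) (grd (arity M (length [(Suc 0, q, y)])) p)
        (\<lambda>x. \<Phi> ((p, x), [(Suc 0, q, y)], id))"
      using g unfolding cforms_def by blast
    with True show ?thesis by (simp add: comp_pure_def ev_def)
  qed (simp add: comp_pure_def ev_def linear_on_form_0)
qed

lemma linear_comp_pure_right:
  assumes "x \<in> grd (arity M (Suc 0)) p" "arity_one N"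
  shows "linear_on (scl (arity N (Suc 0))) fscale (grd (arity N (Suc 0)) q) (\<lambda>y. comp_pure M N (p, x) (q, y))"
  unfolding linear_on_formal_iff
proof
  fix \<Phi>
  have g: "is_cgen M N (Suc 0) (p + q) ((p, x), [] @ (Suc 0, q, 0) # [], id)"
    using assms by (simp add: is_cgen_1 graded_0 arity_one_graded)
  show "linear_on (scl (arity N (Suc 0))) (*) (grd (arity N (Suc 0)) q) (\<lambda>y. comp_pure M N (p, x) (q, y) \<Phi>)"
  proof (cases "\<Phi> \<in> cforms M N (Suc 0)")
    case True
    then have "linear_on (scl (arity N (Suc 0))) (*) (grd (arity N (Suc 0)) q)
        (\<lambda>y. \<Phi> ((p, x), [] @ (Suc 0, q, y) # [], id))"
      using g unfolding cforms_def by blast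
    with True show ?thesis by (simp add: comp_pure_def ev_def)
  qed (simp add: comp_pure_def ev_def linear_on_form_0)
qed

lemma bind_comp_pure:
  "admissible (cforms M N (Suc 0)) h \<Longrightarrow> bind (comp_pure M N x y) h = h (x, [(Suc 0, y)], id)"
  unfolding comp_pure_def by (rule bind_ev)

definition comp_gens :: "('k, 'a) smod \<Rightarrow> ('k, 'b) smod \<Rightarrow> int \<Rightarrow> (('a, 'b) cgen) set" where
  "comp_gens M N d = {((p, x), [(Suc 0, q, y)], id) | p x q y.
     x \<in> grd (arity M (Suc 0)) p \<and> y \<in> grd (arity N (Suc 0)) q \<and> p + q = d}"

lemma comp_prod_scl [simp]: "scl (arity (comp_prod M N) n) = fscale"
  by (simp add: comp_prod_def)

lemma comp_prod_grd:
  "grd (arity (comp_prod M N) n) d = formal.span {ev (cforms M N n) g | g. is_cgen M N n d g}"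
  by (simp add: comp_prod_def)

lemma comp_prod_grd_1:
  assumes "arity_one M" "arity_one N"
  shows "grd (arity (comp_prod M N) (Suc 0)) d = formal.span (ev (cforms M N (Suc 0)) ` comp_gens M N d)"
    (is "_ = formal.span ?G")
proof
  have "ev (cforms M N (Suc 0)) g \<in> formal.span ?G" if g: "is_cgen M N (Suc 0) d g" for g
  proof -
    obtain p \<mu> \<nu>s \<sigma> where g': "g = ((p, \<mu>), \<nu>s, \<sigma>)" by (metis prod.exhaust)
    show ?thesis
    proof (cases "length \<nu>s = Suc 0")
      case True
      then have "g \<in> comp_gens M N d"
        using g unfolding g' by (auto simp: length_Suc_conv is_cgen_1 comp_gens_def)
      then show ?thesis by (intro formal.span_base) auto
    next
      case False
      then show ?thesis
        using ev_cforms_vanish[OF assms g[unfolded g']] by (simp add: g' formal.span_zero)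
    qed
  qed
  then show "grd (arity (comp_prod M N) (Suc 0)) d \<subseteq> formal.span ?G"
    unfolding comp_prod_grd by (intro formal.span_minimal formal.subspace_span) auto
  show "formal.span ?G \<subseteq> grd (arity (comp_prod M N) (Suc 0)) d"
    unfolding comp_prod_grd
    by (rule formal.span_mono) (fastforce simp: comp_gens_def is_cgen_1)
qed

lemma comp_prod_grd_not_1:
  assumes "arity_one M" "arity_one N" "n \<noteq> Suc 0"
  shows "grd (arity (comp_prod M N) n) d = {0}"
proof -
  have "{ev (cforms M N n) g | g. is_cgen M N n d g} \<subseteq> {0}"
    using ev_cforms_vanish[OF assms(1,2)] assms(3) by fastforce
  from formal.span_mono[OF this] show ?thesis
    unfolding comp_prod_grd using formal.span_zero by auto
qed

lemma comp_pure_mem: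
  assumes "x \<in> grd (arity M (Suc 0)) p" "y \<in> grd (arity N (Suc 0)) q" "p + q = d"
  shows "comp_pure M N (p, x) (q, y) \<in> grd (arity (comp_prod M N) (Suc 0)) d"
  unfolding comp_prod_grd comp_pure_def
proof (rule formal.span_base, rule CollectI, intro exI conjI)
  show "is_cgen M N (Suc 0) d ((p, x), [(Suc 0, q, y)], id)"
    using assms by (simp add: is_cgen_1)
qed (rule refl)

lemma comp_linear_eq:
  fixes t :: "'k::field \<Rightarrow> 'c::ab_group_add \<Rightarrow> 'c"
  assumes M: "arity_one M" and N: "arity_one N"
    and "linear_between fscale t (grd (arity (comp_prod M N) (Suc 0)) d) B f"
    "linear_between fscale t (grd (arity (comp_prod M N) (Suc 0)) d) D g"
    and "\<And>p x q y. x \<in> grd (arity M (Suc 0)) p \<Longrightarrow> y \<in> grd (arity N (Suc 0)) q \<Longrightarrow> p + q = d \<Longrightarrow>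
      f (comp_pure M N (p, x) (q, y)) = g (comp_pure M N (p, x) (q, y))"
    and "T \<in> grd (arity (comp_prod M N) (Suc 0)) d"
  shows "f T = g T"
  by (rule linear_on_span_eq[OF assms(3,4)[unfolded comp_prod_grd_1[OF M N]] _ assms(6)[unfolded comp_prod_grd_1[OF M N]]])
     (use assms(5) in \<open>auto simp: comp_gens_def comp_pure_def\<close>)

lemma comp_linear_between:
  fixes t :: "'k::field \<Rightarrow> 'c::ab_group_add \<Rightarrow> 'c"
  assumes M: "arity_one M" and N: "arity_one N"
    and "linear_on fscale t (grd (arity (comp_prod M N) (Suc 0)) d) f"
    and "\<And>p x q y. x \<in> grd (arity M (Suc 0)) p \<Longrightarrow> y \<in> grd (arity N (Suc 0)) q \<Longrightarrow> p + q = d \<Longrightarrow>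
      f (comp_pure M N (p, x) (q, y)) \<in> B"
    and "vector_space t" "module.subspace t B"
  shows "linear_between fscale t (grd (arity (comp_prod M N) (Suc 0)) d) B f"
  unfolding comp_prod_grd_1[OF M N]
  by (rule linear_between_span[OF assms(3)[unfolded comp_prod_grd_1[OF M N]] _ assms(5,6)])
     (use assms(4) in \<open>auto simp: comp_gens_def comp_pure_def\<close>)

lemma comp_act_id:
  assumes M: "arity_one M" and N: "arity_one N"
    and T: "T \<in> grd (arity (comp_prod M N) (Suc 0)) d"
  shows "act (comp_prod M N) (Suc 0) id i T = T"
proof -
  have "admissible (cforms M N (Suc 0)) (\<lambda>(\<mu>, \<nu>s, \<sigma>). ev (cforms M N (Suc 0)) (\<mu>, \<nu>s, \<sigma> \<circ> id))"
    by (rule admissible_cformsI[OF M N])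
       (use linear_comp_pure_left[OF _ M] linear_comp_pure_right[OF _ N] ev_cforms_vanish[OF M N]
         in \<open>auto simp: comp_pure_def\<close>)
  then show ?thesis
    unfolding comp_prod_def smod.simps
    by (intro comp_linear_eq[OF M N linear_bind linear_between_id _ T]) (simp add: bind_comp_pure, simp add: comp_pure_def)
qed

text \<open>This makes threefold composites available, which coassociativity needs. Away from arity
  one the action preserves the zero space because \<open>bind\<close> maps 0 to 0.\<close>

lemma arity_one_comp_prod:
  assumes M: "arity_one M" and N: "arity_one N"
  shows "arity_one (comp_prod M N)"
proof -
  have "graded (arity (comp_prod M N) n)" for n
    by (simp add: graded_def vector_space_fscale comp_prod_grd formal.subspace_span)
  moreover have "act (comp_prod M N) n \<tau> i T \<in> grd (arity (comp_prod M N) n) i"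
    if "\<tau> permutes {..<n}" "T \<in> grd (arity (comp_prod M N) n) i" for n \<tau> i T
  proof (cases "n = Suc 0")
    case True
    then show ?thesis using that comp_act_id[OF M N] by simp
  next
    case False
    then show ?thesis using that by (simp add: comp_prod_grd_not_1[OF M N]) (simp add: comp_prod_def)
  qed
  ultimately show ?thesis
    unfolding arity_one_def using comp_prod_grd_not_1[OF M N] comp_act_id[OF M N] by simp
qed

section \<open>Functoriality of the composition product\<close>

definition smod_linear :: "('k::field, 'a::ab_group_add) smod \<Rightarrow> ('k, 'b::ab_group_add) smod
    \<Rightarrow> (nat \<Rightarrow> int \<Rightarrow> 'a \<Rightarrow> 'b) \<Rightarrow> bool" where
  "smod_linear M N f \<longleftrightarrow> (\<forall>n i. linear_between (scl (arity M n)) (scl (arity N n))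
     (grd (arity M n) i) (grd (arity N n) i) (f n i))"

text \<open>The cooperad laws use \<open>\<lambda>_ _ y. y\<close> as the identity. It need not be 0
  outside of its domain, as elements of \<open>smod_mor\<close> are, and therefore only degreewise
  linearity is asked of the arguments of \<open>comp_map\<close>.\<close>

lemma smod_linear_id: "smod_linear M M (\<lambda>_ _ x. x)"
  by (simp add: smod_linear_def linear_between_id)

lemma smod_linear_mem: "smod_linear M N f \<Longrightarrow> x \<in> grd (arity M n) i \<Longrightarrow> f n i x \<in> grd (arity N n) i"
  unfolding smod_linear_def by (blast intro: linear_between_mem)

lemma comp_map_pure:
  assumes M: "arity_one M" and N: "arity_one N" and M': "arity_one M'" and N': "arity_one N'"
    and f: "smod_linear M M' f" and g: "smod_linear N N' g"
  shows "comp_map M' N' f g (Suc 0) (comp_pure M N (p, x) (q, y))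
    = comp_pure M' N' (p, f (Suc 0) p x) (q, g (Suc 0) q y)"
proof -
  let ?h = "\<lambda>((p, \<mu>), \<nu>s, \<sigma>). ev (cforms M' N' (Suc 0))
     ((p, f (length \<nu>s) p \<mu>), map (\<lambda>(a, q, \<nu>). (a, q, g a q \<nu>)) \<nu>s, \<sigma>)"
  have "admissible (cforms M N (Suc 0)) ?h"
  proof (rule admissible_cformsI[OF M N])
    fix p q y assume "y \<in> grd (arity N (Suc 0)) q"
    then have "g (Suc 0) q y \<in> grd (arity N' (Suc 0)) q"
      by (rule smod_linear_mem[OF g])
    with f show "linear_on (scl (arity M (Suc 0))) fscale (grd (arity M (Suc 0)) p) (\<lambda>x. ?h ((p, x), [(Suc 0, q, y)], id))"
      using linear_between_comp[OF _ linear_comp_pure_left[OF _ M']]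
      unfolding smod_linear_def comp_pure_def by (simp, blast)
  next
    fix p q x assume "x \<in> grd (arity M (Suc 0)) p"
    then have "f (Suc 0) p x \<in> grd (arity M' (Suc 0)) p"
      by (rule smod_linear_mem[OF f])
    with g show "linear_on (scl (arity N (Suc 0))) fscale (grd (arity N (Suc 0)) q) (\<lambda>y. ?h ((p, x), [(Suc 0, q, y)], id))"
      using linear_between_comp[OF _ linear_comp_pure_right[OF _ N']]
      unfolding smod_linear_def comp_pure_def by (simp, blast)
  next
    \<comment> \<open>Applying maps entrywise keeps the arities and the number of inputs, so the
      image is again a generator with \<open>k \<noteq> 1\<close> inputs and evaluates to 0.\<close>
    fix d p \<mu> \<nu>s \<sigma> assume *: "is_cgen M N (Suc 0) d ((p, \<mu>), \<nu>s, \<sigma>)" "length \<nu>s \<noteq> Suc 0"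
    let ?\<nu>s = "map (\<lambda>(a, q, \<nu>). (a, q, g a q \<nu>)) \<nu>s"
    have "arities_of ?\<nu>s = arities_of \<nu>s" "degrees_of ?\<nu>s = degrees_of \<nu>s"
      by auto
    moreover have "\<forall>(a, q, \<nu>)\<in>set ?\<nu>s. \<nu> \<in> grd (arity N' a) q"
      using *(1) smod_linear_mem[OF g] by (auto simp: is_cgen_iff)
    ultimately have "is_cgen M' N' (Suc 0) d ((p, f (length \<nu>s) p \<mu>), ?\<nu>s, \<sigma>)"
      using *(1) smod_linear_mem[OF f] unfolding is_cgen_iff by (simp only: length_map simp_thms)
    then show "?h ((p, \<mu>), \<nu>s, \<sigma>) = 0"
      using *(2) ev_cforms_vanish[OF M' N'] by simp
  qed
  then show ?thesis
    unfolding comp_map_def by (subst bind_comp_pure) (simp_all add: comp_pure_def)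
qed

lemma linear_comp_map: "linear_on fscale fscale A (comp_map M' N' f g n)"
  unfolding comp_map_def by (rule linear_bind)

lemma linear_comp_assoc: "linear_on fscale fscale A (comp_assoc M N L n)"
  unfolding comp_assoc_def by (rule linear_bind)

section \<open>The associator\<close>

lemma shuffle_sign_single: "shuffle_sign [a] ys = 1"
  unfolding shuffle_sign_def by (rule prod.neutral) auto

text \<open>Distributing \<open>ys\<close> over the \<open>\<nu>s\<close> gives each entry as many
  inputs as its arity, so every block is a generator of \<open>N \<circ> L\<close>. The result
  therefore still has \<open>length \<nu>s\<close> inputs, and it vanishes when that number is not
  1. The degree stays existential since vanishing does not depend on it.\<close>

lemma is_cgen_chunks:
  assumes N: "\<forall>(a, q, \<nu>)\<in>set \<nu>s. \<nu> \<in> grd (arity N a) q"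
    and ys: "\<forall>(a, q, \<rho>)\<in>set ys. \<rho> \<in> grd (arity L a) q"
    and len: "sum_list (arities_of \<nu>s) = length ys"
    and \<mu>: "\<mu> \<in> grd (arity M (length \<nu>s)) p" and \<tau>: "\<tau> permutes {..<sum_list (arities_of ys)}"
  shows "\<exists>d. is_cgen M (comp_prod N L) (sum_list (arities_of ys)) d ((p, \<mu>),
     map2 (\<lambda>(a, q, \<nu>) zs. (sum_list (arities_of zs), q + sum_list (degrees_of zs),
        ev (cforms N L (sum_list (arities_of zs))) ((q, \<nu>), zs, id))) \<nu>s (chunks (arities_of \<nu>s) ys), \<tau>)"
    (is "\<exists>d. is_cgen _ _ _ d (_, map2 ?f _ ?yss, _)")
proof -
  have len': "map length ?yss = arities_of \<nu>s" by (rule map_length_chunks[OF len])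
  have con: "concat ?yss = ys" by (rule concat_chunks) (use len in simp)
  have "T \<in> grd (arity (comp_prod N L) a) q" if mem: "(a, q, T) \<in> set (map2 ?f \<nu>s ?yss)" for a q T
  proof -
    from mem obtain i where i: "i < length \<nu>s" "(a, q, T) = ?f (\<nu>s ! i) (?yss ! i)"
      by (auto simp: in_set_conv_nth)
    obtain b r \<nu> where \<nu>: "\<nu>s ! i = (b, r, \<nu>)" by (metis prod.exhaust)
    define zs where "zs = ?yss ! i"
    have "length zs = b"
      using arg_cong[OF len', of "\<lambda>l. l ! i"] i(1) \<nu> by (simp add: zs_def)
    moreover have "set zs \<subseteq> set ys"
      using i(1) arg_cong[OF con, of set] nth_mem[of i ?yss] by (auto simp: zs_def)
    moreover have "\<nu> \<in> grd (arity N b) r" using N i(1) \<nu> nth_mem by fastforce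
    ultimately have g: "is_cgen N L (sum_list (arities_of zs)) (r + sum_list (degrees_of zs)) ((r, \<nu>), zs, id)"
      using ys unfolding is_cgen_iff by (auto simp: permutes_id)
    then show ?thesis
      using i(2) \<nu> unfolding comp_prod_grd zs_def[symmetric]
      by (simp, intro formal.span_base, use g in blast)
  qed
  moreover have "sum_list (arities_of (map2 ?f \<nu>s ?yss)) = sum_list (arities_of ys)"
  proof -
    have "arities_of (map2 ?f \<nu>s ?yss) = map (\<lambda>zs. sum_list (arities_of zs)) ?yss"
      by (rule nth_equalityI) (auto simp: case_prod_beta)
    moreover have "sum_list (map (\<lambda>zs. sum_list (arities_of zs)) yss) = sum_list (arities_of (concat yss))"
      for yss :: "(nat \<times> int \<times> 'c) list list"
      by (induction yss) auto
    ultimately show ?thesis using con by metis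
  qed
  moreover have "length (map2 ?f \<nu>s ?yss) = length \<nu>s" by simp
  ultimately show ?thesis using \<mu> \<tau> unfolding is_cgen_iff by (simp only:) blast
qed

text \<open>The associator is a \<open>bind\<close> over composites whose outer entry is itself a
  combination, so two admissibility checks are nested. The label \<open>d\<close> of that entry is
  free: the associator discards it and recomputes degrees from the generators.\<close>

lemma comp_assoc_pure:
  assumes M: "arity_one M" and N: "arity_one N" and L: "arity_one L"
    and x: "x \<in> grd (arity M (Suc 0)) p" and y: "y \<in> grd (arity N (Suc 0)) q"
    and z: "z \<in> grd (arity L (Suc 0)) r"
  shows "comp_assoc M N L (Suc 0) (comp_pure (comp_prod M N) L (d, comp_pure M N (p, x) (q, y)) (r, z))
    = comp_pure M (comp_prod N L) (p, x) (q + r, comp_pure N L (q, y) (r, z))"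
proof -
  define inner where "inner \<rho>s \<tau> = (\<lambda>((p, \<mu>), \<nu>s, \<sigma>).
     let ys = permute_list (inv \<sigma>) \<rho>s; yss = chunks (arities_of \<nu>s) ys
     in fscale (koszul_sign \<sigma> (degrees_of ys)
          * shuffle_sign (degrees_of \<nu>s) (map (\<lambda>zs. sum_list (degrees_of zs)) yss))
        (ev (cforms M (comp_prod N L) (Suc 0))
          ((p, \<mu>),
           map2 (\<lambda>(a, q, \<nu>) zs. (sum_list (arities_of zs), q + sum_list (degrees_of zs),
               ev (cforms N L (sum_list (arities_of zs))) ((q, \<nu>), zs, id))) \<nu>s yss,
           block_perm \<sigma> (arities_of ys) \<circ> \<tau>)))"
    for \<rho>s :: "(nat \<times> int \<times> 'd) list" and \<tau> :: "nat \<Rightarrow> nat"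
  define outer where "outer = (\<lambda>((_ :: int, S), \<rho>s, \<tau>). bind S (inner \<rho>s \<tau>))"
  note NL = arity_one_comp_prod[OF N L] and MN = arity_one_comp_prod[OF M N]
  have inner_1: "inner [(Suc 0, r, z)] id ((p, x), [(Suc 0, q, y)], id)
      = comp_pure M (comp_prod N L) (p, x) (q + r, comp_pure N L (q, y) (r, z))" for p x q y r z
    by (simp add: inner_def Let_def shuffle_sign_single block_perm_1 comp_pure_def)
  have inner: "admissible (cforms M N (Suc 0)) (inner [(Suc 0, r, z)] id)"
    if z: "z \<in> grd (arity L (Suc 0)) r" for r z
  proof (rule admissible_cformsI[OF M N])
    fix p q y assume y: "y \<in> grd (arity N (Suc 0)) q"
    show "linear_on (scl (arity M (Suc 0))) fscale (grd (arity M (Suc 0)) p)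
       (\<lambda>x. inner [(Suc 0, r, z)] id ((p, x), [(Suc 0, q, y)], id))"
      unfolding inner_1 by (rule linear_comp_pure_left[OF comp_pure_mem[OF y z refl] M])
  next
    fix p q x assume x: "x \<in> grd (arity M (Suc 0)) p"
    have "linear_between (scl (arity N (Suc 0))) fscale (grd (arity N (Suc 0)) q)
      (grd (arity (comp_prod N L) (Suc 0)) (q + r)) (\<lambda>y. comp_pure N L (q, y) (r, z))"
      using linear_comp_pure_left[OF z N] comp_pure_mem[OF _ z refl] unfolding linear_between_def by blast
    then show "linear_on (scl (arity N (Suc 0))) fscale (grd (arity N (Suc 0)) q)
       (\<lambda>y. inner [(Suc 0, r, z)] id ((p, x), [(Suc 0, q, y)], id))"
      unfolding inner_1 using linear_between_comp[OF _ linear_comp_pure_right[OF x NL, unfolded comp_prod_scl]] by blast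
  next
    fix d p \<mu> \<nu>s \<sigma> assume g: "is_cgen M N (Suc 0) d ((p, \<mu>), \<nu>s, \<sigma>)" "length \<nu>s \<noteq> Suc 0"
    then have \<sigma>: "\<sigma> = id" by (simp add: is_cgen_iff)
    obtain d' where "is_cgen M (comp_prod N L) (Suc 0) d' ((p, \<mu>),
     map2 (\<lambda>(a, q, \<nu>) zs. (sum_list (arities_of zs), q + sum_list (degrees_of zs),
        ev (cforms N L (sum_list (arities_of zs))) ((q, \<nu>), zs, id))) \<nu>s (chunks (arities_of \<nu>s) [(Suc 0, r, z)]), id)"
      using is_cgen_chunks[of \<nu>s N "[(Suc 0, r, z)]" L \<mu> M p id] g z by (auto simp: is_cgen_iff)
    from ev_cforms_vanish[OF M NL this] g(2)
    show "inner [(Suc 0, r, z)] id ((p, \<mu>), \<nu>s, \<sigma>) = 0"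
      by (simp add: inner_def \<sigma> Let_def block_perm_1)
  qed
  have outer: "admissible (cforms (comp_prod M N) L (Suc 0)) outer"
  proof (rule admissible_cformsI[OF MN L])
    fix p q z
    show "linear_on (scl (arity (comp_prod M N) (Suc 0))) fscale (grd (arity (comp_prod M N) (Suc 0)) p)
       (\<lambda>S. outer ((p, S), [(Suc 0, q, z)], id))"
      by (simp add: outer_def linear_bind)
  next
    fix d r S assume S: "S \<in> grd (arity (comp_prod M N) (Suc 0)) d"
    have lin: "linear_on (scl (arity L (Suc 0))) fscale (grd (arity L (Suc 0)) r)
        (\<lambda>z. comp_pure M (comp_prod N L) (p, x) (q + r, comp_pure N L (q, y) (r, z)))"
      if x: "x \<in> grd (arity M (Suc 0)) p" and y: "y \<in> grd (arity N (Suc 0)) q" for p q x y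
    proof -
      have "linear_between (scl (arity L (Suc 0))) fscale (grd (arity L (Suc 0)) r)
        (grd (arity (comp_prod N L) (Suc 0)) (q + r)) (\<lambda>z. comp_pure N L (q, y) (r, z))"
        using linear_comp_pure_right[OF y L] comp_pure_mem[OF y _ refl] unfolding linear_between_def by blast
      then show ?thesis
        using linear_between_comp[OF _ linear_comp_pure_right[OF x NL, unfolded comp_prod_scl]] by blast
    qed
    note graded = arity_one_graded[OF L]
    show "linear_on (scl (arity L (Suc 0))) fscale (grd (arity L (Suc 0)) r)
       (\<lambda>z. outer ((d, S), [(Suc 0, r, z)], id))"
      unfolding outer_def prod.case
    proof (rule linear_betweenI)
      fix z z' assume zz: "z \<in> grd (arity L (Suc 0)) r" "z' \<in> grd (arity L (Suc 0)) r"
      \<comment> \<open>Here \<open>S\<close> is any combination and the sum sits inside the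
        function that is bound; it suffices to take a single composite for \<open>S\<close>.\<close>
      show "bind S (inner [(Suc 0, r, z + z')] id) = bind S (inner [(Suc 0, r, z)] id) + bind S (inner [(Suc 0, r, z')] id)"
        by (rule comp_linear_eq[OF M N linear_bind linear_on_plus[OF linear_bind linear_bind] _ S])
           (simp add: bind_comp_pure inner inner_1 zz graded_add[OF graded] linear_between_add[OF lin] fun_eq_iff)
    next
      fix c z assume z: "z \<in> grd (arity L (Suc 0)) r"
      show "bind S (inner [(Suc 0, r, scl (arity L (Suc 0)) c z)] id) = fscale c (bind S (inner [(Suc 0, r, z)] id))"
        by (rule comp_linear_eq[OF M N linear_bind linear_on_fscale[OF linear_bind] _ S])
           (simp add: bind_comp_pure inner inner_1 z graded_scale[OF graded] linear_between_scale[OF lin])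
    qed simp
  next
    fix e d S \<rho>s \<tau> assume "is_cgen (comp_prod M N) L (Suc 0) e ((d, S), \<rho>s, \<tau>)" "length \<rho>s \<noteq> Suc 0"
    \<comment> \<open>The outer entry belongs to \<open>(M \<circ> N)(k)\<close> with
      \<open>k \<noteq> 1\<close>, which is zero.\<close>
    then have "S = 0" by (simp add: is_cgen_iff comp_prod_grd_not_1[OF M N])
    then show "outer ((d, S), \<rho>s, \<tau>) = 0" by (simp add: outer_def)
  qed
  have "comp_assoc M N L (Suc 0) T = bind T outer" for T
    unfolding comp_assoc_def outer_def inner_def ..
  then show ?thesis
    by (simp add: bind_comp_pure outer) (simp add: outer_def bind_comp_pure inner z inner_1)
qed

section \<open>Differentials of composites\<close>

lemma concentrated_arity_one:
  assumes "concentrated_in_arity_one P"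
  shows "arity_one P"
  using assms unfolding concentrated_in_arity_one_def arity_one_def dg_smodule_def
  by (auto intro: dg_module_graded dest: linear_between_mem)

lemma concentrated_dg_module: "concentrated_in_arity_one P \<Longrightarrow> dg_module (arity P n)"
  by (auto simp: concentrated_in_arity_one_def dg_smodule_def)

text \<open>With a single input only the term \<open>j = 0\<close> of the sum remains, and its sign
  exponent is \<open>p\<close>. This is the Leibniz rule of a twofold tensor product. Linearity of
  the differentials in the other arities enters when the summands with \<open>k \<noteq> 1\<close>
  inputs are seen to vanish.\<close>

lemma comp_dif_pure:
  assumes M: "concentrated_in_arity_one M" and N: "concentrated_in_arity_one N"
    and x: "x \<in> grd (arity M (Suc 0)) p" and y: "y \<in> grd (arity N (Suc 0)) q"
  shows "dif (arity (comp_prod M N) (Suc 0)) d (comp_pure M N (p, x) (q, y)) =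
    comp_pure M N (p - 1, dif (arity M (Suc 0)) p x) (q, y)
    + fscale ((-1) powi p) (comp_pure M N (p, x) (q - 1, dif (arity N (Suc 0)) q y))"
proof -
  note aM = concentrated_arity_one[OF M] and aN = concentrated_arity_one[OF N]
  note dM = dg_module_dif[OF concentrated_dg_module[OF M]] and dN = dg_module_dif[OF concentrated_dg_module[OF N]]
  let ?h = "\<lambda>((p, \<mu>), \<nu>s, \<sigma>). ev (cforms M N (Suc 0)) ((p - 1, dif (arity M (length \<nu>s)) p \<mu>), \<nu>s, \<sigma>) +
         (\<Sum>j<length \<nu>s. case \<nu>s ! j of (a, q, \<nu>) \<Rightarrow>
            fscale ((-1) powi (p + sum_list (take j (degrees_of \<nu>s))))
              (ev (cforms M N (Suc 0)) ((p, \<mu>), \<nu>s[j := (a, q - 1, dif (arity N a) q \<nu>)], \<sigma>)))"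
  have h1: "?h ((p, x), [(Suc 0, q, y)], id) = comp_pure M N (p - 1, dif (arity M (Suc 0)) p x) (q, y)
    + fscale ((-1) powi p) (comp_pure M N (p, x) (q - 1, dif (arity N (Suc 0)) q y))" for p q x y
    by (simp add: comp_pure_def)
  have "admissible (cforms M N (Suc 0)) ?h"
  proof (rule admissible_cformsI[OF aM aN])
    fix p q y assume y: "y \<in> grd (arity N (Suc 0)) q"
    show "linear_on (scl (arity M (Suc 0))) fscale (grd (arity M (Suc 0)) p) (\<lambda>x. ?h ((p, x), [(Suc 0, q, y)], id))"
      unfolding h1
      by (intro linear_on_plus linear_on_fscale linear_comp_pure_left[OF linear_between_mem[OF dN y] aM]
          linear_between_comp[OF dM linear_comp_pure_left[OF y aM]])
  next
    fix p q x assume x: "x \<in> grd (arity M (Suc 0)) p"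
    show "linear_on (scl (arity N (Suc 0))) fscale (grd (arity N (Suc 0)) q) (\<lambda>y. ?h ((p, x), [(Suc 0, q, y)], id))"
      unfolding h1
      by (intro linear_on_plus linear_on_fscale linear_comp_pure_right[OF linear_between_mem[OF dM x] aN]
          linear_between_comp[OF dN linear_comp_pure_right[OF x aN]])
  next
    fix d p \<mu> \<nu>s \<sigma> assume *: "is_cgen M N (Suc 0) d ((p, \<mu>), \<nu>s, \<sigma>)" "length \<nu>s \<noteq> Suc 0"
    have "is_cgen M N (Suc 0) (d - 1) ((p - 1, dif (arity M (length \<nu>s)) p \<mu>), \<nu>s, \<sigma>)"
      using *(1) linear_between_mem[OF dM] by (auto simp: is_cgen_iff)
    note 1 = ev_cforms_vanish[OF aM aN this disjI1[OF *(2)]]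
    have 2: "(case \<nu>s ! j of (a, q, \<nu>) \<Rightarrow>
            fscale ((-1) powi (p + sum_list (take j (degrees_of \<nu>s))))
              (ev (cforms M N (Suc 0)) ((p, \<mu>), \<nu>s[j := (a, q - 1, dif (arity N a) q \<nu>)], \<sigma>))) = 0"
      if j: "j < length \<nu>s" for j
    proof -
      obtain a q \<nu> where \<nu>: "\<nu>s ! j = (a, q, \<nu>)" by (metis prod.exhaust)
      then have "\<nu> \<in> grd (arity N a) q" using *(1) j nth_mem by (fastforce simp: is_cgen_iff)
      then have "dif (arity N a) q \<nu> \<in> grd (arity N a) (q - 1)" by (rule linear_between_mem[OF dN])
      moreover have "arities_of (\<nu>s[j := (a, q - 1, dif (arity N a) q \<nu>)]) = arities_of \<nu>s"
        using \<nu> j by (auto simp: map_update intro: list_update_same_conv[THEN iffD2])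
      \<comment> \<open>The degree is left unevaluated: vanishing holds in any degree, so the shift
        by one need not be computed.\<close>
      ultimately have "is_cgen M N (Suc 0) (p + sum_list (degrees_of (\<nu>s[j := (a, q - 1, dif (arity N a) q \<nu>)])))
          ((p, \<mu>), \<nu>s[j := (a, q - 1, dif (arity N a) q \<nu>)], \<sigma>)"
        using *(1) set_update_subset_insert[of \<nu>s j] unfolding is_cgen_iff by fastforce
      from ev_cforms_vanish[OF aM aN this] *(2) show ?thesis by (simp add: \<nu>)
    qed
    show "?h ((p, \<mu>), \<nu>s, \<sigma>) = 0" by (simp add: 1 2)
  qed
  from bind_comp_pure[OF this, of "(p, x)" "(q, y)"] show ?thesis
    unfolding h1 by (simp add: comp_prod_def)
qed

lemma linear_comp_dif: "linear_on fscale fscale A (dif (arity (comp_prod M N) n) d)"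
  unfolding comp_prod_def smod.simps dgmod.simps by (rule linear_bind)

lemma subspace_comp_prod: "formal.subspace (grd (arity (comp_prod M N) n) d)"
  by (simp add: comp_prod_grd formal.subspace_span)

lemma linear_comp_pure_between:
  assumes "arity_one M" "arity_one N" "p + q = d"
  shows "y \<in> grd (arity N (Suc 0)) q \<Longrightarrow> linear_between (scl (arity M (Suc 0))) fscale (grd (arity M (Suc 0)) p)
      (grd (arity (comp_prod M N) (Suc 0)) d) (\<lambda>x. comp_pure M N (p, x) (q, y))"
    and "x \<in> grd (arity M (Suc 0)) p \<Longrightarrow> linear_between (scl (arity N (Suc 0))) fscale (grd (arity N (Suc 0)) q)
      (grd (arity (comp_prod M N) (Suc 0)) d) (\<lambda>y. comp_pure M N (p, x) (q, y))"
  by (rule linear_between_codomain, rule linear_comp_pure_left, assumption, rule assms,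
      rule comp_pure_mem[OF _ _ assms(3)], assumption, assumption)
     (rule linear_between_codomain, rule linear_comp_pure_right, assumption, rule assms,
      rule comp_pure_mem[OF _ _ assms(3)], assumption, assumption)

section \<open>The isomorphisms from tensor powers to iterated composites\<close>

lemma comp_one_pure:
  assumes P: "arity_one P"
  shows "comp_one P (pure_tensor (arity P (Suc 0)) [(i, x), (j, y)]) = comp_pure P P (i, x) (j, y)"
proof -
  have "admissible (multilinear_forms (arity P (Suc 0)) (length [(i, x), (j, y)]))
    (\<lambda>xs. ev (cforms P P 1) (xs ! 0, [(1, xs ! 1)], id))"
    unfolding One_nat_def comp_pure_def[symmetric] length_Cons list.size
    by (rule admissible_multilinear_2)
       (simp_all add: linear_comp_pure_left[OF _ P] linear_comp_pure_right[OF _ P])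
  then show ?thesis
    unfolding comp_one_def by (simp add: bind_pure_tensor comp_pure_def)
qed

lemma linear_comp_one: "linear_on fscale fscale A (comp_one P)"
  unfolding comp_one_def by (rule linear_bind)

lemma comp_one_between:
  assumes P: "arity_one P"
  shows "linear_between fscale fscale (grd (tensor_power (arity P (Suc 0)) 2) d)
    (grd (arity (comp_prod P P) (Suc 0)) d) (comp_one P)"
proof (rule tensor_power_linear_between[OF linear_comp_one _ vector_space_fscale subspace_comp_prod])
  fix vs assume "length vs = 2" "homogeneous (arity P (Suc 0)) vs" "sum_list (map fst vs) = d"
  then obtain i x j y where "vs = [(i, x), (j, y)]" "x \<in> grd (arity P (Suc 0)) i"
    "y \<in> grd (arity P (Suc 0)) j" "i + j = d"
    by (rule length_2_gens)
  then show "comp_one P (pure_tensor (arity P (Suc 0)) vs) \<in> grd (arity (comp_prod P P) (Suc 0)) d"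
    by (simp add: comp_one_pure[OF P] comp_pure_mem)
qed

text \<open>The value 0 for other numbers of inputs is forced by the relations. \<open>snd\<close>
  removes the arity label of the single input and leaves an element labelled with its
  degree.\<close>

definition comp_one_inv :: "('k::field, 'a::ab_group_add) smod
    \<Rightarrow> (('a, 'a) cgen, 'k) formal \<Rightarrow> ('a, 'k) tensor" where
  "comp_one_inv P S = bind S (\<lambda>(x, \<nu>s, _).
     if length \<nu>s = Suc 0 then pure_tensor (arity P (Suc 0)) [x, snd (hd \<nu>s)] else 0)"

lemma comp_one_inv_pure:
  assumes P: "arity_one P"
  shows "comp_one_inv P (comp_pure P P x y) = pure_tensor (arity P (Suc 0)) [x, y]"
proof -
  have "admissible (cforms P P (Suc 0)) (\<lambda>(x, \<nu>s, _).
     if length \<nu>s = Suc 0 then pure_tensor (arity P (Suc 0)) [x, snd (hd \<nu>s)] else 0)"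
    by (rule admissible_cformsI[OF P P]) (simp_all add: linear_on_pure_tensor_2)
  then show ?thesis
    unfolding comp_one_inv_def by (simp add: bind_comp_pure)
qed

lemma linear_comp_one_inv: "linear_on fscale fscale A (comp_one_inv P)"
  unfolding comp_one_inv_def by (rule linear_bind)

lemma comp_one_inv_between:
  assumes P: "arity_one P"
  shows "linear_between fscale fscale (grd (arity (comp_prod P P) (Suc 0)) d)
    (grd (tensor_power (arity P (Suc 0)) 2) d) (comp_one_inv P)"
  by (rule comp_linear_between[OF P P linear_comp_one_inv _ vector_space_fscale subspace_tensor_power])
     (simp add: comp_one_inv_pure[OF P] pure_tensor_mem del: tensor_power_simps)

lemma comp_one_inv_comp_one:
  assumes P: "arity_one P" and T: "T \<in> grd (tensor_power (arity P (Suc 0)) 2) d"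
  shows "comp_one_inv P (comp_one P T) = T"
proof (rule tensor_power_linear_eq[OF linear_between_comp[OF linear_comp_one linear_comp_one_inv]
      linear_between_id _ T])
  fix vs assume "length vs = 2" "homogeneous (arity P (Suc 0)) vs" "sum_list (map fst vs) = d"
  then obtain i x j y where "vs = [(i, x), (j, y)]"
    by (rule length_2_gens)
  then show "comp_one_inv P (comp_one P (pure_tensor (arity P (Suc 0)) vs)) = pure_tensor (arity P (Suc 0)) vs"
    by (simp add: comp_one_pure[OF P] comp_one_inv_pure[OF P])
qed

lemma comp_one_comp_one_inv:
  assumes P: "arity_one P" and T: "T \<in> grd (arity (comp_prod P P) (Suc 0)) d"
  shows "comp_one P (comp_one_inv P T) = T"
  by (rule comp_linear_eq[OF P P linear_between_comp[OF linear_comp_one_inv linear_comp_one] linear_between_id _ T])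
     (simp add: comp_one_pure[OF P] comp_one_inv_pure[OF P])

text \<open>Needed to cancel \<open>comp_one_inv P (comp_one P _)\<close> at a differential, as
  cancellation holds only inside a graded piece.\<close>

lemma tensor_dif_2_mem:
  assumes V: "dg_module V" and T: "T \<in> grd (tensor_power V 2) d"
  shows "dif (tensor_power V 2) d T \<in> grd (tensor_power V 2) (d - 1)"
proof (rule linear_between_mem[OF tensor_power_linear_between
      [OF linear_tensor_dif _ vector_space_fscale subspace_tensor_power] T])
  fix vs assume "length vs = 2" "homogeneous V vs" "sum_list (map fst vs) = d"
  then obtain i x j y where vs: "vs = [(i, x), (j, y)]" "x \<in> grd V i" "y \<in> grd V j" "i + j = d"
    by (rule length_2_gens)
  have "pure_tensor V [(i - 1, dif V i x), (j, y)] \<in> grd (tensor_power V 2) (d - 1)"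
    "pure_tensor V [(i, x), (j - 1, dif V j y)] \<in> grd (tensor_power V 2) (d - 1)"
    using vs linear_between_mem[OF dg_module_dif[OF V]] by (auto intro!: pure_tensor_mem simp del: tensor_power_simps)
  then show "dif (tensor_power V 2) d (pure_tensor V vs) \<in> grd (tensor_power V 2) (d - 1)"
    using vs by (simp only: tensor_dif_2[OF V] formal.subspace_add[OF subspace_tensor_power]
        formal.subspace_scale[OF subspace_tensor_power])
qed

text \<open>Both Leibniz rules have the sign \<open>(-1) powi i\<close> on the second summand, so
  the isomorphism is a chain map without correction.\<close>

lemma comp_one_dif:
  assumes P: "concentrated_in_arity_one P" and T: "T \<in> grd (tensor_power (arity P (Suc 0)) 2) d"
  shows "comp_one P (dif (tensor_power (arity P (Suc 0)) 2) d T)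
    = dif (arity (comp_prod P P) (Suc 0)) d (comp_one P T)"
proof (rule tensor_power_linear_eq[OF linear_between_comp[OF linear_tensor_dif linear_comp_one]
      linear_between_comp[OF linear_comp_one linear_comp_dif] _ T])
  note aP = concentrated_arity_one[OF P]
  fix vs assume "length vs = 2" "homogeneous (arity P (Suc 0)) vs" "sum_list (map fst vs) = d"
  then obtain i x j y where vs: "vs = [(i, x), (j, y)]" "x \<in> grd (arity P (Suc 0)) i"
    "y \<in> grd (arity P (Suc 0)) j" "i + j = d"
    by (rule length_2_gens)
  show "comp_one P (dif (tensor_power (arity P (Suc 0)) 2) d (pure_tensor (arity P (Suc 0)) vs))
      = dif (arity (comp_prod P P) (Suc 0)) d (comp_one P (pure_tensor (arity P (Suc 0)) vs))"
    by (simp add: linear_between_add[OF linear_comp_one, of _ UNIV] linear_between_scale[OF linear_comp_one, of _ UNIV] vs tensor_dif_2[OF concentrated_dg_module[OF P]] comp_one_pure[OF aP] comp_dif_pure[OF P P])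
qed

text \<open>The isomorphism \<open>P(1)\<^sup>\<otimes>\<^sup>3 \<cong> (P \<circ> (P \<circ> P))(1)\<close>, which transports coassociativity.\<close>

definition comp_triple :: "('k::field, 'a::ab_group_add) smod \<Rightarrow> ('a, 'k) tensor
    \<Rightarrow> (('a, (('a, 'a) cgen, 'k) formal) cgen, 'k) formal" where
  "comp_triple P T = bind T (\<lambda>xs. comp_pure P (comp_prod P P) (xs ! 0)
     (fst (xs ! 1) + fst (xs ! 2), comp_pure P P (xs ! 1) (xs ! 2)))"

definition comp_triple_inv :: "('k::field, 'a::ab_group_add) smod
    \<Rightarrow> (('a, (('a, 'a) cgen, 'k) formal) cgen, 'k) formal \<Rightarrow> ('a, 'k) tensor" where
  "comp_triple_inv P S = bind S (\<lambda>(x, \<nu>s, _). if length \<nu>s = Suc 0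
     then tensor_append (arity P (Suc 0)) (pure_tensor (arity P (Suc 0)) [x]) (comp_one_inv P (snd (snd (hd \<nu>s))))
     else 0)"

lemma linear_comp_triple: "linear_on fscale fscale A (comp_triple P)"
  unfolding comp_triple_def by (rule linear_bind)

lemma linear_comp_triple_inv: "linear_on fscale fscale A (comp_triple_inv P)"
  unfolding comp_triple_inv_def by (rule linear_bind)

lemma comp_triple_pure:
  assumes P: "arity_one P"
  shows "comp_triple P (pure_tensor (arity P (Suc 0)) [(i, x), (j, y), (k, z)])
    = comp_pure P (comp_prod P P) (i, x) (j + k, comp_pure P P (j, y) (k, z))"
proof -
  note PP = arity_one_comp_prod[OF P P]
  have "admissible (multilinear_forms (arity P (Suc 0)) (length [(i, x), (j, y), (k, z)]))
    (\<lambda>xs. comp_pure P (comp_prod P P) (xs ! 0) (fst (xs ! 1) + fst (xs ! 2), comp_pure P P (xs ! 1) (xs ! 2)))"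
    unfolding length_Cons list.size
    by (rule admissible_multilinear_3)
       (simp_all add: linear_comp_pure_left[OF _ P] comp_pure_mem
          linear_between_comp[OF linear_comp_pure_between(1)[OF P P refl] linear_comp_pure_right[OF _ PP, simplified]]
          linear_between_comp[OF linear_comp_pure_between(2)[OF P P refl] linear_comp_pure_right[OF _ PP, simplified]])
  then show ?thesis
    unfolding comp_triple_def by (simp add: bind_pure_tensor)
qed

lemma comp_triple_inv_pure:
  assumes P: "arity_one P" and x: "x \<in> grd (arity P (Suc 0)) i" and y: "y \<in> grd (arity P (Suc 0)) j"
    and z: "z \<in> grd (arity P (Suc 0)) k"
  shows "comp_triple_inv P (comp_pure P (comp_prod P P) (i, x) (d, comp_pure P P (j, y) (k, z)))
    = pure_tensor (arity P (Suc 0)) [(i, x), (j, y), (k, z)]"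
proof -
  note PP = arity_one_comp_prod[OF P P] and g = arity_one_graded[OF P]
  have "admissible (cforms P (comp_prod P P) (Suc 0)) (\<lambda>(x, \<nu>s, _). if length \<nu>s = Suc 0
     then tensor_append (arity P (Suc 0)) (pure_tensor (arity P (Suc 0)) [x]) (comp_one_inv P (snd (snd (hd \<nu>s))))
     else 0)" (is "admissible _ ?h")
  proof (rule admissible_cformsI[OF P PP])
    fix p q y
    show "linear_on (scl (arity P (Suc 0))) fscale (grd (arity P (Suc 0)) p) (\<lambda>x. ?h ((p, x), [(Suc 0, q, y)], id))"
      using linear_between_comp[OF linear_on_pure_tensor_1 linear_tensor_append_left] by simp
  next
    fix p q x assume "x \<in> grd (arity P (Suc 0)) p"
    then have "pure_tensor (arity P (Suc 0)) [(p, x)] \<in> grd (tensor_power (arity P (Suc 0)) 1) p"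
      by (intro pure_tensor_mem) simp_all
    then show "linear_on (scl (arity (comp_prod P P) (Suc 0))) fscale (grd (arity (comp_prod P P) (Suc 0)) q)
        (\<lambda>y. ?h ((p, x), [(Suc 0, q, y)], id))"
      using linear_between_comp[OF comp_one_inv_between[OF P] linear_tensor_append_right[OF g]]
      by (simp del: tensor_power_simps)
  qed auto
  then show ?thesis
    using x y z tensor_append_pure[OF g[of "Suc 0"], of "[(i, x)]" "[(j, y), (k, z)]"]
    unfolding comp_triple_inv_def by (simp add: bind_comp_pure comp_one_inv_pure[OF P])
qed

text \<open>A left inverse gives injectivity, which is what is required to pull the coassociativity
  equation back to the tensor cube.\<close>

lemma comp_triple_inv_comp_triple:
  assumes P: "arity_one P" and T: "T \<in> grd (tensor_power (arity P (Suc 0)) 3) d"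
  shows "comp_triple_inv P (comp_triple P T) = T"
proof (rule tensor_power_linear_eq[OF linear_between_comp[OF linear_comp_triple linear_comp_triple_inv]
      linear_between_id _ T])
  fix vs assume *: "length vs = 3" "homogeneous (arity P (Suc 0)) vs"
  then obtain a b c where "vs = [a, b, c]"
    by (auto simp: numeral_3_eq_3 length_Suc_conv)
  then show "comp_triple_inv P (comp_triple P (pure_tensor (arity P (Suc 0)) vs)) = pure_tensor (arity P (Suc 0)) vs"
    using * by (cases a; cases b; cases c) (simp add: comp_triple_pure[OF P] comp_triple_inv_pure[OF P])
qed

section \<open>Extension by zero from arity one\<close>

text \<open>Transported comultiplications and counits both have this shape, so one bijection between
  morphisms of modules and morphisms of S-modules serves both.\<close>

definition extend :: "(int \<Rightarrow> 'a \<Rightarrow> 'b::zero) \<Rightarrow> nat \<Rightarrow> int \<Rightarrow> 'a \<Rightarrow> 'b" where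
  "extend f = (\<lambda>n i x. if n = Suc 0 then f i x else 0)"

lemma cooperad_comult_extend: "cooperad_comult P \<Delta> = extend (\<lambda>i x. comp_one P (\<Delta> i x))"
  and cooperad_counit_extend: "cooperad_counit \<epsilon> = extend \<epsilon>"
  by (auto simp: cooperad_comult_def cooperad_counit_def extend_def fun_eq_iff)

lemma dg_mor_linear: "f \<in> dg_mor V W \<Longrightarrow> linear_between (scl V) (scl W) (grd V i) (grd W i) (f i)"
  and dg_mor_outside: "f \<in> dg_mor V W \<Longrightarrow> x \<notin> grd V i \<Longrightarrow> f i x = 0"
  and dg_mor_dif: "f \<in> dg_mor V W \<Longrightarrow> x \<in> grd V i \<Longrightarrow> f (i - 1) (dif V i x) = dif W i (f i x)"
  by (auto simp: dg_mor_def hom_deg_def)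

lemma dg_morI:
  assumes "\<And>i. linear_between (scl V) (scl W) (grd V i) (grd W i) (f i)"
    and "\<And>i x. x \<notin> grd V i \<Longrightarrow> f i x = 0"
    and "\<And>i x. x \<in> grd V i \<Longrightarrow> f (i - 1) (dif V i x) = dif W i (f i x)"
  shows "f \<in> dg_mor V W"
  using assms by (auto simp: dg_mor_def hom_deg_def)

lemma smod_mor_linear: "f \<in> smod_mor M N \<Longrightarrow> smod_linear M N f"
  using dg_mor_linear unfolding smod_mor_def smod_linear_def by blast

lemma linear_between_0_singleton:
  assumes "graded V" "graded W"
  shows "linear_between (scl V) (scl W) {0} (grd W i) (\<lambda>x. 0)"
proof -
  interpret V: vector_space "scl V" using assms by (simp add: graded_def)
  interpret W: vector_space "scl W" using assms by (simp add: graded_def)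
  show ?thesis by (intro linear_betweenI) (auto simp: graded_0 assms)
qed

text \<open>Away from arity one the map is zero, and compatibility with differentials there says
  exactly that the differential of \<open>N\<close> maps 0 to 0; equivariance holds because the
  action preserves the zero space.\<close>

lemma extend_smod_mor:
  assumes M: "arity_one M" and N: "arity_one N" and dif: "\<And>n i. dif (arity N n) i 0 = 0"
    and f: "f \<in> dg_mor (arity M (Suc 0)) (arity N (Suc 0))"
  shows "extend f \<in> smod_mor M N"
  unfolding smod_mor_def
proof (intro CollectI allI conjI ballI impI)
  fix n
  show "extend f n \<in> dg_mor (arity M n) (arity N n)"
  proof (cases "n = Suc 0")
    case True
    have "extend f (Suc 0) = f" by (simp add: extend_def)
    with True f show ?thesis by simp
  next
    case False
    then have "extend f n = (\<lambda>_ _. 0)" by (simp add: extend_def)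
    with False show ?thesis
      using linear_between_0_singleton[OF arity_one_graded[OF M] arity_one_graded[OF N]]
      by (auto intro!: dg_morI simp: arity_one_grd[OF M False] dif)
  qed
next
  fix n \<sigma> i x assume x: "x \<in> grd (arity M n) i" and \<sigma>: "\<sigma> permutes {..<n}"
  show "extend f n i (act M n \<sigma> i x) = act N n \<sigma> i (extend f n i x)"
  proof (cases "n = Suc 0")
    case True
    with x \<sigma> linear_between_mem[OF dg_mor_linear[OF f]] show ?thesis
      by (simp add: extend_def arity_one_act_id[OF M] arity_one_act_id[OF N])
  next
    case False
    have "act N n \<sigma> i 0 = 0"
      using arity_one_act[OF N \<sigma>, of 0 i] by (simp add: arity_one_grd[OF N False])
    with False show ?thesis by (simp add: extend_def)
  qed
qed

text \<open>In another arity the values on the domain lie in a zero space, and outside of the domain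
  they are 0 by convention.\<close>

lemma smod_mor_extend:
  assumes M: "arity_one M" and N: "arity_one N" and f: "f \<in> smod_mor M N"
  shows "f = extend (f (Suc 0))"
proof (intro ext)
  fix n i x
  have fn: "f n \<in> dg_mor (arity M n) (arity N n)" using f by (simp add: smod_mor_def)
  have "f n i x = 0" if "n \<noteq> Suc 0"
  proof (cases "x \<in> grd (arity M n) i")
    case True
    then show ?thesis
      using linear_between_mem[OF dg_mor_linear[OF fn] True] by (simp add: arity_one_grd[OF N that])
  qed (rule dg_mor_outside[OF fn])
  then show "f n i x = extend (f (Suc 0)) n i x" by (simp add: extend_def)
qed

lemma bij_smod_mor:
  assumes M: "arity_one M" and N: "arity_one N" and dif: "\<And>n i. dif (arity N n) i 0 = 0"
  shows "bij_betw (\<lambda>f. f (Suc 0)) (smod_mor M N) (dg_mor (arity M (Suc 0)) (arity N (Suc 0)))"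
    and "bij_betw extend (dg_mor (arity M (Suc 0)) (arity N (Suc 0))) (smod_mor M N)"
proof -
  have 1: "f (Suc 0) \<in> dg_mor (arity M (Suc 0)) (arity N (Suc 0))" if "f \<in> smod_mor M N" for f
    using that by (simp add: smod_mor_def)
  have 2: "extend f (Suc 0) = f" for f :: "int \<Rightarrow> 'b \<Rightarrow> 'c"
    by (simp add: extend_def)
  show "bij_betw (\<lambda>f. f (Suc 0)) (smod_mor M N) (dg_mor (arity M (Suc 0)) (arity N (Suc 0)))"
    by (rule bij_betw_byWitness[where f' = extend])
       (use 1 2 smod_mor_extend[OF M N] extend_smod_mor[OF M N dif] in auto)
  show "bij_betw extend (dg_mor (arity M (Suc 0)) (arity N (Suc 0))) (smod_mor M N)"
    by (rule bij_betw_byWitness[where f' = "\<lambda>f. f (Suc 0)"])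
       (use 1 2 smod_mor_extend[OF M N] extend_smod_mor[OF M N dif] in auto)
qed

lemma concentrated_dif_0: "concentrated_in_arity_one P \<Longrightarrow> dif (arity P n) i 0 = 0"
  using linear_between_zero[OF dg_module_dif graded_0[OF dg_module_graded]] concentrated_dg_module by blast

lemma comp_prod_dif_0: "dif (arity (comp_prod M N) n) i 0 = 0"
  by (simp add: comp_prod_def)

lemma unit_smod_arity: "arity unit_smod (Suc 0) = unit_mod"
  by (simp add: unit_smod_def in_arity_one_def)

lemma unit_smod_dif_0: "dif (arity unit_smod n) i 0 = 0"
  by (simp add: unit_smod_def in_arity_one_def unit_mod_def)

lemma unit_mod_simps:
  "scl unit_mod = (*)" "grd unit_mod i = (if i = 0 then UNIV else {0})"
  by (simp_all add: unit_mod_def)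

lemma arity_one_unit_smod: "arity_one (unit_smod :: ('k::field, 'k) smod)"
proof -
  interpret vector_space "(*) :: 'k \<Rightarrow> 'k \<Rightarrow> 'k"
    by unfold_locales (auto simp: algebra_simps)
  have "graded (arity (unit_smod :: ('k, 'k) smod) n)" for n
    using vector_space_axioms
    by (auto simp: graded_def unit_smod_def in_arity_one_def unit_mod_def subspace_UNIV subspace_def)
  then show ?thesis
    by (auto simp: arity_one_def unit_smod_def in_arity_one_def)
qed

lemma bij_cooperad_comult:
  assumes P: "concentrated_in_arity_one P"
  shows "bij_betw (cooperad_comult P) (dg_mor (arity P (Suc 0)) (tensor_power (arity P (Suc 0)) 2))
    (smod_mor P (comp_prod P P))"
proof -
  note aP = concentrated_arity_one[OF P]
  let ?C = "arity P (Suc 0)"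
  have 1: "(\<lambda>i x. comp_one P (\<Delta> i x)) \<in> dg_mor ?C (arity (comp_prod P P) (Suc 0))"
    if \<Delta>: "\<Delta> \<in> dg_mor ?C (tensor_power ?C 2)" for \<Delta>
  proof (rule dg_morI)
    show "linear_between (scl ?C) (scl (arity (comp_prod P P) (Suc 0))) (grd ?C i)
      (grd (arity (comp_prod P P) (Suc 0)) i) (\<lambda>x. comp_one P (\<Delta> i x))" for i
      using linear_between_comp[OF dg_mor_linear[OF \<Delta>] comp_one_between[OF aP, folded tensor_power_simps(1)[of ?C 2]]]
      by simp
    show "comp_one P (\<Delta> i x) = 0" if "x \<notin> grd ?C i" for i x
      using that by (simp add: dg_mor_outside[OF \<Delta>] comp_one_def)
    show "comp_one P (\<Delta> (i - 1) (dif ?C i x)) = dif (arity (comp_prod P P) (Suc 0)) i (comp_one P (\<Delta> i x))"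
      if x: "x \<in> grd ?C i" for i x
      using comp_one_dif[OF P linear_between_mem[OF dg_mor_linear[OF \<Delta>] x]] by (simp add: dg_mor_dif[OF \<Delta> x])
  qed
  have 2: "(\<lambda>i x. comp_one_inv P (f i x)) \<in> dg_mor ?C (tensor_power ?C 2)"
    if f: "f \<in> dg_mor ?C (arity (comp_prod P P) (Suc 0))" for f
  proof (rule dg_morI)
    show "linear_between (scl ?C) (scl (tensor_power ?C 2)) (grd ?C i)
      (grd (tensor_power ?C 2) i) (\<lambda>x. comp_one_inv P (f i x))" for i
      using linear_between_comp[OF dg_mor_linear[OF f] comp_one_inv_between[OF aP, folded comp_prod_scl[of P P "Suc 0"]]]
      by simp
    show "comp_one_inv P (f i x) = 0" if "x \<notin> grd ?C i" for i x
      using that by (simp add: dg_mor_outside[OF f] comp_one_inv_def)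
    show "comp_one_inv P (f (i - 1) (dif ?C i x)) = dif (tensor_power ?C 2) i (comp_one_inv P (f i x))"
      if x: "x \<in> grd ?C i" for i x
    proof -
      note fx = linear_between_mem[OF dg_mor_linear[OF f] x]
      have mem: "comp_one_inv P (f i x) \<in> grd (tensor_power ?C 2) i"
        by (rule linear_between_mem[OF comp_one_inv_between[OF aP] fx])
      \<comment> \<open>That the inverse commutes with differentials is deduced from the same
        property of \<open>comp_one\<close>: the value \<open>f i x\<close> is written as an image
        under \<open>comp_one\<close>, the differential is moved inside, and the two maps
        cancel.\<close>
      have "comp_one_inv P (f (i - 1) (dif ?C i x))
          = comp_one_inv P (dif (arity (comp_prod P P) (Suc 0)) i (comp_one P (comp_one_inv P (f i x))))"
        by (simp add: dg_mor_dif[OF f x] comp_one_comp_one_inv[OF aP fx])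
      also have "\<dots> = comp_one_inv P (comp_one P (dif (tensor_power ?C 2) i (comp_one_inv P (f i x))))"
        by (simp add: comp_one_dif[OF P mem])
      also have "\<dots> = dif (tensor_power ?C 2) i (comp_one_inv P (f i x))"
        by (rule comp_one_inv_comp_one[OF aP tensor_dif_2_mem[OF concentrated_dg_module[OF P] mem]])
      finally show ?thesis .
    qed
  qed
  have inv1: "comp_one_inv P (comp_one P (\<Delta> i x)) = \<Delta> i x"
    if "\<Delta> \<in> dg_mor ?C (tensor_power ?C 2)" for \<Delta> i x
  proof (cases "x \<in> grd ?C i")
    case True
    from comp_one_inv_comp_one[OF aP linear_between_mem[OF dg_mor_linear[OF that] True]] show ?thesis .
  qed (simp add: dg_mor_outside[OF that] comp_one_def comp_one_inv_def)
  have inv2: "comp_one P (comp_one_inv P (f i x)) = f i x"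
    if "f \<in> dg_mor ?C (arity (comp_prod P P) (Suc 0))" for f i x
  proof (cases "x \<in> grd ?C i")
    case True
    from comp_one_comp_one_inv[OF aP linear_between_mem[OF dg_mor_linear[OF that] True]] show ?thesis .
  qed (simp add: dg_mor_outside[OF that] comp_one_def comp_one_inv_def)
  have "bij_betw (\<lambda>\<Delta> i x. comp_one P (\<Delta> i x)) (dg_mor ?C (tensor_power ?C 2))
      (dg_mor ?C (arity (comp_prod P P) (Suc 0)))"
    by (rule bij_betw_byWitness[where f' = "\<lambda>f i x. comp_one_inv P (f i x)"])
       (use 1 2 inv1 inv2 in auto)
  from bij_betw_trans[OF this bij_smod_mor(2)[OF aP arity_one_comp_prod[OF aP aP] comp_prod_dif_0]]
  show ?thesis unfolding comp_def cooperad_comult_extend[symmetric] .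
qed

lemma bij_cooperad_counit:
  assumes P: "concentrated_in_arity_one P"
  shows "bij_betw cooperad_counit (dg_mor (arity P (Suc 0)) unit_mod) (smod_mor P unit_smod)"
  using bij_smod_mor(2)[OF concentrated_arity_one[OF P] arity_one_unit_smod unit_smod_dif_0]
  unfolding unit_smod_arity cooperad_counit_extend[abs_def] by simp


section \<open>Coalgebras and cooperads\<close>

text \<open>Two reductions to pure tensors are needed, one for \<open>T\<close> and one for
  \<open>\<Delta> i x\<close>, which is not pure even when \<open>T\<close> is. Afterwards both
  sides are the same threefold composite.\<close>

lemma coassoc_left:
  assumes P: "arity_one P" and \<Delta>: "\<And>i. linear_between (scl (arity P (Suc 0))) fscale
      (grd (arity P (Suc 0)) i) (grd (tensor_power (arity P (Suc 0)) 2) i) (\<Delta> i)"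
    and f: "smod_linear P (comp_prod P P) f" "\<And>i x. f (Suc 0) i x = comp_one P (\<Delta> i x)"
    and T: "T \<in> grd (tensor_power (arity P (Suc 0)) 2) d"
  shows "comp_assoc P P P (Suc 0) (comp_map (comp_prod P P) P f (\<lambda>_ _ y. y) (Suc 0) (comp_one P T))
    = comp_triple P (tensor2_map (arity P (Suc 0)) \<Delta> (tensor1 (arity P (Suc 0))) T)"
proof (rule tensor_power_linear_eq[OF
      linear_between_comp[OF linear_between_comp[OF linear_comp_one linear_comp_map] linear_comp_assoc]
      linear_between_comp[OF linear_tensor2_map linear_comp_triple] _ T])
  let ?C = "arity P (Suc 0)"
  note PP = arity_one_comp_prod[OF P P] and g = arity_one_graded[OF P]
  fix vs assume "length vs = 2" "homogeneous ?C vs" "sum_list (map fst vs) = d"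
  then obtain i x j y where vs: "vs = [(i, x), (j, y)]" "x \<in> grd ?C i" "y \<in> grd ?C j"
    by (rule length_2_gens)
  have "comp_assoc P P P (Suc 0) (comp_pure (comp_prod P P) P (i, comp_one P (\<Delta> i x)) (j, y))
      = comp_triple P (tensor_append ?C (\<Delta> i x) (pure_tensor ?C [(j, y)]))"
  proof (rule tensor_power_linear_eq[OF
      linear_between_comp[OF linear_between_comp[OF comp_one_between[OF P]
          linear_comp_pure_left[OF vs(3) PP, simplified]] linear_comp_assoc]
      linear_between_comp[OF linear_tensor_append_left linear_comp_triple]
      _ linear_between_mem[OF \<Delta> vs(2)]])
    fix us assume "length us = 2" "homogeneous ?C us" "sum_list (map fst us) = i"
    then obtain k u l v where us: "us = [(k, u), (l, v)]" "u \<in> grd ?C k" "v \<in> grd ?C l"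
      by (rule length_2_gens)
    then show "comp_assoc P P P (Suc 0) (comp_pure (comp_prod P P) P (i, comp_one P (pure_tensor ?C us)) (j, y))
      = comp_triple P (tensor_append ?C (pure_tensor ?C us) (pure_tensor ?C [(j, y)]))"
      using vs by (simp add: comp_one_pure[OF P] comp_assoc_pure[OF P P P] tensor_append_pure[OF g] comp_triple_pure[OF P])
  qed
  then show "comp_assoc P P P (Suc 0) (comp_map (comp_prod P P) P f (\<lambda>_ _ y. y) (Suc 0) (comp_one P (pure_tensor ?C vs)))
    = comp_triple P (tensor2_map ?C \<Delta> (tensor1 ?C) (pure_tensor ?C vs))"
    by (simp add: vs comp_one_pure[OF P] comp_map_pure[OF P P PP P f(1) smod_linear_id] f(2)
        tensor2_map_pure[OF g \<Delta> linear_tensor1]) (simp add: tensor1_def)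
qed

lemma coassoc_right:
  assumes P: "arity_one P" and \<Delta>: "\<And>i. linear_between (scl (arity P (Suc 0))) fscale
      (grd (arity P (Suc 0)) i) (grd (tensor_power (arity P (Suc 0)) 2) i) (\<Delta> i)"
    and f: "smod_linear P (comp_prod P P) f" "\<And>i x. f (Suc 0) i x = comp_one P (\<Delta> i x)"
    and T: "T \<in> grd (tensor_power (arity P (Suc 0)) 2) d"
  shows "comp_map P (comp_prod P P) (\<lambda>_ _ y. y) f (Suc 0) (comp_one P T)
    = comp_triple P (tensor2_map (arity P (Suc 0)) (tensor1 (arity P (Suc 0))) \<Delta> T)"
proof (rule tensor_power_linear_eq[OF
      linear_between_comp[OF linear_comp_one linear_comp_map]
      linear_between_comp[OF linear_tensor2_map linear_comp_triple] _ T])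
  let ?C = "arity P (Suc 0)"
  note PP = arity_one_comp_prod[OF P P] and g = arity_one_graded[OF P]
  fix vs assume "length vs = 2" "homogeneous ?C vs" "sum_list (map fst vs) = d"
  then obtain i x j y where vs: "vs = [(i, x), (j, y)]" "x \<in> grd ?C i" "y \<in> grd ?C j"
    by (rule length_2_gens)
  have x: "pure_tensor ?C [(i, x)] \<in> grd (tensor_power ?C 1) i"
    by (rule pure_tensor_mem) (use vs in auto)
  have "comp_pure P (comp_prod P P) (i, x) (j, comp_one P (\<Delta> j y))
      = comp_triple P (tensor_append ?C (pure_tensor ?C [(i, x)]) (\<Delta> j y))"
  proof (rule tensor_power_linear_eq[OF
      linear_between_comp[OF comp_one_between[OF P] linear_comp_pure_right[OF vs(2) PP, simplified]]
      linear_between_comp[OF linear_tensor_append_right[OF g x] linear_comp_triple]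
      _ linear_between_mem[OF \<Delta> vs(3)]])
    fix us assume "length us = 2" "homogeneous ?C us" "sum_list (map fst us) = j"
    \<comment> \<open>The equation \<open>k + l = j\<close> is essential here:
      \<open>comp_triple\<close> labels the inner composite with \<open>k + l\<close>, whereas
      \<open>comp_map\<close> keeps the label \<open>j\<close> of \<open>y\<close>.\<close>
    then obtain k u l v where us: "us = [(k, u), (l, v)]" "u \<in> grd ?C k" "v \<in> grd ?C l" "k + l = j"
      by (rule length_2_gens)
    then show "comp_pure P (comp_prod P P) (i, x) (j, comp_one P (pure_tensor ?C us))
      = comp_triple P (tensor_append ?C (pure_tensor ?C [(i, x)]) (pure_tensor ?C us))"
      using vs by (simp add: comp_one_pure[OF P] tensor_append_pure[OF g] comp_triple_pure[OF P])
  qed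
  then show "comp_map P (comp_prod P P) (\<lambda>_ _ y. y) f (Suc 0) (comp_one P (pure_tensor ?C vs))
    = comp_triple P (tensor2_map ?C (tensor1 ?C) \<Delta> (pure_tensor ?C vs))"
    by (simp add: vs comp_one_pure[OF P] comp_map_pure[OF P P P PP smod_linear_id f(1)] f(2)
        tensor2_map_pure[OF g linear_tensor1 \<Delta>]) (simp add: tensor1_def)
qed

section \<open>Counits\<close>

text \<open>The unit isomorphism \<open>P(1) \<cong> (I \<circ> P)(1)\<close>, with source written
  as a first tensor power. Its explicit left inverse is used to cancel it in the counit law.\<close>

definition unitor_left :: "('k::field, 'a::ab_group_add) smod \<Rightarrow> ('a, 'k) tensor \<Rightarrow> (('k, 'a) cgen, 'k) formal" where
  "unitor_left P T = bind T (\<lambda>xs. comp_pure unit_smod P (0, 1) (xs ! 0))"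

definition unitor_left_inv :: "('k::field, 'a::ab_group_add) smod \<Rightarrow> (('k, 'a) cgen, 'k) formal \<Rightarrow> ('a, 'k) tensor" where
  "unitor_left_inv P S = bind S (\<lambda>((_, c), \<nu>s, _). if length \<nu>s = Suc 0
     then fscale c (pure_tensor (arity P (Suc 0)) [snd (hd \<nu>s)]) else 0)"

definition unitor_right :: "('k::field, 'a::ab_group_add) smod \<Rightarrow> ('a, 'k) tensor \<Rightarrow> (('a, 'k) cgen, 'k) formal" where
  "unitor_right P T = bind T (\<lambda>xs. comp_pure P unit_smod (xs ! 0) (0, 1))"

definition unitor_right_inv :: "('k::field, 'a::ab_group_add) smod \<Rightarrow> (('a, 'k) cgen, 'k) formal \<Rightarrow> ('a, 'k) tensor" where
  "unitor_right_inv P S = bind S (\<lambda>(x, \<nu>s, _). if length \<nu>s = Suc 0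
     then fscale (snd (snd (hd \<nu>s))) (pure_tensor (arity P (Suc 0)) [x]) else 0)"

lemma unit_grd [simp]: "1 \<in> grd (arity unit_smod (Suc 0)) 0"
  by (simp add: unit_smod_arity unit_mod_simps)

lemma unitor_left_pure:
  assumes P: "arity_one P"
  shows "unitor_left P (pure_tensor (arity P (Suc 0)) [(i, x)]) = comp_pure unit_smod P (0, 1) (i, x)"
  unfolding unitor_left_def
  by (subst bind_pure_tensor) (auto intro!: admissible_multilinear_1 linear_comp_pure_right P)

lemma unitor_right_pure:
  assumes P: "arity_one P"
  shows "unitor_right P (pure_tensor (arity P (Suc 0)) [(i, x)]) = comp_pure P unit_smod (i, x) (0, 1)"
  unfolding unitor_right_def
  by (subst bind_pure_tensor) (auto intro!: admissible_multilinear_1 linear_comp_pure_left P)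

lemma linear_on_fscale_left: "linear_on (*) fscale A (\<lambda>c. fscale c T)"
  by (rule linear_betweenI) (auto simp: formal.scale_left_distrib)

lemma unitor_left_inv_pure:
  assumes P: "arity_one P"
  shows "unitor_left_inv P (comp_pure unit_smod P (p, c) y) = fscale c (pure_tensor (arity P (Suc 0)) [y])"
proof -
  have "admissible (cforms unit_smod P (Suc 0)) (\<lambda>((_, c), \<nu>s, _). if length \<nu>s = Suc 0
     then fscale c (pure_tensor (arity P (Suc 0)) [snd (hd \<nu>s)]) else 0)"
    by (rule admissible_cformsI[OF arity_one_unit_smod P])
       (simp_all add: unit_smod_arity unit_mod_simps(1) linear_on_fscale_left linear_on_fscale[OF linear_on_pure_tensor_1])
  then show ?thesis
    unfolding unitor_left_inv_def by (simp add: bind_comp_pure)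
qed

lemma unitor_right_inv_pure:
  assumes P: "arity_one P"
  shows "unitor_right_inv P (comp_pure P unit_smod x (q, c)) = fscale c (pure_tensor (arity P (Suc 0)) [x])"
proof -
  have "admissible (cforms P unit_smod (Suc 0)) (\<lambda>(x, \<nu>s, _). if length \<nu>s = Suc 0
     then fscale (snd (snd (hd \<nu>s))) (pure_tensor (arity P (Suc 0)) [x]) else 0)"
    by (rule admissible_cformsI[OF P arity_one_unit_smod])
       (simp_all add: unit_smod_arity unit_mod_simps(1) linear_on_fscale_left linear_on_fscale[OF linear_on_pure_tensor_1])
  then show ?thesis
    unfolding unitor_right_inv_def by (simp add: bind_comp_pure)
qed

lemma unitor_inv:
  assumes P: "arity_one P" and T: "T \<in> grd (tensor_power (arity P (Suc 0)) (Suc 0)) d"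
  shows "unitor_left_inv P (unitor_left P T) = T" "unitor_right_inv P (unitor_right P T) = T"
proof -
  obtain x where "T = pure_tensor (arity P (Suc 0)) [(d, x)]"
    using T tensor_power_1_grd[OF arity_one_graded[OF P]] by (auto simp: tensor1_def simp del: tensor_power_simps)
  then show "unitor_left_inv P (unitor_left P T) = T" "unitor_right_inv P (unitor_right P T) = T"
    by (simp_all add: unitor_left_pure[OF P] unitor_left_inv_pure[OF P] unitor_right_pure[OF P] unitor_right_inv_pure[OF P])
qed

lemma linear_unitor: "linear_on fscale fscale A (unitor_left P)" "linear_on fscale fscale A (unitor_right P)"
  unfolding unitor_left_def unitor_right_def by (rule linear_bind)+

text \<open>The scalar \<open>\<epsilon> i x\<close> carries the label \<open>i\<close> of its
  argument, while the unit has degree 0. For a nonzero label the scalar is 0 and both sides vanish;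
  otherwise linearity in the first slot applies.\<close>

lemma comp_pure_unit_left:
  assumes P: "arity_one P" and c: "c \<in> grd unit_mod p" and y: "y \<in> grd (arity P (Suc 0)) q"
  shows "comp_pure unit_smod P (p, c) (q, y) = fscale c (comp_pure unit_smod P (0, 1) (q, y))"
proof (cases "p = 0")
  case True
  show ?thesis
    using linear_between_scale[OF linear_comp_pure_left[OF y arity_one_unit_smod, of 0], of 1 c] True
    by (simp add: unit_smod_arity unit_mod_simps)
next
  case False
  with c have "c = 0" by (simp add: unit_mod_simps)
  then show ?thesis
    using linear_between_zero[OF linear_comp_pure_left[OF y arity_one_unit_smod, of p]
        graded_0[OF arity_one_graded[OF arity_one_unit_smod]]] by simp
qed

lemma comp_pure_unit_right:
  assumes P: "arity_one P" and c: "c \<in> grd unit_mod q" and x: "x \<in> grd (arity P (Suc 0)) p"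
  shows "comp_pure P unit_smod (p, x) (q, c) = fscale c (comp_pure P unit_smod (p, x) (0, 1))"
proof (cases "q = 0")
  case True
  show ?thesis
    using linear_between_scale[OF linear_comp_pure_right[OF x arity_one_unit_smod, of 0], of 1 c] True
    by (simp add: unit_smod_arity unit_mod_simps)
next
  case False
  with c have "c = 0" by (simp add: unit_mod_simps)
  then show ?thesis
    using linear_between_zero[OF linear_comp_pure_right[OF x arity_one_unit_smod, of q]
        graded_0[OF arity_one_graded[OF arity_one_unit_smod]]] by simp
qed

lemma counit_transport:
  assumes P: "arity_one P" and \<epsilon>: "\<epsilon> \<in> dg_mor (arity P (Suc 0)) unit_mod"
    and f: "smod_linear P unit_smod f" "f (Suc 0) = \<epsilon>"
    and T: "T \<in> grd (tensor_power (arity P (Suc 0)) 2) d"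
  shows "comp_map unit_smod P f (\<lambda>_ _ y. y) (Suc 0) (comp_one P T) = unitor_left P
      (tensor2_map (arity P (Suc 0)) (\<lambda>i x. tensor0 (arity P (Suc 0)) (\<epsilon> i x)) (tensor1 (arity P (Suc 0))) T)"
    and "comp_map P unit_smod (\<lambda>_ _ y. y) f (Suc 0) (comp_one P T) = unitor_right P
      (tensor2_map (arity P (Suc 0)) (tensor1 (arity P (Suc 0))) (\<lambda>i x. tensor0 (arity P (Suc 0)) (\<epsilon> i x)) T)"
proof -
  let ?C = "arity P (Suc 0)"
  note U = arity_one_unit_smod and g = arity_one_graded[OF P]
  note \<epsilon>_mem = linear_between_mem[OF dg_mor_linear[OF \<epsilon>]]
  have t0: "linear_between (scl ?C) fscale (grd ?C i) (grd (tensor_power ?C 0) i) (\<lambda>x. tensor0 ?C (\<epsilon> i x))" for i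
    by (rule linear_tensor0) (use dg_mor_linear[OF \<epsilon>] in \<open>simp add: unit_mod_simps\<close>)
  show "comp_map unit_smod P f (\<lambda>_ _ y. y) (Suc 0) (comp_one P T)
      = unitor_left P (tensor2_map ?C (\<lambda>i x. tensor0 ?C (\<epsilon> i x)) (tensor1 ?C) T)"
  proof (rule tensor_power_linear_eq[OF linear_between_comp[OF linear_comp_one linear_comp_map]
        linear_between_comp[OF linear_tensor2_map linear_unitor(1)] _ T])
    fix vs assume "length vs = 2" "homogeneous ?C vs" "sum_list (map fst vs) = d"
    then obtain i x j y where vs: "vs = [(i, x), (j, y)]" "x \<in> grd ?C i" "y \<in> grd ?C j"
      by (rule length_2_gens)
    show "comp_map unit_smod P f (\<lambda>_ _ y. y) (Suc 0) (comp_one P (pure_tensor ?C vs))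
      = unitor_left P (tensor2_map ?C (\<lambda>i x. tensor0 ?C (\<epsilon> i x)) (tensor1 ?C) (pure_tensor ?C vs))"
      by (simp add: vs comp_one_pure[OF P] comp_map_pure[OF P P U P f(1) smod_linear_id] f(2)
          tensor2_map_pure[OF g t0 linear_tensor1] comp_pure_unit_left[OF P \<epsilon>_mem[OF vs(2)] vs(3)])
         (simp add: tensor1_def tensor0_append[OF g] vs linear_between_scale[OF linear_unitor(1), of _ UNIV]
            unitor_left_pure[OF P])
  qed
  show "comp_map P unit_smod (\<lambda>_ _ y. y) f (Suc 0) (comp_one P T)
      = unitor_right P (tensor2_map ?C (tensor1 ?C) (\<lambda>i x. tensor0 ?C (\<epsilon> i x)) T)"
  proof (rule tensor_power_linear_eq[OF linear_between_comp[OF linear_comp_one linear_comp_map]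
        linear_between_comp[OF linear_tensor2_map linear_unitor(2)] _ T])
    fix vs assume "length vs = 2" "homogeneous ?C vs" "sum_list (map fst vs) = d"
    then obtain i x j y where vs: "vs = [(i, x), (j, y)]" "x \<in> grd ?C i" "y \<in> grd ?C j"
      by (rule length_2_gens)
    show "comp_map P unit_smod (\<lambda>_ _ y. y) f (Suc 0) (comp_one P (pure_tensor ?C vs))
      = unitor_right P (tensor2_map ?C (tensor1 ?C) (\<lambda>i x. tensor0 ?C (\<epsilon> i x)) (pure_tensor ?C vs))"
      by (simp add: vs comp_one_pure[OF P] comp_map_pure[OF P P P U smod_linear_id f(1)] f(2)
          tensor2_map_pure[OF g linear_tensor1 t0] comp_pure_unit_right[OF P \<epsilon>_mem[OF vs(3)] vs(2)])
         (simp add: tensor1_def tensor0_append[OF g] vs linear_between_scale[OF linear_unitor(2), of _ UNIV]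
            unitor_right_pure[OF P])
  qed
qed

section \<open>Equivalence of the laws\<close>

lemma dg_cooperad_iff:
  assumes P: "concentrated_in_arity_one P"
    and \<Delta>: "\<Delta> \<in> dg_mor (arity P (Suc 0)) (tensor_power (arity P (Suc 0)) 2)"
    and \<epsilon>: "\<epsilon> \<in> dg_mor (arity P (Suc 0)) unit_mod"
  shows "dg_cooperad P (cooperad_comult P \<Delta>) (cooperad_counit \<epsilon>) \<longleftrightarrow> dg_coalgebra (arity P (Suc 0)) \<Delta> \<epsilon>"
proof -
  let ?C = "arity P (Suc 0)" and ?\<Delta> = "cooperad_comult P \<Delta>" and ?\<epsilon> = "cooperad_counit \<epsilon>"
  note aP = concentrated_arity_one[OF P]
  note g = arity_one_graded[OF aP] and dP = concentrated_dg_module[OF P]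
  have \<Delta>_mor: "?\<Delta> \<in> smod_mor P (comp_prod P P)"
    using bij_cooperad_comult[OF P] \<Delta> by (auto simp: bij_betw_def)
  have \<epsilon>_mor: "?\<epsilon> \<in> smod_mor P unit_smod"
    using bij_cooperad_counit[OF P] \<epsilon> by (auto simp: bij_betw_def)
  have \<Delta>1: "?\<Delta> (Suc 0) i x = comp_one P (\<Delta> i x)" for i x
    by (simp add: cooperad_comult_def)
  have \<epsilon>1: "?\<epsilon> (Suc 0) = \<epsilon>"
    by (simp add: cooperad_counit_def)
  have lin: "linear_between (scl ?C) fscale (grd ?C i) (grd (tensor_power ?C 2) i) (\<Delta> i)" for i
    using dg_mor_linear[OF \<Delta>] by simp
  have t0: "linear_between (scl ?C) fscale (grd ?C i) (grd (tensor_power ?C 0) i) (\<lambda>x. tensor0 ?C (\<epsilon> i x))" for i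
    by (rule linear_tensor0) (use dg_mor_linear[OF \<epsilon>] in \<open>simp add: unit_mod_simps\<close>)
  define laws where "laws n i x \<longleftrightarrow>
        comp_assoc P P P n (comp_map (comp_prod P P) P ?\<Delta> (\<lambda>_ _ y. y) n (?\<Delta> n i x))
          = comp_map P (comp_prod P P) (\<lambda>_ _ y. y) ?\<Delta> n (?\<Delta> n i x) \<and>
        comp_map unit_smod P ?\<epsilon> (\<lambda>_ _ y. y) n (?\<Delta> n i x)
          = ev (cforms unit_smod P n) ((0, 1), [(n, i, x)], id) \<and>
        comp_map P unit_smod (\<lambda>_ _ y. y) ?\<epsilon> n (?\<Delta> n i x)
          = ev (cforms P unit_smod n) ((i, x), replicate n (1, 0, 1), id)" for n i x
  \<comment> \<open>The transported comultiplication is 0 away from arity one, so the laws hold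
    there as soon as the right-hand sides of the counit laws are 0. These are evaluations at
    generators of arity \<open>n\<close>, which vanish.\<close>
  have other: "laws n i x" if n: "n \<noteq> Suc 0" and x: "x \<in> grd (arity P n) i" for n i x
  proof -
    have 0: "x = 0" using x arity_one_grd[OF aP n] by simp
    have "is_cgen unit_smod P n i ((0, 1), [(n, i, x)], id)"
      using x by (simp add: is_cgen_iff permutes_id)
    note 1 = ev_cforms_vanish[OF arity_one_unit_smod aP this disjI2[OF n]]
    have "is_cgen P unit_smod n i ((i, x), replicate n (1, 0, 1), id)"
      using x by (simp add: is_cgen_iff permutes_id sum_list_replicate)
    note 2 = ev_cforms_vanish[OF aP arity_one_unit_smod this disjI2[OF n]]
    show ?thesis
      unfolding laws_def 1 2 using n
      by (simp add: cooperad_comult_def comp_map_def comp_assoc_def)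
  qed
  have one: "laws (Suc 0) i x \<longleftrightarrow>
      tensor2_map ?C \<Delta> (tensor1 ?C) (\<Delta> i x) = tensor2_map ?C (tensor1 ?C) \<Delta> (\<Delta> i x) \<and>
      tensor2_map ?C (\<lambda>i x. tensor0 ?C (\<epsilon> i x)) (tensor1 ?C) (\<Delta> i x) = tensor1 ?C i x \<and>
      tensor2_map ?C (tensor1 ?C) (\<lambda>i x. tensor0 ?C (\<epsilon> i x)) (\<Delta> i x) = tensor1 ?C i x"
    (is "_ \<longleftrightarrow> ?a = ?b \<and> ?c = ?t \<and> ?d = ?t")
    if x: "x \<in> grd ?C i" for i x
  proof -
    note T = linear_between_mem[OF lin x]
    note sl = smod_mor_linear[OF \<Delta>_mor] smod_mor_linear[OF \<epsilon>_mor]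
    have "?a \<in> grd (tensor_power ?C 3) i" "?b \<in> grd (tensor_power ?C 3) i"
      using tensor2_map_mem[OF g lin linear_tensor1 T] tensor2_map_mem[OF g linear_tensor1 lin T]
      by (simp_all add: numeral_3_eq_3 numeral_2_eq_2 del: tensor_power_simps)
    \<comment> \<open>Both tensors lie in one graded piece of the tensor cube, where the left
      inverse cancels \<open>comp_triple\<close>.\<close>
    then have 1: "comp_triple P ?a = comp_triple P ?b \<longleftrightarrow> ?a = ?b"
      using comp_triple_inv_comp_triple[OF aP] by metis
    have mem: "?c \<in> grd (tensor_power ?C (Suc 0)) i" "?d \<in> grd (tensor_power ?C (Suc 0)) i"
        "?t \<in> grd (tensor_power ?C (Suc 0)) i"
      using tensor2_map_mem[OF g t0 linear_tensor1 T] tensor2_map_mem[OF g linear_tensor1 t0 T]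
        linear_between_mem[OF linear_tensor1 x]
      by (simp_all del: tensor_power_simps)
    then have 2: "unitor_left P ?c = unitor_left P ?t \<longleftrightarrow> ?c = ?t" "unitor_right P ?d = unitor_right P ?t \<longleftrightarrow> ?d = ?t"
      using unitor_inv[OF aP] by metis+
    have 3: "unitor_left P ?t = ev (cforms unit_smod P (Suc 0)) ((0, 1), [(Suc 0, i, x)], id)"
      "unitor_right P ?t = ev (cforms P unit_smod (Suc 0)) ((i, x), replicate (Suc 0) (1, 0, 1), id)"
      unfolding tensor1_def unitor_left_pure[OF aP] unitor_right_pure[OF aP] by (simp_all add: comp_pure_def)
    show ?thesis
      unfolding laws_def \<Delta>1 coassoc_left[OF aP lin sl(1) \<Delta>1 T] coassoc_right[OF aP lin sl(1) \<Delta>1 T]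
        counit_transport[OF aP \<epsilon> sl(2) \<epsilon>1 T] 3[symmetric] 1 2 ..
  qed
  have "(\<forall>n i. \<forall>x\<in>grd (arity P n) i. laws n i x) \<longleftrightarrow> (\<forall>i. \<forall>x\<in>grd ?C i. laws (Suc 0) i x)"
    using other by metis
  then show ?thesis
    unfolding dg_cooperad_def dg_coalgebra_def laws_def[symmetric]
    using P \<Delta> \<epsilon> \<Delta>_mor \<epsilon>_mor dP one by (simp add: concentrated_in_arity_one_def)
qed

text \<open>Transport is already bijective on structure maps that satisfy no laws, and the laws
  correspond. The bijection therefore restricts; a cooperad structure has its preimage among the
  lawless pairs, which then satisfies the coalgebra laws.\<close>

lemma bij_dg_cooperad:
  assumes P: "concentrated_in_arity_one P"
  shows "bij_betw (\<lambda>(\<Delta>, \<epsilon>). (cooperad_comult P \<Delta>, cooperad_counit \<epsilon>))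
          {(\<Delta>, \<epsilon>). dg_coalgebra (arity P (Suc 0)) \<Delta> \<epsilon>}
          {(\<Delta>, \<epsilon>). dg_cooperad P \<Delta> \<epsilon>}"
proof -
  let ?C = "arity P (Suc 0)" and ?F = "\<lambda>(\<Delta>, \<epsilon>). (cooperad_comult P \<Delta>, cooperad_counit \<epsilon>)"
  let ?A = "dg_mor ?C (tensor_power ?C 2) \<times> dg_mor ?C unit_mod"
  have "bij_betw ?F ?A (smod_mor P (comp_prod P P) \<times> smod_mor P unit_smod)"
    using bij_betw_map_prod[OF bij_cooperad_comult[OF P] bij_cooperad_counit[OF P]]
    by (simp add: map_prod_def)
  then have F: "inj_on ?F ?A" "?F ` ?A = smod_mor P (comp_prod P P) \<times> smod_mor P unit_smod"
    by (auto simp: bij_betw_def)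
  have sub: "{(\<Delta>, \<epsilon>). dg_coalgebra ?C \<Delta> \<epsilon>} \<subseteq> ?A" by (auto simp: dg_coalgebra_def)
  have "?F ` {(\<Delta>, \<epsilon>). dg_coalgebra ?C \<Delta> \<epsilon>} = {(\<Delta>, \<epsilon>). dg_cooperad P \<Delta> \<epsilon>}"
  proof
    show "?F ` {(\<Delta>, \<epsilon>). dg_coalgebra ?C \<Delta> \<epsilon>} \<subseteq> {(\<Delta>, \<epsilon>). dg_cooperad P \<Delta> \<epsilon>}"
      using dg_cooperad_iff[OF P] sub by auto
  next
    have "(\<Delta>', \<epsilon>') \<in> ?F ` {(\<Delta>, \<epsilon>). dg_coalgebra ?C \<Delta> \<epsilon>}" if c: "dg_cooperad P \<Delta>' \<epsilon>'" for \<Delta>' \<epsilon>'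
    proof -
      from c have "(\<Delta>', \<epsilon>') \<in> ?F ` ?A" unfolding F(2) by (simp add: dg_cooperad_def)
      then obtain \<Delta> \<epsilon> where "\<Delta> \<in> dg_mor ?C (tensor_power ?C 2)" "\<epsilon> \<in> dg_mor ?C unit_mod"
        "\<Delta>' = cooperad_comult P \<Delta>" "\<epsilon>' = cooperad_counit \<epsilon>" by auto
      with c dg_cooperad_iff[OF P] show ?thesis by auto
    qed
    then show "{(\<Delta>, \<epsilon>). dg_cooperad P \<Delta> \<epsilon>} \<subseteq> ?F ` {(\<Delta>, \<epsilon>). dg_coalgebra ?C \<Delta> \<epsilon>}" by auto
  qed
  with inj_on_subset[OF F(1) sub] show ?thesis unfolding bij_betw_def by blast
qed

section \<open>Morphisms of coalgebras and cooperads\<close>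

text \<open>Naturality of the isomorphism
  \<open>P(1) \<otimes> P(1) \<cong> (P \<circ> P)(1)\<close> in \<open>P\<close>; this turns
  compatibility with comultiplications on one side into that on the other.\<close>

lemma comp_map_comp_one:
  assumes P: "arity_one P" and Q: "arity_one Q" and f: "smod_linear P Q f"
    and T: "T \<in> grd (tensor_power (arity P (Suc 0)) 2) d"
  shows "comp_map Q Q f f (Suc 0) (comp_one P T) = comp_one Q (tensor_map (arity Q (Suc 0)) (f (Suc 0)) T)"
proof (rule tensor_power_linear_eq[OF linear_between_comp[OF linear_comp_one linear_comp_map]
        linear_between_comp[OF linear_tensor_map linear_comp_one] _ T])
  fix vs assume "length vs = 2" "homogeneous (arity P (Suc 0)) vs" "sum_list (map fst vs) = d"
  then obtain i x j y where vs: "vs = [(i, x), (j, y)]"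
    by (rule length_2_gens)
  have "linear_between (scl (arity P (Suc 0))) (scl (arity Q (Suc 0))) (grd (arity P (Suc 0)) i)
      (grd (arity Q (Suc 0)) i) (f (Suc 0) i)" for i
    using f by (simp add: smod_linear_def)
  note map = tensor_map_pure[OF this]
  show "comp_map Q Q f f (Suc 0) (comp_one P (pure_tensor (arity P (Suc 0)) vs))
      = comp_one Q (tensor_map (arity Q (Suc 0)) (f (Suc 0)) (pure_tensor (arity P (Suc 0)) vs))"
    by (simp add: vs comp_one_pure[OF P] comp_map_pure[OF P P Q Q f f] map comp_one_pure[OF Q])
qed

lemma tensor_map_mem:
  assumes f: "\<And>i. linear_between (scl V) (scl W) (grd V i) (grd W i) (f i)"
    and T: "T \<in> grd (tensor_power V n) d"
  shows "tensor_map W f T \<in> grd (tensor_power W n) d"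
proof (rule linear_between_mem[OF tensor_power_linear_between
      [OF linear_tensor_map _ vector_space_fscale subspace_tensor_power] T])
  fix vs assume vs: "length vs = n" "homogeneous V vs" "sum_list (map fst vs) = d"
  have "sum_list (map fst (map (\<lambda>(i, v). (i, f i v)) vs)) = d"
    using vs(3) by (simp add: case_prod_beta comp_def)
  moreover have "homogeneous W (map (\<lambda>(i, v). (i, f i v)) vs)"
    using vs(2) linear_between_mem[OF f] by (fastforce simp: homogeneous_def)
  ultimately show "tensor_map W f (pure_tensor V vs) \<in> grd (tensor_power W n) d"
    using vs(1) unfolding tensor_map_pure[OF f] by (intro pure_tensor_mem) (simp_all only: length_map)
qed

lemma cooperad_mor_iff:
  assumes P: "concentrated_in_arity_one P" and Q: "concentrated_in_arity_one Q"
    and c: "dg_coalgebra (arity P (Suc 0)) \<Delta> \<epsilon>" and c': "dg_coalgebra (arity Q (Suc 0)) \<Delta>' \<epsilon>'"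
    and f: "f \<in> smod_mor P Q"
  shows "f \<in> cooperad_mor P (cooperad_comult P \<Delta>) (cooperad_counit \<epsilon>) Q (cooperad_comult Q \<Delta>') (cooperad_counit \<epsilon>')
    \<longleftrightarrow> f (Suc 0) \<in> coalgebra_mor (arity P (Suc 0)) \<Delta> \<epsilon> (arity Q (Suc 0)) \<Delta>' \<epsilon>'"
proof -
  let ?C = "arity P (Suc 0)" and ?D = "arity Q (Suc 0)"
  note aP = concentrated_arity_one[OF P] and aQ = concentrated_arity_one[OF Q]
  note fl = smod_mor_linear[OF f]
  have f1: "f (Suc 0) \<in> dg_mor ?C ?D" using f by (simp add: smod_mor_def)
  have \<Delta>: "\<Delta> \<in> dg_mor ?C (tensor_power ?C 2)" and \<Delta>': "\<Delta>' \<in> dg_mor ?D (tensor_power ?D 2)"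
    using c c' by (auto simp: dg_coalgebra_def)
  define laws where "laws n i x \<longleftrightarrow>
     comp_map Q Q f f n (cooperad_comult P \<Delta> n i x) = cooperad_comult Q \<Delta>' n i (f n i x) \<and>
     cooperad_counit \<epsilon>' n i (f n i x) = cooperad_counit \<epsilon> n i x" for n i x
  have other: "laws n i x" if "n \<noteq> Suc 0" for n i x
    using that by (simp add: laws_def cooperad_comult_def cooperad_counit_def comp_map_def)
  have one: "laws (Suc 0) i x \<longleftrightarrow> tensor_map ?D (f (Suc 0)) (\<Delta> i x) = \<Delta>' i (f (Suc 0) i x)
      \<and> \<epsilon>' i (f (Suc 0) i x) = \<epsilon> i x" if x: "x \<in> grd ?C i" for i x
  proof -
    have T: "\<Delta> i x \<in> grd (tensor_power ?C 2) i" by (rule linear_between_mem[OF dg_mor_linear[OF \<Delta>] x])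
    have "tensor_map ?D (f (Suc 0)) (\<Delta> i x) \<in> grd (tensor_power ?D 2) i"
      by (rule tensor_map_mem[OF dg_mor_linear[OF f1] T])
    moreover have "\<Delta>' i (f (Suc 0) i x) \<in> grd (tensor_power ?D 2) i"
      by (rule linear_between_mem[OF dg_mor_linear[OF \<Delta>'] linear_between_mem[OF dg_mor_linear[OF f1] x]])
    \<comment> \<open>\<open>comp_one Q\<close> may be cancelled because both arguments are in the
      degree \<open>i\<close> part of the tensor square.\<close>
    ultimately have "comp_one Q (tensor_map ?D (f (Suc 0)) (\<Delta> i x)) = comp_one Q (\<Delta>' i (f (Suc 0) i x))
       \<longleftrightarrow> tensor_map ?D (f (Suc 0)) (\<Delta> i x) = \<Delta>' i (f (Suc 0) i x)"
      using comp_one_inv_comp_one[OF aQ] by metis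
    then show ?thesis
      by (simp add: laws_def cooperad_comult_def cooperad_counit_def comp_map_comp_one[OF aP aQ fl T])
  qed
  have "(\<forall>n i. \<forall>x\<in>grd (arity P n) i. laws n i x) \<longleftrightarrow> (\<forall>i. \<forall>x\<in>grd ?C i. laws (Suc 0) i x)"
    using other by metis
  then show ?thesis
    unfolding cooperad_mor_def coalgebra_mor_def mem_Collect_eq laws_def[symmetric]
    using f f1 one by simp
qed

lemma bij_cooperad_mor:
  assumes P: "concentrated_in_arity_one P" and Q: "concentrated_in_arity_one Q"
    and c: "dg_coalgebra (arity P (Suc 0)) \<Delta> \<epsilon>" and c': "dg_coalgebra (arity Q (Suc 0)) \<Delta>' \<epsilon>'"
  shows "bij_betw (\<lambda>f. f (Suc 0))
     (cooperad_mor P (cooperad_comult P \<Delta>) (cooperad_counit \<epsilon>) Q (cooperad_comult Q \<Delta>') (cooperad_counit \<epsilon>'))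
     (coalgebra_mor (arity P (Suc 0)) \<Delta> \<epsilon> (arity Q (Suc 0)) \<Delta>' \<epsilon>')" (is "bij_betw ?F ?A ?B")
proof -
  have bij: "bij_betw ?F (smod_mor P Q) (dg_mor (arity P (Suc 0)) (arity Q (Suc 0)))"
    by (rule bij_smod_mor(1)[OF concentrated_arity_one[OF P] concentrated_arity_one[OF Q] concentrated_dif_0[OF Q]])
  have sub: "?A \<subseteq> smod_mor P Q" by (auto simp: cooperad_mor_def)
  have "?B \<subseteq> dg_mor (arity P (Suc 0)) (arity Q (Suc 0))" by (auto simp: coalgebra_mor_def)
  then have "?B \<subseteq> ?F ` smod_mor P Q" by (simp add: bij_betw_imp_surj_on[OF bij])
  then have "?F ` ?A = ?B"
    using cooperad_mor_iff[OF P Q c c'] sub by blast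
  then show ?thesis using inj_on_subset[OF bij_betw_imp_inj_on[OF bij] sub] by (auto simp: bij_betw_def)
qed

lemma concentrated_in_arity_one_in_arity_one:
  assumes V: "dg_module V"
  shows "concentrated_in_arity_one (in_arity_one V)"
proof -
  interpret vector_space "scl V" using V by (simp add: dg_module_def)
  have "dg_module (V\<lparr>grd := \<lambda>_. {0}, dif := \<lambda>_ _. 0\<rparr>)"
    using vector_space_axioms
    by (auto simp: dg_module_def linear_between_def subspace_def)
  then show ?thesis
    using V unfolding concentrated_in_arity_one_def dg_smodule_def
    by (auto simp: in_arity_one_def linear_between_id)
qed


section \<open>The dual Schur functor in arity one\<close>

lemma hom_deg_linear:
    "h \<in> hom_deg V W p \<Longrightarrow> linear_between (scl V) (scl W) (grd V i) (grd W (i + p)) (h i)"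
  and hom_deg_outside: "h \<in> hom_deg V W p \<Longrightarrow> x \<notin> grd V i \<Longrightarrow> h i x = 0"
  by (auto simp: hom_deg_def)

text \<open>Outside of its domain \<open>h\<close> is 0, which belongs to every degree; hence the
  conclusion for all \<open>x\<close>.\<close>

lemma hom_deg_mem: "graded W \<Longrightarrow> h \<in> hom_deg V W p \<Longrightarrow> h i x \<in> grd W (i + p)"
  by (cases "x \<in> grd V i")
     (auto simp: hom_deg_outside graded_0 intro: linear_between_mem[OF hom_deg_linear])

lemma hom_degI:
  assumes "\<And>i. linear_between (scl V) (scl W) (grd V i) (grd W (i + p)) (h i)"
    and "\<And>i x. x \<notin> grd V i \<Longrightarrow> h i x = 0"
  shows "h \<in> hom_deg V W p"
  using assms by (auto simp: hom_deg_def)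

lemma hom_deg_comp:
  assumes h: "h \<in> hom_deg V W p"
    and f: "\<And>i. linear_between (scl W) (scl U) (grd W (i + p)) (grd U (i + q)) (f i)" and W: "graded W"
  shows "(\<lambda>i x. f i (h i x)) \<in> hom_deg V U q"
  by (rule hom_degI)
     (auto simp: hom_deg_outside[OF h] intro: linear_between_comp[OF hom_deg_linear[OF h] f]
        linear_between_zero[OF f graded_0[OF W]])

lemma hom_deg_closed:
  assumes W: "graded W" and V: "graded V"
  shows "0 \<in> hom_deg V W p"
    and "h \<in> hom_deg V W p \<Longrightarrow> h' \<in> hom_deg V W p \<Longrightarrow> h + h' \<in> hom_deg V W p"
    and "h \<in> hom_deg V W p \<Longrightarrow> (\<lambda>i x. scl W c (h i x)) \<in> hom_deg V W p"
proof -
  interpret W: vector_space "scl W" using W by (simp add: graded_def)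
  show "0 \<in> hom_deg V W p"
    by (rule hom_degI) (auto intro!: linear_betweenI simp: graded_0[OF W])
  show "h + h' \<in> hom_deg V W p" if "h \<in> hom_deg V W p" "h' \<in> hom_deg V W p"
  proof (rule hom_degI)
    fix i
    show "linear_between (scl V) (scl W) (grd V i) (grd W (i + p)) ((h + h') i)"
      using linear_between_add[OF hom_deg_linear[OF that(1)]] linear_between_add[OF hom_deg_linear[OF that(2)]]
        linear_between_scale[OF hom_deg_linear[OF that(1)]] linear_between_scale[OF hom_deg_linear[OF that(2)]]
      by (intro linear_betweenI)
         (simp_all add: graded_add[OF W] hom_deg_mem[OF W that(1)] hom_deg_mem[OF W that(2)] W.scale_right_distrib)
  qed (simp add: hom_deg_outside[OF that(1)] hom_deg_outside[OF that(2)])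
  show "(\<lambda>i x. scl W c (h i x)) \<in> hom_deg V W p" if "h \<in> hom_deg V W p"
  proof (rule hom_degI)
    fix i
    show "linear_between (scl V) (scl W) (grd V i) (grd W (i + p)) (\<lambda>x. scl W c (h i x))"
      using linear_between_add[OF hom_deg_linear[OF that]] linear_between_scale[OF hom_deg_linear[OF that]]
      by (intro linear_betweenI)
         (simp_all add: graded_scale[OF W] hom_deg_mem[OF W that] W.scale_right_distrib mult.commute)
  qed (simp add: hom_deg_outside[OF that])
qed

lemma hom_mod_simps [simp]:
  "scl (hom_mod V W) = (\<lambda>c f i x. scl W c (f i x))" "grd (hom_mod V W) = hom_deg V W"
  "dif (hom_mod V W) = hom_dif V W"
  by (simp_all add: hom_mod_def)

lemma graded_diff: "graded V \<Longrightarrow> x \<in> grd V i \<Longrightarrow> y \<in> grd V i \<Longrightarrow> x - y \<in> grd V i"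
  using module.subspace_diff[of "scl V"] by (auto simp: graded_def vector_space_def module_def)

lemma linear_between_diff:
  fixes f :: "'a::ab_group_add \<Rightarrow> 'b::ab_group_add"
  assumes "graded V" "linear_between (scl V) t (grd V i) B f" "x \<in> grd V i" "y \<in> grd V i"
  shows "f (x - y) = f x - f y"
  using linear_between_add[OF assms(2) graded_diff[OF assms(1,3,4)] assms(4)] by simp

lemma hom_dif_mem:
  assumes V: "dg_module V" and W: "dg_module W" and h: "h \<in> hom_deg V W p"
  shows "hom_dif V W p h \<in> hom_deg V W (p - 1)"
proof -
  note gV = dg_module_graded[OF V] and gW = dg_module_graded[OF W]
  interpret W: vector_space "scl W" using gW by (simp add: graded_def)
  have 1: "linear_between (scl V) (scl W) (grd V i) (grd W (i + p - 1)) (\<lambda>x. dif W (i + p) (h i x))" for i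
    by (rule linear_between_comp[OF hom_deg_linear[OF h] dg_module_dif[OF W]])
  have 2: "linear_between (scl V) (scl W) (grd V i) (grd W (i + p - 1)) (\<lambda>x. h (i - 1) (dif V i x))" for i
    using linear_between_comp[OF dg_module_dif[OF V] hom_deg_linear[OF h]] by (simp add: algebra_simps)
  show ?thesis
  proof (rule hom_degI)
    fix i
    have "linear_between (scl V) (scl W) (grd V i) (grd W (i + p - 1))
       (\<lambda>x. dif W (i + p) (h i x) - scl W ((-1) powi p) (h (i - 1) (dif V i x)))"
    proof (rule linear_betweenI)
      fix x assume "x \<in> grd V i"
      then show "dif W (i + p) (h i x) - scl W ((-1) powi p) (h (i - 1) (dif V i x)) \<in> grd W (i + p - 1)"
        using linear_between_mem[OF 1] linear_between_mem[OF 2]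
        by (intro graded_diff[OF gW] graded_scale[OF gW])
    qed (simp_all add: linear_between_add[OF 1] linear_between_add[OF 2] linear_between_scale[OF 1]
           linear_between_scale[OF 2] W.scale_right_distrib W.scale_right_diff_distrib mult.commute)
    from graded_linear_cong[OF this gV]
    show "linear_between (scl V) (scl W) (grd V i) (grd W (i + (p - 1))) (hom_dif V W p h i)"
      by (simp add: hom_dif_def algebra_simps)
  qed (simp add: hom_dif_def)
qed

section \<open>The dual Schur functor as a Hom module\<close>

lemma dual_schur_simps [simp]:
  "scl (dual_schur P V) = (\<lambda>c f n i x. fscale c (f n i x))"
  "dif (dual_schur P V) = (\<lambda>p f n. hom_dif (arity P n) (tensor_power V n) p (f n))"
  by (simp_all add: dual_schur_def)

lemma dual_schur_grd:
  "f \<in> grd (dual_schur P V) p \<longleftrightarrow> (\<forall>n. f n \<in> hom_deg (arity P n) (tensor_power V n) p \<and>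
     (\<forall>\<sigma> i. \<forall>x\<in>grd (arity P n) i. \<sigma> permutes {..<n} \<longrightarrow>
        f n i (act P n \<sigma> i x) = tensor_perm V \<sigma> (f n i x)))"
  by (simp add: dual_schur_def)

text \<open>The twice iterated dual Schur functor takes this graded object as its argument. Closure
  under the operations is that of Hom modules, together with linearity of
  \<open>tensor_perm\<close>, which is a \<open>bind\<close>.\<close>

lemma graded_dual_schur:
  assumes P: "arity_one P"
  shows "graded (dual_schur P V)"
proof -
  have vs: "vector_space (scl (dual_schur P V))"
    by unfold_locales (auto simp: fun_eq_iff fscale_apply algebra_simps)
  interpret vector_space "scl (dual_schur P V)" by (rule vs)
  have "subspace (grd (dual_schur P V) p)" for p
    unfolding subspace_def
  proof (intro conjI ballI allI)
    note closed = hom_deg_closed[OF graded_tensor_power[of V] arity_one_graded[OF P]]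
    show "0 \<in> grd (dual_schur P V) p"
      using closed(1) by (simp add: dual_schur_grd tensor_perm_def)
    show "f + g \<in> grd (dual_schur P V) p" if "f \<in> grd (dual_schur P V) p" "g \<in> grd (dual_schur P V) p" for f g
      using that closed(2) by (simp add: dual_schur_grd tensor_perm_def)
    show "scl (dual_schur P V) c f \<in> grd (dual_schur P V) p" if "f \<in> grd (dual_schur P V) p" for c f
      using that closed(3) by (simp add: dual_schur_grd tensor_perm_def)
  qed
  then show ?thesis using vs by (simp add: graded_def)
qed

lemma linear_dual_schur_one:
  assumes P: "arity_one P" and V: "graded V"
  shows "linear_between (scl (hom_mod (arity P (Suc 0)) V)) (scl (dual_schur P V))
    (hom_deg (arity P (Suc 0)) V p) (grd (dual_schur P V) p) (dual_schur_one V p)"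
proof (rule linear_betweenI)
  let ?C = "arity P (Suc 0)"
  fix h assume h: "h \<in> hom_deg ?C V p"
  show "dual_schur_one V p h \<in> grd (dual_schur P V) p"
    unfolding dual_schur_grd
  proof (intro allI conjI ballI impI)
    fix n
    show "dual_schur_one V p h n \<in> hom_deg (arity P n) (tensor_power V n) p"
    proof (cases "n = Suc 0")
      case True
      have "(\<lambda>i x. tensor1 V (i + p) (h i x)) \<in> hom_deg ?C (tensor_power V (Suc 0)) p"
        by (rule hom_deg_comp[OF h _ V]) (use linear_tensor1 in simp)
      with True show ?thesis by (simp add: dual_schur_one_def)
    next
      case False
      have "(\<lambda>_ _. 0) \<in> hom_deg (arity P n) (tensor_power V n) p"
        using hom_deg_closed(1)[OF graded_tensor_power arity_one_graded[OF P]] by (simp add: zero_fun_def)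
      with False show ?thesis by (simp add: dual_schur_one_def)
    qed
  next
    fix n \<sigma> i x assume x: "x \<in> grd (arity P n) i" and \<sigma>: "\<sigma> permutes {..<n}"
    show "dual_schur_one V p h n i (act P n \<sigma> i x) = tensor_perm V \<sigma> (dual_schur_one V p h n i x)"
    proof (cases "n = Suc 0")
      case True
      have "tensor_perm V id (tensor1 V (i + p) (h i x)) = tensor1 V (i + p) (h i x)"
        by (rule tensor_perm_id[OF linear_between_mem[OF linear_tensor1 hom_deg_mem[OF V h]]])
      then show ?thesis using x \<sigma> by (simp add: True dual_schur_one_def arity_one_act_id[OF P])
    qed (simp add: dual_schur_one_def tensor_perm_def)
  qed
next
  fix h h' assume "h \<in> hom_deg (arity P (Suc 0)) V p" "h' \<in> hom_deg (arity P (Suc 0)) V p"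
  then show "dual_schur_one V p (h + h') = dual_schur_one V p h + dual_schur_one V p h'"
    by (auto simp: dual_schur_one_def fun_eq_iff linear_between_add[OF linear_tensor1 hom_deg_mem[OF V] hom_deg_mem[OF V]])
next
  fix c h assume "h \<in> hom_deg (arity P (Suc 0)) V p"
  then show "dual_schur_one V p (scl (hom_mod (arity P (Suc 0)) V) c h) = scl (dual_schur P V) c (dual_schur_one V p h)"
    by (auto simp: dual_schur_one_def fun_eq_iff linear_between_scale[OF linear_tensor1 hom_deg_mem[OF V]])
qed

lemma dual_schur_one_inj:
  assumes V: "graded V"
  shows "inj_on (dual_schur_one V p) (hom_deg C V p)"
proof (rule inj_onI, intro ext)
  fix h h' i x assume h: "h \<in> hom_deg C V p" "h' \<in> hom_deg C V p" and eq: "dual_schur_one V p h = dual_schur_one V p h'"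
  have "tensor1 V (i + p) (h i x) = tensor1 V (i + p) (h' i x)"
    using fun_cong[OF fun_cong[OF fun_cong[OF eq, of "Suc 0"], of i], of x] by (simp add: dual_schur_one_def)
  then show "h i x = h' i x"
    using inj_onD[OF tensor1_inj[OF V]] hom_deg_mem[OF V] h by blast
qed

text \<open>The component \<open>f (Suc 0)\<close> has values in a first tensor power, which
  \<open>tensor1\<close> identifies with \<open>V\<close>; all other components vanish on a zero
  domain.\<close>

lemma dual_schur_one_surj:
  assumes P: "arity_one P" and V: "graded V" and f: "f \<in> grd (dual_schur P V) p"
  obtains h where "h \<in> hom_deg (arity P (Suc 0)) V p" "f = dual_schur_one V p h"
proof -
  let ?C = "arity P (Suc 0)"
  have fn: "f n \<in> hom_deg (arity P n) (tensor_power V n) p" for n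
    using f by (simp add: dual_schur_grd)
  note f1 = fn[of "Suc 0"]
  define h where "h i x = inv_into (grd V (i + p)) (tensor1 V (i + p)) (f (Suc 0) i x)" for i x
  have mem: "f (Suc 0) i x \<in> tensor1 V (i + p) ` grd V (i + p)" for i x
    using hom_deg_mem[OF graded_tensor_power f1] tensor_power_1_grd[OF V] by blast
  have h: "tensor1 V (i + p) (h i x) = f (Suc 0) i x" "h i x \<in> grd V (i + p)" for i x
    unfolding h_def using mem by (rule f_inv_into_f, rule inv_into_into)
  \<comment> \<open>Uniqueness of preimages under \<open>tensor1\<close>. Linearity of
    \<open>h\<close> and its vanishing outside of the domain follow by exhibiting the expected value
    as a preimage.\<close>
  have hI: "h i x = v" if "v \<in> grd V (i + p)" "tensor1 V (i + p) v = f (Suc 0) i x" for i x v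
    unfolding h_def using inv_into_f_f[OF tensor1_inj[OF V] that(1)] that(2) by simp
  have "h \<in> hom_deg ?C V p"
  proof (rule hom_degI)
    fix i
    show "linear_between (scl ?C) (scl V) (grd ?C i) (grd V (i + p)) (h i)"
    proof (rule linear_betweenI)
      fix x y assume "x \<in> grd ?C i" "y \<in> grd ?C i"
      then show "h i (x + y) = h i x + h i y"
        by (intro hI) (simp_all add: h graded_add[OF V] linear_between_add[OF linear_tensor1]
            linear_between_add[OF hom_deg_linear[OF f1]])
    next
      fix c x assume "x \<in> grd ?C i"
      then show "h i (scl ?C c x) = scl V c (h i x)"
        by (intro hI) (simp_all add: h graded_scale[OF V] linear_between_scale[OF linear_tensor1]
            linear_between_scale[OF hom_deg_linear[OF f1]])
    qed (rule h)
  next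
    fix i x assume "x \<notin> grd ?C i"
    then show "h i x = 0"
      by (intro hI) (simp_all add: graded_0[OF V] tensor1_0[OF V] hom_deg_outside[OF f1])
  qed
  moreover have "f n i x = dual_schur_one V p h n i x" for n i x
  proof -
    have "f n i x = 0" if "n \<noteq> Suc 0"
    proof (cases "x \<in> grd (arity P n) i")
      case True
      then have "x = 0" using arity_one_grd[OF P that] by simp
      then show ?thesis
        using linear_between_zero[OF hom_deg_linear[OF fn] graded_0[OF arity_one_graded[OF P]]] by simp
    qed (rule hom_deg_outside[OF fn])
    then show ?thesis
      by (simp add: dual_schur_one_def h)
  qed
  then have "f = dual_schur_one V p h" by blast
  ultimately show ?thesis by (rule that)
qed

lemma dual_schur_one_dif:
  assumes P: "concentrated_in_arity_one P" and V: "dg_module V" and h: "h \<in> hom_deg (arity P (Suc 0)) V p"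
  shows "dual_schur_one V (p - 1) (hom_dif (arity P (Suc 0)) V p h) = dif (dual_schur P V) p (dual_schur_one V p h)"
proof -
  let ?C = "arity P (Suc 0)"
  note gV = dg_module_graded[OF V]
  have "dual_schur_one V (p - 1) (hom_dif ?C V p h) n i x = dif (dual_schur P V) p (dual_schur_one V p h) n i x"
    for n i x
  proof (cases "n = Suc 0 \<and> x \<in> grd ?C i")
    case True
    let ?a = "dif V (i + p) (h i x)" and ?b = "h (i - 1) (dif ?C i x)" and ?c = "(-1) powi p"
    \<comment> \<open>The two terms of the differential of \<open>h\<close> arise with differently
      written degrees; they must be identified before both can be embedded by the same
      \<open>tensor1\<close>.\<close>
    have idx: "i + (p - 1) = i + p - 1" "i - 1 + p = i + p - 1" by simp_all
    have a: "?a \<in> grd V (i + p - 1)"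
      by (rule linear_between_mem[OF dg_module_dif[OF V] hom_deg_mem[OF gV h]])
    have b: "?b \<in> grd V (i + p - 1)"
      using hom_deg_mem[OF gV h, of "i - 1"] by (simp only: idx)
    have "tensor1 V (i + p - 1) (?a - scl V ?c ?b)
        = tensor1 V (i + p - 1) ?a - fscale ?c (tensor1 V (i + p - 1) ?b)"
      using linear_between_diff[OF gV linear_tensor1 a graded_scale[OF gV b]]
        linear_between_scale[OF linear_tensor1 b] by simp
    then show ?thesis
      using True by (simp add: dual_schur_one_def hom_dif_def idx tensor_dif_1[OF V])
  next
    case False
    then show ?thesis
      by (auto simp: dual_schur_one_def hom_dif_def tensor_power_def tensor1_0[OF gV])
  qed
  then show ?thesis by blast
qed

section \<open>Transport of structure maps\<close>

lemma contramodule_action_eq: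
  "h \<in> hom_deg (arity P (Suc 0)) V p \<Longrightarrow> contramodule_action P V \<gamma> p h = \<gamma> p (dual_schur_one V p h)"
  by (simp add: contramodule_action_def)

lemma contramodule_action_mor:
  assumes P: "concentrated_in_arity_one P" and M: "dg_module M"
    and \<gamma>: "\<gamma> \<in> dg_mor (dual_schur P M) M"
  shows "contramodule_action P M \<gamma> \<in> dg_mor (hom_mod (arity P (Suc 0)) M) M"
proof (rule dg_morI)
  let ?C = "arity P (Suc 0)"
  note aP = concentrated_arity_one[OF P] and gM = dg_module_graded[OF M]
  note gC = arity_one_graded[OF aP]
  fix p
  have "linear_between (scl (hom_mod ?C M)) (scl M) (hom_deg ?C M p) (grd M p) (\<lambda>h. \<gamma> p (dual_schur_one M p h))"
    by (rule linear_between_comp[OF linear_dual_schur_one[OF aP gM] dg_mor_linear[OF \<gamma>]])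
  note lin = this[unfolded hom_mod_simps]
  show "linear_between (scl (hom_mod ?C M)) (scl M) (grd (hom_mod ?C M) p) (grd M p) (contramodule_action P M \<gamma> p)"
    unfolding hom_mod_simps
    by (rule linear_betweenI)
       (simp_all add: contramodule_action_eq hom_deg_closed[OF gM gC] linear_between_mem[OF lin]
          linear_between_add[OF lin] linear_between_scale[OF lin])
next
  fix p h assume "h \<notin> grd (hom_mod (arity P (Suc 0)) M) p"
  then show "contramodule_action P M \<gamma> p h = 0" by (simp add: contramodule_action_def)
next
  let ?C = "arity P (Suc 0)"
  fix p h assume "h \<in> grd (hom_mod ?C M) p"
  then have h: "h \<in> hom_deg ?C M p" by simp
  have "dual_schur_one M p h \<in> grd (dual_schur P M) p"
    by (rule linear_between_mem[OF linear_dual_schur_one[OF concentrated_arity_one[OF P] dg_module_graded[OF M]] h])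
  then show "contramodule_action P M \<gamma> (p - 1) (dif (hom_mod ?C M) p h) = dif M p (contramodule_action P M \<gamma> p h)"
    using dg_mor_dif[OF \<gamma>] dual_schur_one_dif[OF P M h] hom_dif_mem[OF concentrated_dg_module[OF P] M h]
    by (simp add: contramodule_action_eq h)
qed

lemma contramodule_action_inj:
  assumes P: "arity_one P" and M: "graded M"
  shows "inj_on (contramodule_action P M) (dg_mor (dual_schur P M) M)"
proof (rule inj_onI)
  fix \<gamma> \<delta> assume \<gamma>: "\<gamma> \<in> dg_mor (dual_schur P M) M" and \<delta>: "\<delta> \<in> dg_mor (dual_schur P M) M"
    and eq: "contramodule_action P M \<gamma> = contramodule_action P M \<delta>"
  have "\<gamma> p f = \<delta> p f" for p f
  proof (cases "f \<in> grd (dual_schur P M) p")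
    case True
    then obtain h where "h \<in> hom_deg (arity P (Suc 0)) M p" "f = dual_schur_one M p h"
      by (rule dual_schur_one_surj[OF P M])
    then show ?thesis
      using contramodule_action_eq[of h P M p \<gamma>] contramodule_action_eq[of h P M p \<delta>] eq by simp
  next
    case False
    show ?thesis unfolding dg_mor_outside[OF \<gamma> False] dg_mor_outside[OF \<delta> False] ..
  qed
  then show "\<gamma> = \<delta>" by blast
qed

text \<open>The preimage is \<open>\<delta>\<close> composed with the inverse of
  \<open>dual_schur_one\<close>, and 0 outside of the dual Schur functor so that it obeys the
  convention for morphisms. Its properties are checked after writing each argument as
  \<open>dual_schur_one M p h\<close>.\<close>

lemma contramodule_action_surj:
  assumes P: "concentrated_in_arity_one P" and M: "dg_module M"
    and \<delta>: "\<delta> \<in> dg_mor (hom_mod (arity P (Suc 0)) M) M"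
  obtains \<gamma> where "\<gamma> \<in> dg_mor (dual_schur P M) M" "contramodule_action P M \<gamma> = \<delta>"
proof -
  let ?C = "arity P (Suc 0)"
  note aP = concentrated_arity_one[OF P] and gM = dg_module_graded[OF M]
  note lin = linear_dual_schur_one[OF aP gM] and closed = hom_deg_closed[OF gM arity_one_graded[OF aP]]
  define \<gamma> where "\<gamma> p f = (if f \<in> grd (dual_schur P M) p
     then \<delta> p (inv_into (hom_deg ?C M p) (dual_schur_one M p) f) else 0)" for p f
  have \<gamma>: "\<gamma> p (dual_schur_one M p h) = \<delta> p h" if "h \<in> hom_deg ?C M p" for p h
    using linear_between_mem[OF lin that] inv_into_f_f[OF dual_schur_one_inj[OF gM] that]
    by (simp add: \<gamma>_def)
  have "\<gamma> \<in> dg_mor (dual_schur P M) M"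
  proof (rule dg_morI)
    fix p
    show "linear_between (scl (dual_schur P M)) (scl M) (grd (dual_schur P M) p) (grd M p) (\<gamma> p)"
    proof (rule linear_betweenI)
      fix f assume "f \<in> grd (dual_schur P M) p"
      then obtain h where h: "h \<in> hom_deg ?C M p" "f = dual_schur_one M p h"
        by (rule dual_schur_one_surj[OF aP gM])
      then show "\<gamma> p f \<in> grd M p"
        using linear_between_mem[OF dg_mor_linear[OF \<delta>], of h p] by (simp add: \<gamma>)
    next
      fix f f' assume f: "f \<in> grd (dual_schur P M) p" and f': "f' \<in> grd (dual_schur P M) p"
      obtain h where h: "h \<in> hom_deg ?C M p" "f = dual_schur_one M p h"
        using f by (rule dual_schur_one_surj[OF aP gM])
      obtain h' where h': "h' \<in> hom_deg ?C M p" "f' = dual_schur_one M p h'"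
        using f' by (rule dual_schur_one_surj[OF aP gM])
      have "f + f' = dual_schur_one M p (h + h')"
        using linear_between_add[OF lin h(1) h'(1)] h h' by simp
      then show "\<gamma> p (f + f') = \<gamma> p f + \<gamma> p f'"
        using h h' \<gamma>[OF closed(2)[OF h(1) h'(1)]] linear_between_add[OF dg_mor_linear[OF \<delta>], of h p h']
        by (simp add: \<gamma>)
    next
      fix c f assume "f \<in> grd (dual_schur P M) p"
      then obtain h where h: "h \<in> hom_deg ?C M p" "f = dual_schur_one M p h"
        by (rule dual_schur_one_surj[OF aP gM])
      have "scl (dual_schur P M) c f = dual_schur_one M p (\<lambda>i x. scl M c (h i x))"
        using linear_between_scale[OF lin h(1), of c] h by simp
      then show "\<gamma> p (scl (dual_schur P M) c f) = scl M c (\<gamma> p f)"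
        using h \<gamma>[OF closed(3)[OF h(1)]] linear_between_scale[OF dg_mor_linear[OF \<delta>], of h p c]
        by (simp add: \<gamma>)
    qed
  next
    fix p f assume "f \<notin> grd (dual_schur P M) p"
    then show "\<gamma> p f = 0" by (simp add: \<gamma>_def)
  next
    fix p f assume "f \<in> grd (dual_schur P M) p"
    then obtain h where h: "h \<in> hom_deg ?C M p" "f = dual_schur_one M p h"
      by (rule dual_schur_one_surj[OF aP gM])
    then show "\<gamma> (p - 1) (dif (dual_schur P M) p f) = dif M p (\<gamma> p f)"
      using \<gamma>[OF hom_dif_mem[OF concentrated_dg_module[OF P] M h(1)]] dual_schur_one_dif[OF P M h(1)]
        dg_mor_dif[OF \<delta>, of h p] by (simp add: \<gamma>)
  qed
  moreover have "contramodule_action P M \<gamma> = \<delta>"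
    using dg_mor_outside[OF \<delta>] by (auto simp: contramodule_action_def fun_eq_iff \<gamma>)
  ultimately show ?thesis by (rule that)
qed


section \<open>Contramodules and algebras\<close>

lemma linear_hom_curry:
  assumes C: "graded C" and M: "graded M" and g: "g \<in> hom_deg (tensor_power C 2) M p"
  shows "linear_between (scl C) (scl (hom_mod C M)) (grd C i) (hom_deg C M (i + p)) (hom_curry C g i)"
    and "x \<notin> grd C i \<Longrightarrow> hom_curry C g i x = 0"
proof -
  have lin: "linear_between fscale (scl M) (grd (tensor_power C 2) d) (grd M (d + p)) (g d)" for d
    using hom_deg_linear[OF g] by simp
  have mem: "pure_tensor C [(i, x), (j, y)] \<in> grd (tensor_power C 2) (i + j)"
    if "x \<in> grd C i" "y \<in> grd C j" for i x j y
    by (rule pure_tensor_mem) (use that in auto)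
  have left: "linear_between (scl C) (scl M) (grd C i) (grd M (i + j + p)) (\<lambda>x. g (i + j) (pure_tensor C [(i, x), (j, y)]))"
    if y: "y \<in> grd C j" for i j y
    by (rule linear_between_comp[OF linear_between_codomain[OF linear_on_pure_tensor_2(1)[OF y] mem[OF _ y]] lin])
  have right: "linear_between (scl C) (scl M) (grd C j) (grd M (i + j + p)) (\<lambda>y. g (i + j) (pure_tensor C [(i, x), (j, y)]))"
    if x: "x \<in> grd C i" for i j x
    by (rule linear_between_comp[OF linear_between_codomain[OF linear_on_pure_tensor_2(2)[OF x] mem[OF x]] lin])
  interpret M: vector_space "scl M" using M by (simp add: graded_def)
  show "linear_between (scl C) (scl (hom_mod C M)) (grd C i) (hom_deg C M (i + p)) (hom_curry C g i)"
  proof (rule linear_betweenI)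
    fix x assume x: "x \<in> grd C i"
    show "hom_curry C g i x \<in> hom_deg C M (i + p)"
    proof (rule hom_degI)
      fix j
      have "linear_between (scl C) (scl M) (grd C j) (grd M (j + (i + p))) (\<lambda>y. g (i + j) (pure_tensor C [(i, x), (j, y)]))"
        using right[OF x, of j] by (simp add: algebra_simps)
      from graded_linear_cong[OF this C]
      show "linear_between (scl C) (scl M) (grd C j) (grd M (j + (i + p))) (hom_curry C g i x j)"
        by (simp add: hom_curry_def x)
    qed (simp add: hom_curry_def)
  next
    fix x x' assume "x \<in> grd C i" "x' \<in> grd C i"
    then show "hom_curry C g i (x + x') = hom_curry C g i x + hom_curry C g i x'"
      by (auto simp: fun_eq_iff hom_curry_def graded_add[OF C] linear_between_add[OF left])
  next
    fix c x assume "x \<in> grd C i"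
    then show "hom_curry C g i (scl C c x) = scl (hom_mod C M) c (hom_curry C g i x)"
      by (auto simp: fun_eq_iff hom_curry_def graded_scale[OF C] linear_between_scale[OF left])
  qed
  show "x \<notin> grd C i \<Longrightarrow> hom_curry C g i x = 0"
    by (auto simp: hom_curry_def fun_eq_iff)
qed

lemma multilinear_forms_2I:
  assumes "\<And>i j y. y \<in> grd V j \<Longrightarrow> linear_on (scl V) (*) (grd V i) (\<lambda>x. \<Phi> [(i, x), (j, y)])"
    and "\<And>i j x. x \<in> grd V i \<Longrightarrow> linear_on (scl V) (*) (grd V j) (\<lambda>y. \<Phi> [(i, x), (j, y)])"
  shows "\<Phi> \<in> multilinear_forms V 2"
  unfolding multilinear_forms_iff
proof (intro allI impI)
  fix l r i assume "Suc (length l + length r) = 2" "homogeneous V (l @ r)"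
  then show "linear_on (scl V) (*) (grd V i) (\<lambda>x. \<Phi> (l @ (i, x) # r))"
    by (cases l; cases r) (use assms in auto)
qed

text \<open>This is the universal property of the tensor square: a bilinear map composed with any
  functional is a multilinear form, so \<open>ev_universal\<close> extends it linearly.\<close>

lemma hom_curry_surj:
  fixes C :: "('k::field, 'c::ab_group_add) dgmod" and M :: "('k, 'm::ab_group_add) dgmod"
  assumes C: "graded C" and M: "graded M"
    and H: "\<And>i. linear_between (scl C) (scl (hom_mod C M)) (grd C i) (hom_deg C M (i + p)) (H i)"
    and H0: "\<And>i x. x \<notin> grd C i \<Longrightarrow> H i x = 0"
  obtains g where "g \<in> hom_deg (tensor_power C 2) M p" "hom_curry C g = H"
proof -
  define h where "h xs = H (fst (xs ! 0)) (snd (xs ! 0)) (fst (xs ! 1)) (snd (xs ! 1))" for xs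
  have vM: "vector_space (scl M)" using M by (simp add: graded_def)
  have mem: "H i x \<in> hom_deg C M (i + p)" if "x \<in> grd C i" for i x
    by (rule linear_between_mem[OF H that])
  have "\<exists>g. Vector_Spaces.linear fscale (scl M) g \<and> (\<forall>xs. g (ev (multilinear_forms C 2) xs) = h xs)"
  proof (rule ev_universal[OF vM], rule multilinear_forms_2I)
    fix l assume "Vector_Spaces.linear (scl M) (*) l"
    then interpret l: Vector_Spaces.linear "scl M" "(*)" l .
    show "linear_on (scl C) (*) (grd C i) (\<lambda>x. l (h [(i, x), (j, y)]))" for i j y
      by (rule linear_betweenI)
         (simp_all add: h_def linear_between_add[OF H] linear_between_scale[OF H] l.add l.scale)
    show "linear_on (scl C) (*) (grd C j) (\<lambda>y. l (h [(i, x), (j, y)]))" if "x \<in> grd C i" for i j x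
      by (rule linear_betweenI)
         (simp_all add: h_def linear_between_add[OF hom_deg_linear[OF mem[OF that]]]
            linear_between_scale[OF hom_deg_linear[OF mem[OF that]]] l.add l.scale)
  qed
  then obtain g0 where g0: "Vector_Spaces.linear fscale (scl M) g0" "\<And>xs. g0 (ev (multilinear_forms C 2) xs) = h xs"
    by blast
  interpret g0: Vector_Spaces.linear fscale "scl M" g0 by (rule g0(1))
  have g0_pure: "g0 (pure_tensor C [(i, x), (j, y)]) = H i x j y" for i x j y
    using g0(2)[of "[(i, x), (j, y)]"] by (simp add: pure_tensor_def h_def numeral_2_eq_2)
  \<comment> \<open>Generators carry the degrees of their entries, so the single map
    \<open>g0\<close> serves all degrees at once; it only has to be cut off outside of each graded
    piece.\<close>
  define g where "g d T = (if T \<in> grd (tensor_power C 2) d then g0 T else 0)" for d T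
  have "linear_between fscale (scl M) (grd (tensor_power C 2) d) (grd M (d + p)) g0" for d
  proof (rule tensor_power_linear_between[OF _ _ vM])
    show "linear_on fscale (scl M) (grd (tensor_power C 2) d) g0"
      by (rule linear_betweenI) (simp_all only: g0.add g0.scale UNIV_I)
    show "module.subspace (scl M) (grd M (d + p))" using M by (simp add: graded_def)
    fix vs assume "length vs = 2" "homogeneous C vs" "sum_list (map fst vs) = d"
    then obtain i x j y where vs: "vs = [(i, x), (j, y)]" "x \<in> grd C i" "y \<in> grd C j" "i + j = d"
      by (rule length_2_gens)
    have "j + (i + p) = d + p" using vs(4) by simp
    then show "g0 (pure_tensor C vs) \<in> grd M (d + p)"
      using hom_deg_mem[OF M mem[OF vs(2)], of j y] by (simp only: vs(1) g0_pure)
  qed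
  from graded_linear_cong[OF this[folded tensor_power_simps(1)[of C 2]] graded_tensor_power]
  have "g \<in> hom_deg (tensor_power C 2) M p"
    by (intro hom_degI) (simp_all add: g_def del: tensor_power_simps(2))
  moreover have "hom_curry C g i x j y = H i x j y" for i x j y
  proof (cases "x \<in> grd C i \<and> y \<in> grd C j")
    case True
    then have "pure_tensor C [(i, x), (j, y)] \<in> grd (tensor_power C 2) (i + j)"
      by (intro pure_tensor_mem) auto
    with True show ?thesis by (simp add: hom_curry_def g_def g0_pure del: tensor_power_simps)
  next
    case False
    then show ?thesis
      using H0[of x i] hom_deg_outside[OF mem, of x i y j] by (cases "x \<in> grd C i") (auto simp: hom_curry_def)
  qed
  then have "hom_curry C g = H" by blast
  ultimately show ?thesis by (rule that)
qed

text \<open>The element of the twice iterated dual Schur functor that corresponds to \<open>g \<in> Hom(P(1) \<otimes> P(1), M)\<close>.\<close>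

definition double_dual where
  "double_dual P M p g = dual_schur_one (dual_schur P M) p
     (\<lambda>i x. dual_schur_one M (i + p) (hom_curry (arity P (Suc 0)) g i x))"

section \<open>The monad structure expressed through Hom modules\<close>

lemma dual_schur_one_0: "graded M \<Longrightarrow> dual_schur_one M p 0 = 0"
  by (simp add: dual_schur_one_def tensor1_0 fun_eq_iff)

lemma double_dual_inner:
  assumes P: "arity_one P" and M: "graded M"
    and g: "g \<in> hom_deg (tensor_power (arity P (Suc 0)) 2) M p"
  shows "(\<lambda>i x. dual_schur_one M (i + p) (hom_curry (arity P (Suc 0)) g i x))
    \<in> hom_deg (arity P (Suc 0)) (dual_schur P M) p"
proof (rule hom_degI)
  note gC = arity_one_graded[OF P]
  show "linear_between (scl (arity P (Suc 0))) (scl (dual_schur P M)) (grd (arity P (Suc 0)) i)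
      (grd (dual_schur P M) (i + p)) (\<lambda>x. dual_schur_one M (i + p) (hom_curry (arity P (Suc 0)) g i x))" for i
    by (rule linear_between_comp[OF linear_hom_curry(1)[OF gC M g] linear_dual_schur_one[OF P M]])
  show "dual_schur_one M (i + p) (hom_curry (arity P (Suc 0)) g i x) = 0"
    if "x \<notin> grd (arity P (Suc 0)) i" for i x
    by (simp add: linear_hom_curry(2)[OF gC M g that] dual_schur_one_0[OF M])
qed

lemma double_dual_mem:
  assumes P: "arity_one P" and M: "graded M"
    and g: "g \<in> hom_deg (tensor_power (arity P (Suc 0)) 2) M p"
  shows "double_dual P M p g \<in> grd (dual_schur P (dual_schur P M)) p"
  unfolding double_dual_def
  by (rule linear_between_mem[OF linear_dual_schur_one[OF P graded_dual_schur[OF P]] double_dual_inner[OF P M g]])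

text \<open>Both layers of the dual Schur functor are removed by surjectivity of
  \<open>dual_schur_one\<close>, and the resulting map into a Hom module is uncurried.\<close>

lemma double_dual_surj:
  assumes P: "arity_one P" and M: "graded M" and f: "f \<in> grd (dual_schur P (dual_schur P M)) p"
  obtains g where "g \<in> hom_deg (tensor_power (arity P (Suc 0)) 2) M p" "f = double_dual P M p g"
proof -
  let ?C = "arity P (Suc 0)" and ?S = "dual_schur P M"
  note gC = arity_one_graded[OF P] and lin = linear_dual_schur_one[OF P M]
  obtain F where F: "F \<in> hom_deg ?C ?S p" "f = dual_schur_one ?S p F"
    using f by (rule dual_schur_one_surj[OF P graded_dual_schur[OF P]])
  have "\<exists>h. h \<in> hom_deg ?C M (i + p) \<and> F i x = dual_schur_one M (i + p) h" for i x
    using hom_deg_mem[OF graded_dual_schur[OF P] F(1), of i x] by (rule dual_schur_one_surj[OF P M]) blast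
  then obtain H where H: "\<And>i x. H i x \<in> hom_deg ?C M (i + p)" "\<And>i x. F i x = dual_schur_one M (i + p) (H i x)"
    by metis
  note closed = hom_deg_closed[OF M gC]
  \<comment> \<open>\<open>H\<close> comes from a choice made separately for each \<open>i\<close>
    and \<open>x\<close>. Injectivity of \<open>dual_schur_one\<close> makes the choice unique, and
    this yields linearity of \<open>H\<close>.\<close>
  have HI: "H i x = h" if "h \<in> hom_deg ?C M (i + p)" "dual_schur_one M (i + p) h = F i x" for i x h
    using inj_onD[OF dual_schur_one_inj[OF M] _ H(1) that(1)] that(2) H(2) by simp
  have 1: "linear_between (scl ?C) (scl (hom_mod ?C M)) (grd ?C i) (hom_deg ?C M (i + p)) (H i)" for i
  proof (rule linear_betweenI)
    fix x y assume "x \<in> grd ?C i" "y \<in> grd ?C i"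
    then show "H i (x + y) = H i x + H i y"
      using linear_between_add[OF hom_deg_linear[OF F(1)]] linear_between_add[OF lin H(1) H(1)]
      by (intro HI) (simp_all add: closed(2) H)
  next
    fix c x assume "x \<in> grd ?C i"
    then show "H i (scl ?C c x) = scl (hom_mod ?C M) c (H i x)"
      using linear_between_scale[OF hom_deg_linear[OF F(1)]] linear_between_scale[OF lin H(1)]
      by (intro HI) (simp_all add: closed(3) H)
  qed (rule H)
  have 2: "H i x = 0" if "x \<notin> grd ?C i" for i x
    by (rule HI) (simp_all add: closed(1) dual_schur_one_0[OF M] hom_deg_outside[OF F(1) that])
  obtain g where g: "g \<in> hom_deg (tensor_power ?C 2) M p" "hom_curry ?C g = H"
    by (rule hom_curry_surj[OF gC M 1 2])
  have "F = (\<lambda>i x. dual_schur_one M (i + p) (hom_curry ?C g i x))"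
    using H(2) g(2) by blast
  then have "f = double_dual P M p g" by (simp add: F(2) double_dual_def)
  with g(1) show ?thesis by (rule that)
qed

text \<open>On \<open>\<mu> \<otimes> \<nu>\<close> the lax map first evaluates at
  \<open>\<mu>\<close>, which gives a single tensor factor, and then evaluates that factor at
  \<open>\<nu>\<close>. This is the order of arguments in \<open>hom_curry\<close>. With one factor
  there is nothing to shuffle, permute or concatenate, so no sign appears.\<close>

lemma double_dual_lax:
  fixes P :: "('k::field, 'a::ab_group_add) smod" and M :: "('k, 'm::ab_group_add) dgmod"
  assumes P: "arity_one P" and M: "graded M"
    and g: "g \<in> hom_deg (tensor_power (arity P (Suc 0)) 2) M p"
    and T: "T \<in> grd (tensor_power (arity P (Suc 0)) 2) d"
  shows "dual_schur_lax P P M (double_dual P M p g) (Suc 0) d (comp_one P T) = tensor1 M (d + p) (g d T)"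
proof -
  let ?C = "arity P (Suc 0)" and ?S = "dual_schur P M" and ?f = "double_dual P M p g"
  note gC = arity_one_graded[OF P] and gS = graded_dual_schur[OF P]
  define inner where "inner \<nu>s \<sigma> gs = fscale (shuffle_sign (map fst gs) (degrees_of \<nu>s))
         (tensor_perm M \<sigma> (tensor_concat M (map2 (\<lambda>(_ :: int, g) (a, q, \<nu>). g a q \<nu>) gs \<nu>s)))"
    for \<nu>s :: "(nat \<times> int \<times> 'a) list" and \<sigma> and gs :: "(int \<times> (nat \<Rightarrow> int \<Rightarrow> 'a \<Rightarrow> ('m, 'k) tensor)) list"
  define L where "L = (\<lambda>((r, \<mu>), \<nu>s, \<sigma>). bind (?f (length \<nu>s) r \<mu>) (inner \<nu>s \<sigma>))"
  have lin: "linear_between fscale (scl M) (grd (tensor_power ?C 2) d) (grd M (d + p)) (g d)" for d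
    using hom_deg_linear[OF g] by simp
  note out = linear_between_comp[OF lin linear_tensor1]
  have mem: "pure_tensor ?C [(i, x), (j, y)] \<in> grd (tensor_power ?C 2) (i + j)"
    if "x \<in> grd ?C i" "y \<in> grd ?C j" for i x j y
    by (rule pure_tensor_mem) (use that in auto)
  have inner_1: "inner [(Suc 0, q, \<nu>)] id [(j, G)] = G (Suc 0) q \<nu>" if G: "G \<in> grd ?S j" for q \<nu> j G
  proof -
    have "G (Suc 0) \<in> hom_deg ?C (tensor_power M (Suc 0)) j" using G by (simp add: dual_schur_grd)
    then have "G (Suc 0) q \<nu> \<in> grd (tensor_power M (Suc 0)) (q + j)"
      by (rule hom_deg_mem[OF graded_tensor_power])
    then show ?thesis
      by (simp add: inner_def shuffle_sign_single tensor_concat_single[OF M] tensor_perm_id del: tensor_power_simps)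
  qed
  have inner: "bind (tensor1 ?S j G) (inner [(Suc 0, q, \<nu>)] id) = G (Suc 0) q \<nu>" if G: "G \<in> grd ?S j" for q \<nu> j G
  proof -
    have "linear_on (scl ?S) fscale (grd ?S j) (\<lambda>G. G (Suc 0) q \<nu>)" for j
      by (rule linear_betweenI) simp_all
    \<comment> \<open>The inner map reduces to evaluation at \<open>\<nu>\<close> only on genuine
      elements of the dual Schur functor, since permutation by the identity and concatenation of one
      factor fix genuine tensors; its linearity is therefore transferred on each graded
      piece.\<close>
    from graded_linear_cong[OF this gS]
    have "admissible (multilinear_forms ?S (Suc 0)) (inner [(Suc 0, q, \<nu>)] id)"
      by (intro admissible_multilinear_1) (simp add: inner_1)
    then show ?thesis
      unfolding tensor1_def by (simp add: bind_pure_tensor inner_1[OF G])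
  qed
  have L1: "L ((r, \<mu>), [(Suc 0, q, \<nu>)], id) = tensor1 M (r + q + p) (g (r + q) (pure_tensor ?C [(r, \<mu>), (q, \<nu>)]))"
    if \<mu>: "\<mu> \<in> grd ?C r" and \<nu>: "\<nu> \<in> grd ?C q" for r \<mu> q \<nu>
  proof -
    let ?G = "dual_schur_one M (r + p) (hom_curry ?C g r \<mu>)"
    have "?G \<in> grd ?S (r + p)"
      by (rule hom_deg_mem[OF gS double_dual_inner[OF P M g]])
    from inner[OF this] have "L ((r, \<mu>), [(Suc 0, q, \<nu>)], id) = ?G (Suc 0) q \<nu>"
      by (simp add: L_def double_dual_def dual_schur_one_def[of ?S])
    then show ?thesis
      using \<mu> \<nu> by (simp add: dual_schur_one_def hom_curry_def algebra_simps)
  qed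
  have adm: "admissible (cforms P P (Suc 0)) L"
  proof (rule admissible_cformsI[OF P P])
    fix r q \<nu> assume \<nu>: "\<nu> \<in> grd ?C q"
    have "linear_on (scl ?C) fscale (grd ?C r)
        (\<lambda>\<mu>. tensor1 M (r + q + p) (g (r + q) (pure_tensor ?C [(r, \<mu>), (q, \<nu>)])))"
      by (rule linear_on_weaken[OF linear_between_comp[OF
            linear_between_codomain[OF linear_on_pure_tensor_2(1)[OF \<nu>] mem[OF _ \<nu>]] out]])
    from graded_linear_cong[OF this gC]
    show "linear_on (scl ?C) fscale (grd ?C r) (\<lambda>\<mu>. L ((r, \<mu>), [(Suc 0, q, \<nu>)], id))"
      by (simp add: L1 \<nu>)
  next
    fix r q \<mu> assume \<mu>: "\<mu> \<in> grd ?C r"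
    have "linear_on (scl ?C) fscale (grd ?C q)
        (\<lambda>\<nu>. tensor1 M (r + q + p) (g (r + q) (pure_tensor ?C [(r, \<mu>), (q, \<nu>)])))"
      by (rule linear_on_weaken[OF linear_between_comp[OF
            linear_between_codomain[OF linear_on_pure_tensor_2(2)[OF \<mu>] mem[OF \<mu>]] out]])
    from graded_linear_cong[OF this gC]
    show "linear_on (scl ?C) fscale (grd ?C q) (\<lambda>\<nu>. L ((r, \<mu>), [(Suc 0, q, \<nu>)], id))"
      by (simp add: L1 \<mu>)
  next
    fix r \<mu> \<sigma> and \<nu>s :: "(nat \<times> int \<times> 'a) list" assume "length \<nu>s \<noteq> Suc 0"
    then show "L ((r, \<mu>), \<nu>s, \<sigma>) = 0"
      by (simp add: L_def double_dual_def dual_schur_one_def)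
  qed
  have "bind (comp_one P T) L = tensor1 M (d + p) (g d T)"
  proof (rule tensor_power_linear_eq[OF linear_between_comp[OF linear_comp_one linear_bind] out _ T])
    fix vs assume "length vs = 2" "homogeneous ?C vs" "sum_list (map fst vs) = d"
    then obtain i x j y where vs: "vs = [(i, x), (j, y)]" "x \<in> grd ?C i" "y \<in> grd ?C j" "i + j = d"
      by (rule length_2_gens)
    then show "bind (comp_one P (pure_tensor ?C vs)) L = tensor1 M (d + p) (g d (pure_tensor ?C vs))"
      by (simp add: comp_one_pure[OF P] bind_comp_pure[OF adm] L1)
  qed
  moreover have "comp_one P T \<in> grd (arity (comp_prod P P) (Suc 0)) d"
    by (rule linear_between_mem[OF comp_one_between[OF P] T])
  ultimately show ?thesis
    unfolding dual_schur_lax_def L_def inner_def by simp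
qed

lemma monad_mult_double_dual:
  assumes P: "arity_one P" and M: "graded M"
    and \<Delta>: "\<Delta> \<in> dg_mor (arity P (Suc 0)) (tensor_power (arity P (Suc 0)) 2)"
    and g: "g \<in> hom_deg (tensor_power (arity P (Suc 0)) 2) M p"
  shows "monad_mult P (cooperad_comult P \<Delta>) M (double_dual P M p g) = dual_schur_one M p (\<lambda>i x. g i (\<Delta> i x))"
proof -
  let ?C = "arity P (Suc 0)"
  have "dual_schur_lax P P M (double_dual P M p g) n i (cooperad_comult P \<Delta> n i x)
      = dual_schur_one M p (\<lambda>i x. g i (\<Delta> i x)) n i x" for n i x
  proof (cases "n = Suc 0")
    case True
    \<comment> \<open>Needed for every \<open>x\<close>, because \<open>dual_schur_lax\<close>
      returns 0 off the graded pieces of the composition product. Outside of the domain of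
      \<open>\<Delta>\<close> the value 0 lies in the piece anyway.\<close>
    have "\<Delta> i x \<in> grd (tensor_power ?C 2) i"
    proof (cases "x \<in> grd ?C i")
      case True
      then show ?thesis by (rule linear_between_mem[OF dg_mor_linear[OF \<Delta>]])
    next
      case False
      then show ?thesis
        using dg_mor_outside[OF \<Delta>] graded_0[OF graded_tensor_power] by metis
    qed
    from double_dual_lax[OF P M g this] True show ?thesis
      by (simp add: cooperad_comult_def dual_schur_one_def)
  qed (simp add: cooperad_comult_def dual_schur_one_def dual_schur_lax_def)
  then show ?thesis
    unfolding monad_mult_def dual_schur_comap_def by blast
qed

lemma dual_schur_map_one:
  assumes f: "\<And>i. linear_between (scl V) (scl W) (grd V i) (grd W i) (f i)"
  shows "dual_schur_map W f (dual_schur_one V p h) = dual_schur_one W p (\<lambda>i x. f (i + p) (h i x))"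
proof -
  have "dual_schur_map W f (dual_schur_one V p h) n i x = dual_schur_one W p (\<lambda>i x. f (i + p) (h i x)) n i x" for n i x
    by (simp add: dual_schur_map_def dual_schur_one_def tensor1_def tensor_map_pure[OF f])
       (simp add: tensor_map_def)
  then show ?thesis by blast
qed

text \<open>Applying \<open>\<gamma>\<close> under the outer dual Schur functor acts on the inner
  Hom, and there \<open>\<gamma>\<close> composed with \<open>dual_schur_one\<close> is the
  transported action.\<close>

lemma dual_schur_map_double_dual:
  assumes P: "arity_one P" and M: "graded M" and \<gamma>: "\<gamma> \<in> dg_mor (dual_schur P M) M"
    and g: "g \<in> hom_deg (tensor_power (arity P (Suc 0)) 2) M p"
  shows "dual_schur_map M \<gamma> (double_dual P M p g)
    = dual_schur_one M p (\<lambda>i x. contramodule_action P M \<gamma> (i + p) (hom_curry (arity P (Suc 0)) g i x))"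
proof -
  let ?C = "arity P (Suc 0)"
  note gC = arity_one_graded[OF P]
  have "hom_curry ?C g i x \<in> hom_deg ?C M (i + p)" for i x
  proof (cases "x \<in> grd ?C i")
    case True
    then show ?thesis by (rule linear_between_mem[OF linear_hom_curry(1)[OF gC M g]])
  qed (simp add: linear_hom_curry(2)[OF gC M g] hom_deg_closed(1)[OF M gC])
  then show ?thesis
    unfolding double_dual_def by (simp add: dual_schur_map_one[OF dg_mor_linear[OF \<gamma>]] contramodule_action_eq)
qed

text \<open>For \<open>i = 0\<close> the degree labels \<open>p\<close> and \<open>i + p\<close>
  coincide; for \<open>i \<noteq> 0\<close> both sides are zero because \<open>tensor1\<close> maps
  0 to 0.\<close>

lemma monad_unit_one:
  assumes M: "graded M"
  shows "monad_unit (cooperad_counit \<epsilon>) M p v = dual_schur_one M p (\<lambda>i x. if i = 0 then scl M (\<epsilon> i x) v else 0)"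
proof -
  have "monad_unit (cooperad_counit \<epsilon>) M p v n i x
      = dual_schur_one M p (\<lambda>i x. if i = 0 then scl M (\<epsilon> i x) v else 0) n i x" for n i x
    by (simp add: monad_unit_def dual_schur_comap_def dual_schur_unit_iso_def cooperad_counit_def
        dual_schur_one_def tensor1_0[OF M])
  then show ?thesis by blast
qed

section \<open>Comparison of algebras and contramodules\<close>

lemma dg_algebra_iff:
  assumes P: "concentrated_in_arity_one P" and c: "dg_coalgebra (arity P (Suc 0)) \<Delta> \<epsilon>" and M: "dg_module M"
    and \<gamma>: "\<gamma> \<in> dg_mor (dual_schur P M) M"
  shows "dg_algebra P (cooperad_comult P \<Delta>) (cooperad_counit \<epsilon>) M \<gamma> \<longleftrightarrow>
    dg_contramodule (arity P (Suc 0)) \<Delta> \<epsilon> M (contramodule_action P M \<gamma>)"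
proof -
  let ?C = "arity P (Suc 0)" and ?\<gamma> = "contramodule_action P M \<gamma>"
  note aP = concentrated_arity_one[OF P] and gM = dg_module_graded[OF M]
  note gC = arity_one_graded[OF aP]
  have \<Delta>: "\<Delta> \<in> dg_mor ?C (tensor_power ?C 2)" and \<epsilon>: "\<epsilon> \<in> dg_mor ?C unit_mod"
    using c by (auto simp: dg_coalgebra_def)
  note \<gamma>' = contramodule_action_mor[OF P M \<gamma>]
  interpret M: vector_space "scl M" using gM by (simp add: graded_def)
  \<comment> \<open>This membership and the next two are required since
    \<open>contramodule_action\<close> is 0 outside of Hom, and agrees with \<open>\<gamma>\<close>
    after \<open>dual_schur_one\<close> only inside.\<close>
  have 1: "(\<lambda>i x. g i (\<Delta> i x)) \<in> hom_deg ?C M p" if g: "g \<in> hom_deg (tensor_power ?C 2) M p" for p g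
    by (rule hom_degI)
       (auto intro: linear_between_comp[OF dg_mor_linear[OF \<Delta>] hom_deg_linear[OF g]]
         simp: dg_mor_outside[OF \<Delta>] linear_between_zero[OF hom_deg_linear[OF g] graded_0[OF graded_tensor_power]])
  have 2: "(\<lambda>i x. ?\<gamma> (i + p) (hom_curry ?C g i x)) \<in> hom_deg ?C M p"
    if g: "g \<in> hom_deg (tensor_power ?C 2) M p" for p g
  proof (rule hom_degI)
    have \<gamma>'_lin: "linear_between (scl (hom_mod ?C M)) (scl M) (hom_deg ?C M q) (grd M q) (?\<gamma> q)" for q
      using dg_mor_linear[OF \<gamma>'] by simp
    show "linear_between (scl ?C) (scl M) (grd ?C i) (grd M (i + p)) (\<lambda>x. ?\<gamma> (i + p) (hom_curry ?C g i x))" for i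
      by (rule linear_between_comp[OF linear_hom_curry(1)[OF gC gM g] \<gamma>'_lin])
    show "?\<gamma> (i + p) (hom_curry ?C g i x) = 0" if "x \<notin> grd ?C i" for i x
      unfolding linear_hom_curry(2)[OF gC gM g that]
      by (rule linear_between_zero[OF \<gamma>'_lin hom_deg_closed(1)[OF gM gC]])
  qed
  have 3: "(\<lambda>i x. if i = 0 then scl M (\<epsilon> i x) v else 0) \<in> hom_deg ?C M p" if v: "v \<in> grd M p" for p v
  proof (rule hom_degI)
    fix i
    show "linear_between (scl ?C) (scl M) (grd ?C i) (grd M (i + p)) (\<lambda>x. if i = 0 then scl M (\<epsilon> i x) v else 0)"
      using linear_between_add[OF dg_mor_linear[OF \<epsilon>]] linear_between_scale[OF dg_mor_linear[OF \<epsilon>]]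
      by (cases "i = 0"; intro linear_betweenI)
         (simp_all add: graded_0[OF gM] graded_scale[OF gM v] M.scale_left_distrib unit_mod_simps)
  qed (use dg_mor_outside[OF \<epsilon>] in auto)
  have mult: "(\<forall>f\<in>grd (dual_schur P (dual_schur P M)) p.
        \<gamma> p (monad_mult P (cooperad_comult P \<Delta>) M f) = \<gamma> p (dual_schur_map M \<gamma> f)) \<longleftrightarrow>
     (\<forall>g\<in>hom_deg (tensor_power ?C 2) M p.
        ?\<gamma> p (\<lambda>i x. g i (\<Delta> i x)) = ?\<gamma> p (\<lambda>i x. ?\<gamma> (i + p) (hom_curry ?C g i x)))" (is "?l \<longleftrightarrow> ?r") for p
  proof -
    have "?l \<longleftrightarrow> (\<forall>g\<in>hom_deg (tensor_power ?C 2) M p.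
        \<gamma> p (monad_mult P (cooperad_comult P \<Delta>) M (double_dual P M p g)) = \<gamma> p (dual_schur_map M \<gamma> (double_dual P M p g)))"
      \<comment> \<open>\<open>double_dual\<close> is onto, so quantifying over the iterated dual
        Schur functor is quantifying over \<open>g\<close>; in these terms the two associativity
        laws coincide.\<close>
      using double_dual_mem[OF aP gM] double_dual_surj[OF aP gM] by metis
    also have "\<dots> \<longleftrightarrow> ?r"
      by (simp add: monad_mult_double_dual[OF aP gM \<Delta>] dual_schur_map_double_dual[OF aP gM \<gamma>]
          contramodule_action_eq 1 2 del: tensor_power_simps cong: ball_cong_simp)
    finally show ?thesis .
  qed
  have unit: "\<gamma> p (monad_unit (cooperad_counit \<epsilon>) M p v) = ?\<gamma> p (\<lambda>i x. if i = 0 then scl M (\<epsilon> i x) v else 0)"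
    if "v \<in> grd M p" for p v
    unfolding monad_unit_one[OF gM] contramodule_action_eq[OF 3[OF that]] ..
  show ?thesis
    unfolding dg_algebra_def dg_contramodule_def mult using M \<gamma> \<gamma>' unit by simp
qed

lemma bij_contramodule_action:
  assumes P: "concentrated_in_arity_one P" and c: "dg_coalgebra (arity P (Suc 0)) \<Delta> \<epsilon>"
  shows "bij_betw (contramodule_action P M)
     {\<gamma>. dg_algebra P (cooperad_comult P \<Delta>) (cooperad_counit \<epsilon>) M \<gamma>}
     {\<gamma>. dg_contramodule (arity P (Suc 0)) \<Delta> \<epsilon> M \<gamma>}" (is "bij_betw ?F ?A ?B")
proof (cases "dg_module M")
  case True
  have sub: "?A \<subseteq> dg_mor (dual_schur P M) M" by (auto simp: dg_algebra_def)
  have "?F ` ?A = ?B"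
  proof
    show "?F ` ?A \<subseteq> ?B" using dg_algebra_iff[OF P c True] sub by auto
    show "?B \<subseteq> ?F ` ?A"
    proof
      fix \<delta> assume \<delta>: "\<delta> \<in> ?B"
      then have "\<delta> \<in> dg_mor (hom_mod (arity P (Suc 0)) M) M" by (simp add: dg_contramodule_def)
      then obtain \<gamma> where "\<gamma> \<in> dg_mor (dual_schur P M) M" "?F \<gamma> = \<delta>"
        by (rule contramodule_action_surj[OF P True])
      with \<delta> dg_algebra_iff[OF P c True] show "\<delta> \<in> ?F ` ?A" by auto
    qed
  qed
  moreover have "inj_on ?F ?A"
    by (rule inj_on_subset[OF contramodule_action_inj[OF concentrated_arity_one[OF P] dg_module_graded[OF True]] sub])
  ultimately show ?thesis by (simp add: bij_betw_def)
next
  case False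
  \<comment> \<open>Both structures require \<open>M\<close> to be a dg module, so in this case both
    sets are empty.\<close>
  then show ?thesis by (simp add: dg_algebra_def dg_contramodule_def bij_betw_def)
qed

text \<open>The isomorphism \<open>dual_schur_one\<close> is natural in the module, so the condition
  for a given \<open>f\<close> at \<open>h\<close> on one side is the condition for the same
  \<open>f\<close> at \<open>dual_schur_one M p h\<close> on the other.\<close>

lemma algebra_mor_eq_contramodule_mor:
  assumes P: "concentrated_in_arity_one P" and M: "dg_module M" and N: "dg_module N"
  shows "algebra_mor P M \<gamma> N \<delta>
    = contramodule_mor (arity P (Suc 0)) M (contramodule_action P M \<gamma>) N (contramodule_action P N \<delta>)"
proof -
  let ?C = "arity P (Suc 0)"
  note aP = concentrated_arity_one[OF P] and gM = dg_module_graded[OF M] and gN = dg_module_graded[OF N]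
  have "(\<forall>h\<in>grd (dual_schur P M) p. f p (\<gamma> p h) = \<delta> p (dual_schur_map N f h)) \<longleftrightarrow>
      (\<forall>h\<in>hom_deg ?C M p. f p (contramodule_action P M \<gamma> p h)
        = contramodule_action P N \<delta> p (\<lambda>i x. f (i + p) (h i x)))" (is "?l \<longleftrightarrow> ?r") if f: "f \<in> dg_mor M N" for f p
  proof -
    have "?l \<longleftrightarrow> (\<forall>h\<in>hom_deg ?C M p. f p (\<gamma> p (dual_schur_one M p h)) = \<delta> p (dual_schur_map N f (dual_schur_one M p h)))"
      using linear_between_mem[OF linear_dual_schur_one[OF aP gM]] dual_schur_one_surj[OF aP gM] by metis
    also have "\<dots> \<longleftrightarrow> ?r"
    proof (rule ball_cong[OF refl])
      fix h assume h: "h \<in> hom_deg ?C M p"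
      have "(\<lambda>i x. f (i + p) (h i x)) \<in> hom_deg ?C N p"
        by (rule hom_deg_comp[OF h dg_mor_linear[OF f] gM])
      with h show "f p (\<gamma> p (dual_schur_one M p h)) = \<delta> p (dual_schur_map N f (dual_schur_one M p h)) \<longleftrightarrow>
        f p (contramodule_action P M \<gamma> p h) = contramodule_action P N \<delta> p (\<lambda>i x. f (i + p) (h i x))"
        by (simp add: contramodule_action_eq dual_schur_map_one[OF dg_mor_linear[OF f]])
    qed
    finally show ?thesis .
  qed
  then show ?thesis
    unfolding algebra_mor_def contramodule_mor_def by blast
qed

text \<open>Equivalence of data is understood categorically. For coalgebras and cooperads: each dg
  module occurs as arity one of a concentrated S-module, structures on it correspond bijectively,
  and restriction to arity one is bijective on morphisms. For contramodules and algebras the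
  underlying module does not change, so morphisms are compared as equal sets of maps.\<close>

theorem proposition4p5:
  fixes C :: "('k::field_char_0, 'a::ab_group_add) dgmod"
    and P :: "('k, 'a) smod" and Q :: "('k, 'b::ab_group_add) smod"
    and \<Delta> :: "int \<Rightarrow> 'a \<Rightarrow> ('a, 'k) tensor" and \<epsilon> :: "int \<Rightarrow> 'a \<Rightarrow> 'k"
    and \<Delta>' :: "int \<Rightarrow> 'b \<Rightarrow> ('b, 'k) tensor" and \<epsilon>' :: "int \<Rightarrow> 'b \<Rightarrow> 'k"
    and M :: "('k, 'm::ab_group_add) dgmod" and N :: "('k, 'n::ab_group_add) dgmod"
  shows
    "(dg_module C \<longrightarrow>
        concentrated_in_arity_one (in_arity_one C) \<and> arity (in_arity_one C) 1 = C)
     \<and>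
     (concentrated_in_arity_one P \<longrightarrow>
        dg_module (arity P 1) \<and>
        bij_betw (\<lambda>(\<Delta>, \<epsilon>). (cooperad_comult P \<Delta>, cooperad_counit \<epsilon>))
          {(\<Delta>, \<epsilon>). dg_coalgebra (arity P 1) \<Delta> \<epsilon>}
          {(\<Delta>, \<epsilon>). dg_cooperad P \<Delta> \<epsilon>})
     \<and>
     (concentrated_in_arity_one P \<and> concentrated_in_arity_one Q \<longrightarrow>
        bij_betw (\<lambda>f. f 1) (smod_mor P Q) (dg_mor (arity P 1) (arity Q 1)))
     \<and>
     (concentrated_in_arity_one P \<and> concentrated_in_arity_one Q \<and>
      dg_coalgebra (arity P 1) \<Delta> \<epsilon> \<and> dg_coalgebra (arity Q 1) \<Delta>' \<epsilon>' \<longrightarrow>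
        bij_betw (\<lambda>f. f 1)
          (cooperad_mor P (cooperad_comult P \<Delta>) (cooperad_counit \<epsilon>)
             Q (cooperad_comult Q \<Delta>') (cooperad_counit \<epsilon>'))
          (coalgebra_mor (arity P 1) \<Delta> \<epsilon> (arity Q 1) \<Delta>' \<epsilon>'))
     \<and>
     (concentrated_in_arity_one P \<and> dg_coalgebra (arity P 1) \<Delta> \<epsilon> \<longrightarrow>
        bij_betw (contramodule_action P M)
          {\<gamma>. dg_algebra P (cooperad_comult P \<Delta>) (cooperad_counit \<epsilon>) M \<gamma>}
          {\<gamma>. dg_contramodule (arity P 1) \<Delta> \<epsilon> M \<gamma>} \<and>
        (\<forall>\<gamma> \<delta>. dg_algebra P (cooperad_comult P \<Delta>) (cooperad_counit \<epsilon>) M \<gamma> \<and>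
               dg_algebra P (cooperad_comult P \<Delta>) (cooperad_counit \<epsilon>) N \<delta> \<longrightarrow>
           algebra_mor P M \<gamma> N \<delta>
             = contramodule_mor (arity P 1) M (contramodule_action P M \<gamma>)
                 N (contramodule_action P N \<delta>)))"
  unfolding One_nat_def
proof (intro conjI impI allI; (elim conjE)?)
  show "concentrated_in_arity_one (in_arity_one C)" if "dg_module C"
    by (rule concentrated_in_arity_one_in_arity_one[OF that])
  show "arity (in_arity_one C) (Suc 0) = C"
    by (simp add: in_arity_one_def)
next
  assume P: "concentrated_in_arity_one P"
  show "dg_module (arity P (Suc 0))" by (rule concentrated_dg_module[OF P])
  show "bij_betw (\<lambda>(\<Delta>, \<epsilon>). (cooperad_comult P \<Delta>, cooperad_counit \<epsilon>))
          {(\<Delta>, \<epsilon>). dg_coalgebra (arity P (Suc 0)) \<Delta> \<epsilon>} {(\<Delta>, \<epsilon>). dg_cooperad P \<Delta> \<epsilon>}"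
    by (rule bij_dg_cooperad[OF P])
next
  assume P: "concentrated_in_arity_one P" and Q: "concentrated_in_arity_one Q"
  show "bij_betw (\<lambda>f. f (Suc 0)) (smod_mor P Q) (dg_mor (arity P (Suc 0)) (arity Q (Suc 0)))"
    by (rule bij_smod_mor(1)[OF concentrated_arity_one[OF P] concentrated_arity_one[OF Q] concentrated_dif_0[OF Q]])
next
  assume P: "concentrated_in_arity_one P" and Q: "concentrated_in_arity_one Q"
    and c: "dg_coalgebra (arity P (Suc 0)) \<Delta> \<epsilon>" and c': "dg_coalgebra (arity Q (Suc 0)) \<Delta>' \<epsilon>'"
  show "bij_betw (\<lambda>f. f (Suc 0))
     (cooperad_mor P (cooperad_comult P \<Delta>) (cooperad_counit \<epsilon>) Q (cooperad_comult Q \<Delta>') (cooperad_counit \<epsilon>'))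
     (coalgebra_mor (arity P (Suc 0)) \<Delta> \<epsilon> (arity Q (Suc 0)) \<Delta>' \<epsilon>')"
    by (rule bij_cooperad_mor[OF P Q c c'])
next
  assume P: "concentrated_in_arity_one P" and c: "dg_coalgebra (arity P (Suc 0)) \<Delta> \<epsilon>"
  show "bij_betw (contramodule_action P M)
     {\<gamma>. dg_algebra P (cooperad_comult P \<Delta>) (cooperad_counit \<epsilon>) M \<gamma>}
     {\<gamma>. dg_contramodule (arity P (Suc 0)) \<Delta> \<epsilon> M \<gamma>}"
    by (rule bij_contramodule_action[OF P c])
next
  fix \<gamma> \<delta>
  assume P: "concentrated_in_arity_one P"
    and "dg_algebra P (cooperad_comult P \<Delta>) (cooperad_counit \<epsilon>) M \<gamma>"
    and "dg_algebra P (cooperad_comult P \<Delta>) (cooperad_counit \<epsilon>) N \<delta>"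
  then have "dg_module M" "dg_module N" by (simp_all add: dg_algebra_def)
  then show "algebra_mor P M \<gamma> N \<delta>
    = contramodule_mor (arity P (Suc 0)) M (contramodule_action P M \<gamma>) N (contramodule_action P N \<delta>)"
    by (rule algebra_mor_eq_contramodule_mor[OF P])
qed

end
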